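(* Let $Z$ be a perfect Polish space and let $P$ be a dynamical property. Then the set of actions in $A_\mu(G,X,\nu)$ having $P$ is residual in $A_\mu(G,X,\nu)$ endowed with the very weak topology if and only if the set of measures $\eta\in\mathcal{P}_\mu(Z^G)$ such that $G\curvearrowright(Z^G,\eta)$ has $P$ is residual in $\mathcal{P}_\mu(Z^G)$.
   Context: $G$ is a countable discrete group; $\mu$ is a probability measure on $G$ whose support generates $G$ as a semigroup. A dynamical property is a class of nonsingular $G$-actions on probability spaces that is invariant under measurable conjugacy (a $G$-equivariant measure-space isomorphism mod null sets). $G$ acts on $Z^G$ by $(gx)(k)=x(g^{-1}k)$; $\mathcal{P}_\mu(Z^G)$ is the set of Borel probability measures $\eta$ on $Z^G$ with $\sum_g\mu(g)g_*\eta=\eta$, with the weak* topology. $(X,\nu)$ is a standard nonatomic Lebesgue probability space; $\mathrm{Aut}^*(X,\nu)$ is the group of invertible nonsingular transformations of $(X,\nu)$ mod a.e. equality. For $T\in\mathrm{Aut}^*(X,\nu)$, $U_{T,1}f=\frac{dT_*\nu}{d\nu}\cdot f\circ T^{-1}$. The very weak topology on $\mathrm{Aut}^*(X,\nu)$ (induced by the weak operator topology on isometries of $L^1$) is given by $T_n\to T$ iff $\int U_{T_n,1}\mathbf 1_A\cdot\mathbf 1_B\,d\nu\to\int U_{T,1}\mathbf 1_A\cdot\mathbf 1_B\,d\nu$ for all measurable $A,B$. $A_\mu(G,X,\nu)$ is the set of homomorphisms $a:G\to\mathrm{Aut}^*(X,\nu)$ with $\sum_g\mu(g)a(g)_*\nu=\nu$,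 topologized by pointwise convergence. Residual means containing a countable intersection of dense open sets. *)

theory Defs
  imports "HOL-Analysis.Analysis" "HOL-Probability.Probability"
begin

text \<open>Groups are written additively: the countable discrete group G is a type
  of class group_add (not necessarily commutative) and countable.\<close>

inductive_set gen_semigroup :: "'g::group_add set \<Rightarrow> 'g set" for S where
  base: "s \<in> S \<Longrightarrow> s \<in> gen_semigroup S"
| plus: "a \<in> gen_semigroup S \<Longrightarrow> b \<in> gen_semigroup S \<Longrightarrow> a + b \<in> gen_semigroup S"

definition residual_in :: "'a topology \<Rightarrow> 'a set \<Rightarrow> bool" where
  "residual_in T S \<longleftrightarrow>
     (\<exists>U :: nat \<Rightarrow> 'a set. (\<forall>n. openin T (U n) \<and> T closure_of (U n) = topspace T)
        \<and> (\<Inter>n. U n) \<subseteq> S)"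

definition nonsingular_action :: "'a measure \<Rightarrow> ('g::group_add \<Rightarrow> 'a \<Rightarrow> 'a) \<Rightarrow> bool" where
  "nonsingular_action M \<alpha> \<longleftrightarrow> prob_space M \<and>
     (\<forall>g. \<alpha> g \<in> measurable M M \<and>
          (\<forall>A\<in>sets M. emeasure M (\<alpha> g -` A \<inter> space M) = 0 \<longleftrightarrow> emeasure M A = 0)) \<and>
     (AE x in M. \<alpha> 0 x = x) \<and>
     (\<forall>g h. AE x in M. \<alpha> (g + h) x = \<alpha> g (\<alpha> h x))"

definition conjugate ::
  "'a measure \<Rightarrow> ('g::group_add \<Rightarrow> 'a \<Rightarrow> 'a) \<Rightarrow> 'b measure \<Rightarrow> ('g \<Rightarrow> 'b \<Rightarrow> 'b) \<Rightarrow> bool" where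
  "conjugate M1 \<alpha>1 M2 \<alpha>2 \<longleftrightarrow> nonsingular_action M1 \<alpha>1 \<and> nonsingular_action M2 \<alpha>2 \<and>
     (\<exists>\<phi> \<psi>. \<phi> \<in> measurable M1 M2 \<and> \<psi> \<in> measurable M2 M1 \<and> distr M1 M2 \<phi> = M2 \<and>
        (AE x in M1. \<psi> (\<phi> x) = x) \<and> (AE y in M2. \<phi> (\<psi> y) = y) \<and>
        (\<forall>g. AE x in M1. \<phi> (\<alpha>1 g x) = \<alpha>2 g (\<phi> x)))"

text \<open>A dynamical property P, given by its restrictions PX (actions on the type of X)
  and PZ (actions on the type of Z^G): a class of nonsingular actions invariant under
  measurable conjugacy (within each type and across the two types).\<close>
definition dynamical_property ::
  "('a measure \<Rightarrow> ('g::group_add \<Rightarrow> 'a \<Rightarrow> 'a) \<Rightarrow> bool) \<Rightarrow>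
   ('b measure \<Rightarrow> ('g \<Rightarrow> 'b \<Rightarrow> 'b) \<Rightarrow> bool) \<Rightarrow> bool" where
  "dynamical_property PX PZ \<longleftrightarrow>
     (\<forall>M \<alpha>. PX M \<alpha> \<longrightarrow> nonsingular_action M \<alpha>) \<and>
     (\<forall>M \<alpha>. PZ M \<alpha> \<longrightarrow> nonsingular_action M \<alpha>) \<and>
     (\<forall>M1 \<alpha>1 M2 \<alpha>2. conjugate M1 \<alpha>1 M2 \<alpha>2 \<longrightarrow> (PX M1 \<alpha>1 \<longleftrightarrow> PX M2 \<alpha>2)) \<and>
     (\<forall>M1 \<alpha>1 M2 \<alpha>2. conjugate M1 \<alpha>1 M2 \<alpha>2 \<longrightarrow> (PZ M1 \<alpha>1 \<longleftrightarrow> PZ M2 \<alpha>2)) \<and>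
     (\<forall>M1 \<alpha>1 M2 \<alpha>2. conjugate M1 \<alpha>1 M2 \<alpha>2 \<longrightarrow> (PX M1 \<alpha>1 \<longleftrightarrow> PZ M2 \<alpha>2))"

definition shift_action :: "'g::group_add \<Rightarrow> ('g \<Rightarrow> 'z) \<Rightarrow> ('g \<Rightarrow> 'z)" where
  "shift_action g x = (\<lambda>k. x (- g + k))"

definition P_mu :: "'g::{group_add,countable} pmf \<Rightarrow> ('g \<Rightarrow> 'z::topological_space) measure set" where
  "P_mu \<mu> = {\<eta>. sets \<eta> = sets (borel :: ('g \<Rightarrow> 'z) measure) \<and> prob_space \<eta> \<and>
     (\<forall>E\<in>sets \<eta>. emeasure \<eta> E =
        (\<integral>\<^sup>+ g. emeasure (distr \<eta> borel (shift_action g)) E \<partial>(measure_pmf \<mu>)))}"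

definition P_mu_topology :: "'g::{group_add,countable} pmf \<Rightarrow> ('g \<Rightarrow> 'z::topological_space) measure topology" where
  "P_mu_topology \<mu> = pullback_topology (P_mu \<mu>)
     (\<lambda>\<eta> (f :: ('g \<Rightarrow> 'z) \<Rightarrow> real).
        if continuous_on UNIV f \<and> bounded (range f) then (\<integral>x. f x \<partial>\<eta>) else 0)
     euclidean"

text \<open>Aut*(X,nu): invertible nonsingular transformations (representatives).\<close>
definition aut_star :: "'a measure \<Rightarrow> ('a \<Rightarrow> 'a) set" where
  "aut_star M = {T. T \<in> measurable M M \<and>
     (\<forall>A\<in>sets M. emeasure M (T -` A \<inter> space M) = 0 \<longleftrightarrow> emeasure M A = 0) \<and>
     (\<exists>S. S \<in> measurable M M \<and> (AE x in M. S (T x) = x) \<and> (AE x in M. T (S x) = x))}"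

definition aut_inv :: "'a measure \<Rightarrow> ('a \<Rightarrow> 'a) \<Rightarrow> ('a \<Rightarrow> 'a)" where
  "aut_inv M T = (SOME S. S \<in> measurable M M \<and> (AE x in M. S (T x) = x) \<and> (AE x in M. T (S x) = x))"

definition U1 :: "'a measure \<Rightarrow> ('a \<Rightarrow> 'a) \<Rightarrow> ('a \<Rightarrow> real) \<Rightarrow> 'a \<Rightarrow> real" where
  "U1 M T f x = enn2real (RN_deriv M (distr M M T) x) * f (aut_inv M T x)"

definition very_weak_coords :: "'a measure \<Rightarrow> ('a \<Rightarrow> 'a) \<Rightarrow> ('a set \<times> 'a set \<Rightarrow> real)" where
  "very_weak_coords M T = (\<lambda>(A, B). if A \<in> sets M \<and> B \<in> sets M
      then (\<integral>x. U1 M T (indicator A) x * indicator B x \<partial>M) else 0)"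

definition very_weak_topology :: "'a measure \<Rightarrow> ('a \<Rightarrow> 'a) topology" where
  "very_weak_topology M = pullback_topology (aut_star M) (very_weak_coords M) euclidean"

definition A_mu :: "'g::group_add pmf \<Rightarrow> 'a measure \<Rightarrow> ('g \<Rightarrow> 'a \<Rightarrow> 'a) set" where
  "A_mu \<mu> M = {a. (\<forall>g. a g \<in> aut_star M) \<and>
     (\<forall>g h. AE x in M. a (g + h) x = a g (a h x)) \<and>
     (\<forall>E\<in>sets M. emeasure M E =
        (\<integral>\<^sup>+ g. emeasure (distr M M (a g)) E \<partial>(measure_pmf \<mu>)))}"

definition A_mu_topology :: "'g::group_add pmf \<Rightarrow> 'a measure \<Rightarrow> ('g \<Rightarrow> 'a \<Rightarrow> 'a) topology" where
  "A_mu_topology \<mu> M = subtopology (product_topology (\<lambda>g. very_weak_topology M) UNIV) (A_mu \<mu> M)"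

end

theory Submission
  imports Defs
begin

text \<open>
  For a measurable map \<open>f : X \<rightarrow> Z\<close> the law of the orbit map \<open>x \<mapsto> (f (a(k)\<^sup>-\<^sup>1 x))\<^sub>k\<close> is a
  stationary measure on \<open>Z\<^sup>G\<close>, conjugate to the action \<open>a\<close> as soon as \<open>f\<close> is almost everywhere
  injective. Generically a stationary measure \<open>\<eta>\<close> has a nonatomic zeroth marginal \<open>\<lambda>\<close> and is
  generated by its zeroth coordinate; such an \<open>\<eta>\<close> is an orbit law for the quantile isomorphism
  \<open>f\<^sub>\<lambda> : (X, \<nu>) \<rightarrow> (Z, \<lambda>)\<close>, and both \<open>f\<^sub>\<lambda>\<close> and the action depend continuously on \<open>\<eta>\<close>. Hence
  generic stationary measures look like a product of the space of actions with the space of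
  marginals. This gives one direction at once; for the other, a Kuratowski--Ulam argument chooses
  one generic \<open>f\<close>, using the Baire category theorem for convergence in measure on maps \<open>X \<rightarrow> Z\<close>.
\<close>

section \<open>Coding points of Polish spaces by real numbers\<close>

text \<open>The semigroup hypothesis enters through one inequality: for each \<open>g\<close> there
  is a constant, the same for all stationary actions, by which preimages under \<open>g\<close> can
  at most enlarge the measure. It carries almost everywhere statements along orbits, and it
  dominates limits well enough that countably many rational thresholds describe the very weak
  topology. The obstacle is that the code of a point, and with it the quantile isomorphism, jumps on
  the frontiers of the basic open sets. Laws charging \<open>frontiers\<close> are therefore
  excluded, and continuity is claimed only among measures whose zeroth law is a
  \<open>good_law\<close>. Perfectness of Z gives room for injective maps: a Cantor set missing all
  frontiers fits into every nonempty open set. The isomorphisms attached to varying laws do not form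
  an evidently complete space. The category argument therefore runs in the space of all measurable
  maps, with the centres of the shrinking balls kept among the isomorphisms; only afterwards is the
  limit map recognised as the isomorphism onto its own law.\<close>

text \<open>Ternary expansions with digits 0 and 1 only: the gaps make the digits locally constant on codes.\<close>

definition code3 :: "(nat \<Rightarrow> bool) \<Rightarrow> real" where
  "code3 s = (\<Sum>n. of_bool (s n) * (1/3)^n)"

definition digit3 :: "nat \<Rightarrow> real \<Rightarrow> bool" where
  "digit3 n t \<longleftrightarrow> \<lfloor>3^n * t\<rfloor> mod 3 = 1"

lemma summable_code3: "summable (\<lambda>n. of_bool (s n) * (1/3::real)^n)"
  by (rule summable_comparison_test'[of "\<lambda>n. (1/3::real)^n"]) (auto simp: summable_geometric_iff)

lemma code3_bounds: "0 \<le> code3 s" "code3 s \<le> 3/2"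
proof -
  show "0 \<le> code3 s" unfolding code3_def by (rule suminf_nonneg[OF summable_code3]) auto
  have "code3 s \<le> (\<Sum>n. (1/3::real)^n)" unfolding code3_def
    by (rule suminf_le[OF _ summable_code3]) (auto simp: summable_geometric_iff)
  also have "\<dots> = 3/2" by (subst suminf_geometric) auto
  finally show "code3 s \<le> 3/2" .
qed

lemma code3_shift: "code3 s = of_bool (s 0) + code3 (\<lambda>n. s (Suc n)) / 3"
proof -
  have "code3 s = of_bool (s 0) + (\<Sum>n. of_bool (s (Suc n)) * (1/3)^Suc n)"
    unfolding code3_def using suminf_split_head[OF summable_code3[of s]] by simp
  also have "(\<Sum>n. of_bool (s (Suc n)) * (1/3::real)^Suc n) = (\<Sum>n. of_bool (s (Suc n)) * (1/3)^n / 3)"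
    by (simp add: field_simps)
  also have "\<dots> = code3 (\<lambda>n. s (Suc n)) / 3"
    unfolding code3_def by (rule suminf_divide[OF summable_code3])
  finally show ?thesis .
qed

text \<open>Multiplying by \<open>3^n\<close> shifts the expansion by \<open>n\<close> places. The
  part shifted out is a multiple of 3, so the residue modulo 3 of the floor sees only digit
  \<open>n\<close>, which is the head of the remaining tail.\<close>

lemma code3_integer_part:
  "\<exists>k::int. 3^n * code3 s = of_int (3 * k) + code3 (\<lambda>i. s (i + n))"
proof (induction n)
  case 0
  show ?case by (rule exI[of _ 0]) simp
next
  case (Suc n)
  then obtain k where k: "3^n * code3 s = of_int (3 * k) + code3 (\<lambda>i. s (i + n))" by blast
  have "3^Suc n * code3 s = 3 * (of_int (3 * k) + (of_bool (s n) + code3 (\<lambda>i. s (i + Suc n)) / 3))"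
    using k code3_shift[of "\<lambda>i. s (i + n)"] by simp
  also have "\<dots> = of_int (3 * (3 * k + of_bool (s n))) + code3 (\<lambda>i. s (i + Suc n))"
    by (simp add: algebra_simps)
  finally show ?case by blast
qed

text \<open>What follows digit \<open>n\<close> is a third of a code, hence at most 1/2. Scaled
  codes thus stay in the left half of their unit interval, and the free right half is the gap that
  \<open>code3_close\<close> exploits.\<close>

lemma code3_floor:
  "\<exists>k::int. \<lfloor>3^n * code3 s\<rfloor> = 3 * k + of_bool (s n)
     \<and> 3^n * code3 s \<le> of_int \<lfloor>3^n * code3 s\<rfloor> + 1/2"
proof -
  obtain k where k: "3^n * code3 s = of_int (3 * k) + code3 (\<lambda>i. s (i + n))"
    using code3_integer_part by blast
  have *: "3^n * code3 s = of_int (3 * k + of_bool (s n)) + code3 (\<lambda>i. s (i + Suc n)) / 3"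
    using k code3_shift[of "\<lambda>i. s (i + n)"] by simp
  have b: "0 \<le> code3 (\<lambda>i. s (i + Suc n)) / 3" "code3 (\<lambda>i. s (i + Suc n)) / 3 \<le> 1/2"
    using code3_bounds[of "\<lambda>i. s (i + Suc n)"] by auto
  have "\<lfloor>3^n * code3 s\<rfloor> = 3 * k + of_bool (s n)"
    using * b by (intro floor_unique) linarith+
  then show ?thesis using * b by (intro exI[of _ k]) simp
qed

lemma digit3_code3: "digit3 n (code3 s) = s n"
proof -
  obtain k where "\<lfloor>3^n * code3 s\<rfloor> = 3 * k + of_bool (s n)" using code3_floor by blast
  then show ?thesis unfolding digit3_def by (cases "s n") auto
qed

text \<open>After scaling by \<open>3^n\<close> both codes lie in left halves of unit intervals. At
  distance below 1/2 their floors differ by less than 1, so the floors and the digits read from them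
  agree.\<close>

lemma code3_close:
  assumes "\<bar>code3 s - code3 s'\<bar> < (1/2) * (1/3)^n"
  shows "s n = s' n"
proof -
  define F where "F = \<lfloor>3^n * code3 s\<rfloor>"
  define F' where "F' = \<lfloor>3^n * code3 s'\<rfloor>"
  have 1: "of_int F \<le> 3^n * code3 s" "3^n * code3 s \<le> of_int F + 1/2"
    "of_int F' \<le> 3^n * code3 s'" "3^n * code3 s' \<le> of_int F' + 1/2"
    unfolding F_def F'_def using code3_floor by auto
  have "\<bar>3^n * code3 s - 3^n * code3 s'\<bar> = 3^n * \<bar>code3 s - code3 s'\<bar>"
    by (simp add: right_diff_distrib[symmetric] abs_mult)
  also have "\<dots> < 3^n * ((1/2) * (1/3)^n)" using assms by simp
  also have "\<dots> = 1/2" by (simp add: power_divide)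
  finally have "\<bar>real_of_int F - real_of_int F'\<bar> < 1" using 1 by linarith
  then have "F = F'" by linarith
  then show ?thesis using digit3_code3[of n s] digit3_code3[of n s'] unfolding digit3_def F_def F'_def by simp
qed

lemma measurable_code3 [measurable]:
  assumes [measurable]: "\<And>n. Measurable.pred M (\<lambda>x. s x n)"
  shows "(\<lambda>x. code3 (s x)) \<in> borel_measurable M"
  unfolding code3_def by measurable

lemma measurable_digit3 [measurable]: "Measurable.pred borel (digit3 n)"
  unfolding digit3_def by measurable

section \<open>Codes of points through a countable basis\<close>

definition base_set :: "nat \<Rightarrow> 'a::second_countable_topology set" where
  "base_set = from_nat_into (SOME B. countable B \<and> topological_basis B)"

lemma base_set:
  fixes x :: "'a::second_countable_topology"
  shows open_base_set: "open (base_set n :: 'a set)"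
    and base_set_neighborhood: "open U \<Longrightarrow> x \<in> U \<Longrightarrow> \<exists>n. x \<in> base_set n \<and> base_set n \<subseteq> U"
proof -
  define B :: "'a set set" where "B = (SOME B. countable B \<and> topological_basis B)"
  have B: "countable B" "topological_basis B"
    unfolding B_def using ex_countable_basis someI_ex[of "\<lambda>B :: 'a set set. countable B \<and> topological_basis B"] by blast+
  have ne: "B \<noteq> {}" using B(2) topological_basisE[of B UNIV] by blast
  have b: "base_set = from_nat_into B" unfolding base_set_def B_def ..
  show "open (base_set n :: 'a set)"
    unfolding b using from_nat_into[OF ne] B(2) topological_basis_open by blast
  assume U: "open U" "x \<in> U"
  then obtain b' where "b' \<in> B" "x \<in> b'" "b' \<subseteq> U" using B(2) by (meson topological_basisE)
  then show "\<exists>n. x \<in> base_set n \<and> base_set n \<subseteq> U" unfolding b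
    by (metis B(1) from_nat_into_surj)
qed

definition hcode :: "'a::second_countable_topology \<Rightarrow> real" where
  "hcode x = code3 (\<lambda>n. x \<in> base_set n)"

text \<open>Picks a point of the first basic set that is listed in the code and small enough. On
  reals that are not codes \<open>LEAST\<close> and \<open>SOME\<close> return arbitrary values;
  only totality and measurability matter there.\<close>

definition decode_approx :: "real \<Rightarrow> nat \<Rightarrow> 'a::polish_space" where
  "decode_approx t j =
     (SOME x. x \<in> base_set (LEAST n. digit3 n t \<and> (\<exists>c :: 'a. base_set n \<subseteq> ball c (1 / real (Suc j)))))"

definition decode :: "real \<Rightarrow> 'a::polish_space" where
  "decode t = (if Cauchy (decode_approx t :: nat \<Rightarrow> 'a) then lim (decode_approx t) else undefined)"

lemma hcode_bounds: "0 \<le> hcode x" "hcode x \<le> 3/2"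
  unfolding hcode_def by (rule code3_bounds)+

lemma measurable_hcode [measurable]: "hcode \<in> borel_measurable borel"
  unfolding hcode_def by (rule measurable_code3) (simp add: pred_def open_base_set)

text \<open>The chosen basic set contains \<open>x\<close> and fits into a ball of radius
  \<open>1 / Suc j\<close>, so the \<open>j\<close>-th approximation is within
  \<open>2 / Suc j\<close> of \<open>x\<close>.\<close>

lemma decode_hcode [simp]: "decode (hcode x) = (x :: 'a::polish_space)"
proof -
  have "dist (decode_approx (hcode x) j :: 'a) x < 2 / real (Suc j)" for j
  proof -
    define P where "P n \<longleftrightarrow> x \<in> base_set n \<and> (\<exists>c :: 'a. base_set n \<subseteq> ball c (1 / real (Suc j)))" for n
    obtain n where "x \<in> base_set n" "base_set n \<subseteq> ball x (1 / real (Suc j))"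
      using base_set_neighborhood[of "ball x (1 / real (Suc j))" x] by auto
    then have "P n" unfolding P_def by blast
    define N where "N = (LEAST n. P n)"
    have "P N" unfolding N_def using \<open>P n\<close> by (rule LeastI)
    have N: "decode_approx (hcode x) j = (SOME y. y \<in> (base_set N :: 'a set))"
      unfolding decode_approx_def N_def P_def hcode_def digit3_code3 ..
    have x: "x \<in> base_set N" using \<open>P N\<close> unfolding P_def by blast
    then have "decode_approx (hcode x) j \<in> (base_set N :: 'a set)" unfolding N by (rule someI)
    then show ?thesis using \<open>P N\<close> x unfolding P_def
      by (auto simp: subset_eq) (smt (verit, best) add_divide_distrib dist_commute dist_triangle)
  qed
  note * = this
  have lim: "(\<lambda>j. decode_approx (hcode x) j :: 'a) \<longlonglongrightarrow> x"
  proof (rule metric_tendsto_imp_tendsto[where f = "\<lambda>j. 2 / real (Suc j)" and a = 0])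
    show "(\<lambda>j. 2 / real (Suc j)) \<longlonglongrightarrow> 0"
      using LIMSEQ_Suc[OF lim_const_over_n[of "2::real"]] by simp
    show "\<forall>\<^sub>F j in sequentially. dist (decode_approx (hcode x) j) x \<le> dist (2 / real (Suc j)) 0"
      using * less_imp_le by (intro always_eventually allI) fastforce
  qed
  then have "Cauchy (decode_approx (hcode x) :: nat \<Rightarrow> 'a)" by (rule LIMSEQ_imp_Cauchy)
  then show ?thesis unfolding decode_def using limI[OF lim] by simp
qed

lemma hcode_eq_iff [simp]: "hcode x = hcode y \<longleftrightarrow> x = (y :: 'a::polish_space)"
  by (metis decode_hcode)

text \<open>The map factors through the natural number found by \<open>LEAST\<close>, and every map
  out of a countable discrete space is measurable; no measurable choice is involved.\<close>

lemma measurable_decode_approx [measurable]: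
  "(\<lambda>t. decode_approx t j :: 'a::polish_space) \<in> borel_measurable borel"
proof -
  have [measurable]: "Measurable.pred borel (\<lambda>t. digit3 n t \<and> (\<exists>c :: 'a. base_set n \<subseteq> ball c (1 / real (Suc j))))" for n
    by measurable
  have "(\<lambda>t. LEAST n. digit3 n t \<and> (\<exists>c :: 'a. base_set n \<subseteq> ball c (1 / real (Suc j)))) \<in> borel \<rightarrow>\<^sub>M count_space UNIV"
    by measurable
  from measurable_compose[OF this measurable_count_space, of "\<lambda>n. (SOME x. x \<in> (base_set n :: 'a set))"]
  show ?thesis unfolding decode_approx_def
    by (rule measurable_compose) auto
qed

text \<open>The library's measurability rule for limits is restricted to Banach spaces.\<close>

lemma borel_measurable_lim_polish:
  fixes f :: "nat \<Rightarrow> 'b \<Rightarrow> 'a::polish_space"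
  assumes [measurable]: "\<And>i. f i \<in> borel_measurable M"
  shows "(\<lambda>x. if Cauchy (\<lambda>i. f i x) then lim (\<lambda>i. f i x) else c) \<in> borel_measurable M"
proof (rule borel_measurable_LIMSEQ_metric)
  show "(\<lambda>x. if Cauchy (\<lambda>i. f i x) then f i x else c) \<in> borel_measurable M" for i
    by measurable
  show "(\<lambda>i. if Cauchy (\<lambda>i. f i x) then f i x else c) \<longlonglongrightarrow>
      (if Cauchy (\<lambda>i. f i x) then lim (\<lambda>i. f i x) else c)" for x
    by (auto dest: Cauchy_convergent simp: convergent_LIMSEQ_iff)
qed

lemma measurable_decode [measurable]: "decode \<in> borel_measurable borel"
  unfolding decode_def by (rule borel_measurable_lim_polish) measurable

text \<open>The set of points where some digit of \<open>hcode\<close> may jump.\<close>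

definition frontiers :: "'a::second_countable_topology set" where
  "frontiers = (\<Union>n. frontier (base_set n))"

lemma frontiers_borel [measurable]: "frontiers \<in> sets borel"
  unfolding frontiers_def by auto

text \<open>Off the frontiers each digit is locally constant, and the geometric majorant
  \<open>(1/3)^n\<close> lets Tannery's theorem sum the digitwise limits.\<close>

lemma isCont_hcode:
  fixes x :: "'a::polish_space"
  assumes "x \<notin> frontiers"
  shows "isCont hcode x"
proof -
  have "((\<lambda>y. \<Sum>n. of_bool (y \<in> base_set n) * (1/3::real)^n) \<longlongrightarrow> (\<Sum>n. of_bool (x \<in> base_set n) * (1/3)^n)) (at x)"
  proof (cases "at x = bot")
    case False
    show ?thesis
    proof (rule tannerys_theorem[where M = "\<lambda>n. (1/3::real)^n", THEN conjunct2, THEN conjunct2])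
      show "((\<lambda>y. of_bool (y \<in> base_set n) * (1/3::real)^n) \<longlongrightarrow> of_bool (x \<in> base_set n) * (1/3)^n) (at x)" for n
      proof -
        have "x \<notin> frontier (base_set n)" using assms unfolding frontiers_def by blast
        then have "x \<in> base_set n \<or> x \<in> - closure (base_set n)"
            using open_base_set[of n] interior_subset[of "base_set n"] by (auto simp: frontier_def interior_open)
        then have "\<forall>\<^sub>F y in at x. (y \<in> base_set n) = (x \<in> base_set n)"
        proof
          assume "x \<in> base_set n"
          then show ?thesis using eventually_at_in_open'[OF open_base_set[of n]] by auto
        next
          assume x: "x \<in> - closure (base_set n)"
          have "x \<notin> base_set n" using x closure_subset by blast
          moreover have "\<forall>\<^sub>F y in at x. y \<in> - closure (base_set n)"
            by (rule eventually_at_in_open'[OF open_Compl[OF closed_closure] x])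
          ultimately show ?thesis using closure_subset[of "base_set n"] by (auto elim!: eventually_mono)
        qed
        then show ?thesis by (intro tendsto_eventually) (auto elim!: eventually_mono)
      qed
      show "\<forall>\<^sub>F (n, y) in at_top \<times>\<^sub>F at x. norm (of_bool (y \<in> base_set n) * (1/3::real)^n) \<le> (1/3)^n"
        by (intro always_eventually) auto
    qed (use False in \<open>auto simp: summable_geometric_iff\<close>)
  qed simp
  then show ?thesis unfolding isCont_def hcode_def code3_def .
qed

text \<open>This direction has no exceptional points: close codes share digit \<open>n\<close>, so
  the sequence enters every basic neighbourhood of \<open>x\<close>.\<close>

lemma tendsto_of_hcode:
  fixes x :: "'a::polish_space"
  assumes "(\<lambda>k. hcode (X k)) \<longlonglongrightarrow> hcode x"
  shows "X \<longlonglongrightarrow> x"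
proof (rule topological_tendstoI)
  fix U assume "open U" "x \<in> U"
  then obtain n where n: "x \<in> base_set n" "base_set n \<subseteq> U" using base_set_neighborhood by blast
  have "\<forall>\<^sub>F k in sequentially. dist (hcode (X k)) (hcode x) < (1/2) * (1/3)^n"
    using assms by (rule tendstoD) simp
  then show "\<forall>\<^sub>F k in sequentially. X k \<in> U"
  proof eventually_elim
    case (elim k)
    then have "(X k \<in> base_set n) = (x \<in> base_set n)"
      unfolding hcode_def dist_real_def by (rule code3_close)
    then show ?case using n by blast
  qed
qed

section \<open>Quantile transforms of nonatomic probability measures\<close>

definition nonatomic_prob :: "'a::topological_space measure \<Rightarrow> bool" where
  "nonatomic_prob m \<longleftrightarrow> prob_space m \<and> sets m = sets borel \<and> (\<forall>x. measure m {x} = 0)"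

definition hlaw :: "'a::second_countable_topology measure \<Rightarrow> real measure" where
  "hlaw m = distr m borel hcode"

text \<open>The distribution function of the code, read at the point itself; for nonatomic
  \<open>m\<close> it carries \<open>m\<close> to \<open>unif\<close>, and \<open>sec m\<close>
  below inverts it almost everywhere.\<close>

definition rank :: "'a::second_countable_topology measure \<Rightarrow> 'a \<Rightarrow> real" where
  "rank m w = cdf (hlaw m) (hcode w)"

text \<open>The generalised inverse of the distribution function. The value 0 off the open unit
  interval is a default on a set that \<open>unif\<close> does not charge.\<close>

definition quant :: "'a::second_countable_topology measure \<Rightarrow> real \<Rightarrow> real" where
  "quant m u = (if u \<in> {0<..<1} then Inf {t. u \<le> cdf (hlaw m) t} else 0)"

definition sec :: "'a::polish_space measure \<Rightarrow> real \<Rightarrow> 'a" where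
  "sec m u = decode (quant m u)"

text \<open>Lebesgue measure on the open unit interval, pushed forward by the identity so that its
  space is the whole line and its sets are the Borel sets.\<close>

definition unif :: "real measure" where
  "unif = distr (restrict_space lborel {0<..<1}) borel (\<lambda>u. u)"

lemma sets_unif [simp, measurable_cong]: "sets unif = sets borel"
  by (simp add: unif_def)

lemma space_unif [simp]: "space unif = UNIV"
  by (simp add: unif_def)

lemma measurable_id_restrict: "(\<lambda>u. u) \<in> borel_measurable (restrict_space lborel {0<..<1::real})"
  by (rule measurable_restrict_space1) auto

lemma prob_space_unif: "prob_space unif"
proof -
  interpret prob_space "restrict_space lborel {0<..<1::real}"
    by (auto simp: space_restrict_space emeasure_restrict_space intro!: prob_spaceI)
  show ?thesis unfolding unif_def by (rule prob_space_distr[OF measurable_id_restrict])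
qed

lemma AE_unif_iff: "{x. P x} \<in> sets borel \<Longrightarrow> (AE u in unif. P u) \<longleftrightarrow> (AE u in lborel. u \<in> {0<..<1} \<longrightarrow> P u)"
  unfolding unif_def by (subst AE_distr_iff[OF measurable_id_restrict])
    (auto simp: AE_restrict_space_iff)

lemma AE_unif_interval: "AE u in unif. u \<in> {0<..<1}"
  by (subst AE_unif_iff) auto

lemma AE_unif_countable: "countable A \<Longrightarrow> AE u in unif. u \<notin> A"
proof -
  assume A: "countable A"
  have "A \<in> sets borel" by (rule sets.countable[OF _ A]) auto
  then have "{x. x \<notin> A} \<in> sets borel"
    using borel_comp[of A] by (simp add: Compl_eq)
  moreover have "AE u in lborel. u \<notin> A"
    by (rule AE_not_in[OF countable_imp_null_set_lborel[OF A]])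
  ultimately show ?thesis by (subst AE_unif_iff) auto
qed

lemma real_distribution_hlaw: "nonatomic_prob m \<Longrightarrow> real_distribution (hlaw m)"
  unfolding nonatomic_prob_def hlaw_def
  by (intro real_distribution.intro prob_space.prob_space_distr real_distribution_axioms.intro) auto

lemma measurable_nonatomic_prob:
  assumes "nonatomic_prob m"
  shows "measurable m N = measurable borel N" "measurable N m = measurable N borel"
proof -
  have "sets m = sets borel" using assms unfolding nonatomic_prob_def by blast
  from measurable_cong_sets[OF this refl] measurable_cong_sets[OF refl this]
  show "measurable m N = measurable borel N" "measurable N m = measurable N borel" by blast+
qed

lemma space_nonatomic_prob: "nonatomic_prob m \<Longrightarrow> space m = UNIV"
  unfolding nonatomic_prob_def by (metis sets_eq_imp_space_eq space_borel)

lemma measure_hlaw_singleton: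
  fixes m :: "'a::polish_space measure"
  assumes "nonatomic_prob m"
  shows "measure (hlaw m) {t} = 0"
proof -
  have "measure (hlaw m) {t} = measure m (hcode -` {t} \<inter> space m)"
    unfolding hlaw_def by (rule measure_distr) (auto simp: measurable_nonatomic_prob[OF assms])
  also have "\<dots> = 0"
  proof (cases "\<exists>x :: 'a. hcode x = t")
    case True
    then obtain x :: 'a where "hcode x = t" by blast
    then have "hcode -` {t} = {x}" by auto
    then show ?thesis using assms unfolding nonatomic_prob_def
      by (metis Int_UNIV_right assms space_nonatomic_prob)
  qed (auto simp: vimage_def)
  finally show ?thesis .
qed

lemma measurable_cdf [measurable]: "real_distribution M \<Longrightarrow> cdf M \<in> borel_measurable borel"
  by (intro borel_measurable_mono monoI)
     (metis finite_borel_measure.cdf_nondecreasing real_distribution.finite_borel_measure_M)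

context
  fixes m :: "'a::polish_space measure"
  assumes m: "nonatomic_prob m"
begin

interpretation H: cdf_distribution "hlaw m"
  unfolding cdf_distribution_def using real_distribution_hlaw[OF m] .

lemma isCont_cdf_hlaw: "isCont (cdf (hlaw m)) t"
  using H.isCont_cdf measure_hlaw_singleton[OF m] by blast

lemma quant_le_iff: "0 < u \<Longrightarrow> u < 1 \<Longrightarrow> quant m u \<le> t \<longleftrightarrow> u \<le> cdf (hlaw m) t"
  unfolding quant_def using H.pseudoinverse[of u t] by auto

lemma measurable_quant [measurable]: "quant m \<in> borel_measurable borel"
proof -
  have "{u \<in> space borel. u \<in> {0<..<1::real}} = {0<..<1}" by auto
  then have "quant m \<in> borel_measurable borel \<longleftrightarrow> H.I \<in> borel_measurable (restrict_space borel {0<..<1})"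
    unfolding quant_def by (subst measurable_If_restrict_space_iff) (auto simp del: greaterThanLessThan_iff)
  then show ?thesis using H.measurable_CI by blast
qed

lemma measurable_sec [measurable]: "sec m \<in> borel_measurable borel"
  unfolding sec_def by measurable

lemma measurable_rank [measurable]: "rank m \<in> borel_measurable borel"
  unfolding rank_def using measurable_cdf[OF real_distribution_hlaw[OF m]] by measurable

lemma distr_quant: "distr unif borel (quant m) = hlaw m"
proof -
  have "distr unif borel (quant m) = distr (restrict_space lborel {0<..<1}) borel (quant m)"
    unfolding unif_def by (subst distr_distr) (auto simp: measurable_id_restrict comp_def)
  also have "\<dots> = distr (restrict_space lborel {0<..<1}) borel H.I"
    by (rule distr_cong) (auto simp: quant_def space_restrict_space)
  also have "\<dots> = hlaw m" by (rule H.distr_I_eq_M)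
  finally show ?thesis .
qed

text \<open>One inequality is the Galois connection \<open>quant_le_iff\<close>. For the other, the
  distribution function is at most \<open>u\<close> to the left of the quantile, and nonatomicity
  makes it continuous there.\<close>

lemma cdf_quant:
  assumes "0 < u" "u < 1"
  shows "cdf (hlaw m) (quant m u) = u"
proof (rule antisym)
  show "u \<le> cdf (hlaw m) (quant m u)" using quant_le_iff[OF assms, of "quant m u"] by simp
  have "(cdf (hlaw m) \<longlongrightarrow> cdf (hlaw m) (quant m u)) (at_left (quant m u))"
    using isCont_cdf_hlaw by (simp add: filterlim_at_split isCont_def)
  moreover have "\<forall>\<^sub>F t in at_left (quant m u). cdf (hlaw m) t \<le> u"
  proof -
    have "cdf (hlaw m) t \<le> u" if "t < quant m u" for t
      using quant_le_iff[OF assms, of t] that by linarith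
    then show ?thesis by (auto simp: eventually_at_filter)
  qed
  ultimately show "cdf (hlaw m) (quant m u) \<le> u"
    by (rule tendsto_upperbound) simp
qed

text \<open>The code of an \<open>m\<close>-random point has the law of \<open>quant m\<close> under
  \<open>unif\<close>, and there the distribution function simply returns \<open>u\<close>.\<close>

lemma distr_rank: "distr m borel (rank m) = unif"
proof -
  have [measurable]: "cdf (hlaw m) \<in> borel_measurable borel" by (rule H.measurable_C)
  have "distr m borel (rank m) = distr (distr m borel hcode) borel (cdf (hlaw m))"
    by (subst distr_distr) (auto simp: measurable_nonatomic_prob[OF m] comp_def rank_def[abs_def])
  also have "\<dots> = distr (distr unif borel (quant m)) borel (cdf (hlaw m))"
    unfolding hlaw_def[of m, symmetric] distr_quant ..
  also have "\<dots> = distr unif borel (\<lambda>u. cdf (hlaw m) (quant m u))"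
    by (subst distr_distr) (auto simp: comp_def)
  also have "\<dots> = distr unif borel (\<lambda>u. u)"
  proof (rule distr_cong_AE)
    show "AE u in unif. cdf (hlaw m) (quant m u) = u"
      using AE_unif_interval by eventually_elim (simp add: cdf_quant)
  qed auto
  also have "\<dots> = unif" by (rule distr_id2) simp
  finally show ?thesis .
qed

text \<open>The identity is verified under \<open>unif\<close>, where \<open>cdf_quant\<close>
  applies, and carried to \<open>m\<close> through the common law of \<open>quant m\<close> and
  \<open>hcode\<close>. The distribution function may have flat pieces, so it can fail on a null
  set.\<close>

lemma sec_rank: "AE w in m. sec m (rank m w) = w"
proof -
  have [measurable]: "cdf (hlaw m) \<in> borel_measurable borel" by (rule H.measurable_C)
  have "AE u in unif. quant m (cdf (hlaw m) (quant m u)) = quant m u"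
    using AE_unif_interval by eventually_elim (auto simp: cdf_quant)
  then have "AE s in distr unif borel (quant m). quant m (cdf (hlaw m) s) = s"
    by (subst AE_distr_iff) auto
  then have "AE s in distr m borel hcode. quant m (cdf (hlaw m) s) = s"
    unfolding distr_quant hlaw_def[of m, symmetric] .
  then have "AE w in m. quant m (cdf (hlaw m) (hcode w)) = hcode w"
    by (subst (asm) AE_distr_iff) (auto simp: measurable_nonatomic_prob[OF m])
  then show ?thesis by eventually_elim (simp add: sec_def rank_def)
qed

text \<open>\<open>decode\<close> is only a left inverse of \<open>hcode\<close>; that coding after
  decoding returns the same real is true almost surely for the law of a code, which is the law of a
  quantile.\<close>

lemma hcode_sec: "AE u in unif. hcode (sec m u) = quant m u"
proof -
  have "AE s in distr m borel hcode. hcode (decode s :: 'a) = s"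
    by (subst AE_distr_iff) (auto simp: measurable_nonatomic_prob[OF m])
  then have "AE s in distr unif borel (quant m). hcode (decode s :: 'a) = s"
    unfolding distr_quant hlaw_def[symmetric] .
  then show ?thesis unfolding sec_def by (subst (asm) AE_distr_iff) auto
qed

lemma distr_sec: "distr unif borel (sec m) = m"
proof -
  have "distr unif borel (sec m) = distr (distr unif borel (quant m)) borel decode"
    by (subst distr_distr) (auto simp: comp_def sec_def[abs_def])
  also have "\<dots> = distr (distr m borel hcode) borel decode"
    unfolding hlaw_def[of m, symmetric] distr_quant ..
  also have "\<dots> = distr m borel (\<lambda>w. w)"
    by (subst distr_distr) (auto simp: measurable_nonatomic_prob[OF m] comp_def)
  also have "\<dots> = m" using m by (intro distr_id2) (auto simp: nonatomic_prob_def)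
  finally show ?thesis .
qed

lemma rank_sec: "AE u in unif. rank m (sec m u) = u"
  using hcode_sec AE_unif_interval by eventually_elim (simp add: rank_def cdf_quant)

end

text \<open>Composing the rank map of one measure with the quantile map of another gives the isomorphism
  of two nonatomic standard probability spaces.\<close>

definition iso :: "'a::polish_space measure \<Rightarrow> 'b::polish_space measure \<Rightarrow> 'a \<Rightarrow> 'b" where
  "iso m n = sec n \<circ> rank m"

lemma measurable_iso [measurable]:
  "nonatomic_prob m \<Longrightarrow> nonatomic_prob n \<Longrightarrow> iso m n \<in> borel_measurable borel"
  unfolding iso_def by (rule measurable_comp[OF measurable_rank measurable_sec])

lemma AE_rank_iff:
  fixes m :: "'a::polish_space measure"
  assumes "nonatomic_prob m" "{u. P u} \<in> sets borel"
  shows "(AE w in m. P (rank m w)) \<longleftrightarrow> (AE u in unif. P u)"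
proof -
  have "rank m \<in> m \<rightarrow>\<^sub>M borel" using measurable_rank[OF assms(1)] by (simp add: measurable_nonatomic_prob[OF assms(1)])
  from AE_distr_iff[OF this, of P] show ?thesis
    using assms(2) unfolding distr_rank[OF assms(1)] by simp
qed

text \<open>\<open>P\<close> is an arbitrary predicate, so the exceptional set is first enlarged to
  a Borel null set.\<close>

lemma AE_rank:
  fixes m :: "'a::polish_space measure"
  assumes "nonatomic_prob m" "AE u in unif. P u"
  shows "AE w in m. P (rank m w)"
proof -
  obtain N where N: "{u. \<not> P u} \<subseteq> N" "N \<in> null_sets unif"
    using assms(2) unfolding eventually_ae_filter by auto
  have "N \<in> sets borel" using N(2) by auto
  have "AE u in unif. u \<notin> N" using N(2) by (rule AE_not_in)
  then have "AE w in m. rank m w \<notin> N"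
    by (subst AE_rank_iff[OF assms(1)]) (use borel_comp[OF \<open>N \<in> sets borel\<close>] in \<open>auto simp: Compl_eq\<close>)
  then show ?thesis using N(1) by (auto elim!: eventually_mono)
qed

lemma distr_iso:
  assumes "nonatomic_prob m" "nonatomic_prob n"
  shows "distr m borel (iso m n) = n"
proof -
  have "distr m borel (iso m n) = distr (distr m borel (rank m)) borel (sec n)"
    using measurable_rank[OF assms(1)] measurable_sec[OF assms(2)]
    by (subst distr_distr) (simp_all add: measurable_nonatomic_prob(1)[OF assms(1)] iso_def)
  then show ?thesis unfolding distr_rank[OF assms(1)] distr_sec[OF assms(2)] .
qed

lemma iso_inverse:
  assumes "nonatomic_prob m" "nonatomic_prob n"
  shows "AE w in m. iso n m (iso m n w) = w"
  using sec_rank[OF assms(1)] AE_rank[OF assms(1) rank_sec[OF assms(2)]]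
  by eventually_elim (simp add: iso_def)

lemma rank_iso:
  assumes "nonatomic_prob m" "nonatomic_prob n"
  shows "AE w in m. rank n (iso m n w) = rank m w"
  using AE_rank[OF assms(1) rank_sec[OF assms(2)]]
  by eventually_elim (simp add: iso_def)

section \<open>Continuity of the quantile maps in the law\<close>

lemma cdf_tendsto_of_rationals:
  assumes F: "real_distribution M" "isCont (cdf M) t" "\<And>k. real_distribution (N k)"
    and lim: "\<And>r. r \<in> \<rat> \<Longrightarrow> (\<lambda>k. cdf (N k) r) \<longlonglongrightarrow> cdf M r"
  shows "(\<lambda>k. cdf (N k) t) \<longlonglongrightarrow> cdf M t"
proof (rule order_tendstoI)
  note mono = finite_borel_measure.cdf_nondecreasing[OF real_distribution.finite_borel_measure_M]
  fix a assume a: "a < cdf M t"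
  have "\<forall>\<^sub>F s in at t. a < cdf M s" using order_tendstoD(1)[OF F(2)[unfolded isCont_def] a] .
  then obtain d where d: "d > 0" "\<And>s. s \<noteq> t \<Longrightarrow> dist s t < d \<Longrightarrow> a < cdf M s"
    unfolding eventually_at by auto
  obtain r where r: "r \<in> \<rat>" "t - d < r" "r < t" using Rats_dense_in_real[of "t - d" t] d(1) by auto
  then have "a < cdf M r" using d(2)[of r] by (auto simp: dist_real_def)
  with lim[OF r(1)] have "\<forall>\<^sub>F k in sequentially. a < cdf (N k) r" by (rule order_tendstoD)
  then show "\<forall>\<^sub>F k in sequentially. a < cdf (N k) t"
    by eventually_elim (use mono[OF F(3), of r t] r(3) in \<open>fastforce intro: less_le_trans\<close>)
next
  note mono = finite_borel_measure.cdf_nondecreasing[OF real_distribution.finite_borel_measure_M]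
  fix a assume a: "cdf M t < a"
  have "\<forall>\<^sub>F s in at t. cdf M s < a" using order_tendstoD(2)[OF F(2)[unfolded isCont_def] a] .
  then obtain d where d: "d > 0" "\<And>s. s \<noteq> t \<Longrightarrow> dist s t < d \<Longrightarrow> cdf M s < a"
    unfolding eventually_at by auto
  obtain r where r: "r \<in> \<rat>" "t < r" "r < t + d" using Rats_dense_in_real[of t "t + d"] d(1) by auto
  then have "cdf M r < a" using d(2)[of r] by (auto simp: dist_real_def)
  with lim[OF r(1)] have "\<forall>\<^sub>F k in sequentially. cdf (N k) r < a" by (rule order_tendstoD)
  then show "\<forall>\<^sub>F k in sequentially. cdf (N k) t < a"
    by eventually_elim (use mono[OF F(3), of t r] r(2) in \<open>fastforce intro: le_less_trans\<close>)
qed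

text \<open>Convergence of distribution functions makes quantiles converge at every \<open>u\<close>
  that the limit function does not attain at a rational. Convergence of codes then gives convergence
  of points, with no condition on frontiers.\<close>

lemma sec_tendsto:
  fixes m :: "'a::polish_space measure"
  assumes m: "nonatomic_prob m" "\<And>k. nonatomic_prob (N k)"
    and lim: "\<And>t. (\<lambda>k. cdf (hlaw (N k)) t) \<longlonglongrightarrow> cdf (hlaw m) t"
  shows "AE u in unif. (\<lambda>k. sec (N k) u) \<longlonglongrightarrow> sec m u"
proof -
  define F where "F = cdf (hlaw m)"
  have mono: "F s \<le> F t" if "s \<le> t" for s t
    unfolding F_def using that real_distribution_hlaw[OF m(1)]
    by (metis finite_borel_measure.cdf_nondecreasing real_distribution.finite_borel_measure_M)
  \<comment> \<open>Excluding these countably many levels turns \<open>u \<le> F r\<close> into a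
    strict inequality at rational \<open>r\<close>, which persists along the sequence.\<close>
  have "AE u in unif. u \<notin> F ` \<rat>" by (rule AE_unif_countable) (simp add: countable_rat)
  moreover have "AE u in unif. \<forall>k. hcode (sec (N k) u) = quant (N k) u"
    using hcode_sec[OF m(2)] by (simp add: AE_all_countable)
  ultimately show ?thesis using hcode_sec[OF m(1)] AE_unif_interval
  proof eventually_elim
    case (elim u)
    have u: "0 < u" "u < 1" using elim by auto
    have "(\<lambda>k. quant (N k) u) \<longlonglongrightarrow> quant m u"
    proof (rule order_tendstoI)
      fix t assume "t < quant m u"
      then have "F t < u" using quant_le_iff[OF m(1) u, of t] unfolding F_def by linarith
      with lim[of t, folded F_def] have "\<forall>\<^sub>F k in sequentially. cdf (hlaw (N k)) t < u" by (rule order_tendstoD)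
      then show "\<forall>\<^sub>F k in sequentially. t < quant (N k) u"
        by eventually_elim (use quant_le_iff[OF m(2) u, of _ t] in \<open>auto simp: not_le[symmetric]\<close>)
    next
      fix t assume t: "quant m u < t"
      then obtain r where r: "r \<in> \<rat>" "quant m u < r" "r < t" using Rats_dense_in_real by blast
      have "u \<le> F r" using quant_le_iff[OF m(1) u, of r] r unfolding F_def by linarith
      moreover have "u \<noteq> F r" using elim(1) r(1) by blast
      ultimately have "u < F r" by simp
      with lim[of r, folded F_def] have "\<forall>\<^sub>F k in sequentially. u < cdf (hlaw (N k)) r" by (rule order_tendstoD)
      then show "\<forall>\<^sub>F k in sequentially. quant (N k) u < t"
      proof eventually_elim
        case (elim k)
        then have "quant (N k) u \<le> r" using quant_le_iff[OF m(2) u, of k r] by simp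
        then show ?case using r(3) by simp
      qed
    qed
    with elim show ?case by (simp add: tendsto_of_hcode[of "\<lambda>k. sec (N k) u"])
  qed
qed

section \<open>Stationary actions\<close>

text \<open>Common form of the two kinds of object compared by the theorem: \<open>P_mu_iff\<close>
  and \<open>A_mu_iff\<close> reduce both spaces to it, so each fact about stationarity is proved
  once.\<close>

definition stat_action ::
  "'g::{group_add,countable} pmf \<Rightarrow> 'a measure \<Rightarrow> ('g \<Rightarrow> 'a \<Rightarrow> 'a) \<Rightarrow> bool" where
  "stat_action \<mu> M \<alpha> \<longleftrightarrow> prob_space M \<and> (\<forall>g. \<alpha> g \<in> measurable M M) \<and> (AE x in M. \<alpha> 0 x = x) \<and>
     (\<forall>g h. AE x in M. \<alpha> (g + h) x = \<alpha> g (\<alpha> h x)) \<and>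
     (\<forall>E\<in>sets M. emeasure M E = (\<integral>\<^sup>+ g. emeasure M (\<alpha> g -` E \<inter> space M) \<partial>(measure_pmf \<mu>)))"

lemma stat_actionD:
  assumes "stat_action \<mu> M \<alpha>"
  shows "prob_space M" "\<alpha> g \<in> measurable M M" "AE x in M. \<alpha> 0 x = x"
    "AE x in M. \<alpha> (g + h) x = \<alpha> g (\<alpha> h x)"
    "E \<in> sets M \<Longrightarrow> emeasure M E = (\<integral>\<^sup>+ g. emeasure M (\<alpha> g -` E \<inter> space M) \<partial>(measure_pmf \<mu>))"
  using assms unfolding stat_action_def by blast+

text \<open>For \<open>s\<close> in the support, keeping a single summand of the stationarity
  equation gives the factor \<open>1 / pmf \<mu> s\<close>; along a product of such elements the
  factors multiply. The constant is chosen before the measure and the action, and this uniformity is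
  what later limits rely on.\<close>

lemma stat_action_bound:
  assumes gen: "gen_semigroup (set_pmf \<mu>) = (UNIV :: 'g::{group_add,countable} set)"
  shows "\<exists>C>0. \<forall>(M :: 'a measure) \<alpha>. stat_action \<mu> M \<alpha> \<longrightarrow>
      (\<forall>E\<in>sets M. measure M (\<alpha> g -` E \<inter> space M) \<le> C * measure M E)"
proof -
  have "g \<in> gen_semigroup (set_pmf \<mu>)" using gen by simp
  then show ?thesis
  proof induction
    case (base s)
    have pos: "pmf \<mu> s > 0" using base by (simp add: pmf_positive)
    show ?case
    proof (intro exI[of _ "1 / pmf \<mu> s"] conjI allI impI ballI)
      show "0 < 1 / pmf \<mu> s" using pos by simp
      fix M :: "'a measure" and \<alpha> E
      assume act: "stat_action \<mu> M \<alpha>" and E: "E \<in> sets M"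
      interpret prob_space M by (rule stat_actionD(1)[OF act])
      define c where "c g = emeasure M (\<alpha> g -` E \<inter> space M)" for g
      have "c s * ennreal (pmf \<mu> s) = (\<integral>\<^sup>+ g. c s * indicator {s} g \<partial>measure_pmf \<mu>)"
        by (simp add: nn_integral_cmult emeasure_pmf_single)
      also have "\<dots> \<le> (\<integral>\<^sup>+ g. c g \<partial>measure_pmf \<mu>)"
        by (intro nn_integral_mono) (auto split: split_indicator)
      also have "\<dots> = emeasure M E" unfolding c_def by (rule stat_actionD(5)[OF act E, symmetric])
      finally have "ennreal (measure M (\<alpha> s -` E \<inter> space M) * pmf \<mu> s) \<le> ennreal (measure M E)"
        unfolding c_def by (simp add: emeasure_eq_measure ennreal_mult)
      then have "measure M (\<alpha> s -` E \<inter> space M) * pmf \<mu> s \<le> measure M E" by simp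
      then show "measure M (\<alpha> s -` E \<inter> space M) \<le> 1 / pmf \<mu> s * measure M E"
        using pos by (simp add: field_simps)
    qed
  next
    case (plus a b)
    from plus.IH obtain C D where C: "C > 0" "\<And>(M :: 'a measure) \<alpha> E. stat_action \<mu> M \<alpha> \<Longrightarrow>
        E \<in> sets M \<Longrightarrow> measure M (\<alpha> a -` E \<inter> space M) \<le> C * measure M E"
      and D: "D > 0" "\<And>(M :: 'a measure) \<alpha> E. stat_action \<mu> M \<alpha> \<Longrightarrow>
        E \<in> sets M \<Longrightarrow> measure M (\<alpha> b -` E \<inter> space M) \<le> D * measure M E" by metis
    show ?case
    proof (intro exI[of _ "D * C"] conjI allI impI ballI)
      show "0 < D * C" using C D by simp
      fix M :: "'a measure" and \<alpha> E
      assume act: "stat_action \<mu> M \<alpha>" and E: "E \<in> sets M"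
      interpret prob_space M by (rule stat_actionD(1)[OF act])
      note [measurable] = stat_actionD(2)[OF act]
      define F where "F = \<alpha> a -` E \<inter> space M"
      have F: "F \<in> sets M" unfolding F_def using E by measurable
      have "measure M (\<alpha> (a + b) -` E \<inter> space M) = measure M (\<alpha> b -` F \<inter> space M)"
      proof (rule measure_eq_AE)
        show "AE x in M. (x \<in> \<alpha> (a + b) -` E \<inter> space M) = (x \<in> \<alpha> b -` F \<inter> space M)"
          using stat_actionD(4)[OF act, of a b] AE_space
          by eventually_elim (auto simp: F_def intro: measurable_space[OF stat_actionD(2)[OF act]])
      qed (use E F in measurable)
      also have "\<dots> \<le> D * measure M F" by (rule D(2)[OF act F])
      also have "\<dots> \<le> D * (C * measure M E)" unfolding F_def using C(2)[OF act E] D(1) by simp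
      finally show "measure M (\<alpha> (a + b) -` E \<inter> space M) \<le> D * C * measure M E" by (simp add: mult.assoc)
    qed
  qed
qed

text \<open>By the bound, the preimage of a null set under any group element is null.\<close>

lemma stat_action_AE:
  assumes gen: "gen_semigroup (set_pmf \<mu>) = UNIV" and act: "stat_action \<mu> M \<alpha>"
    and P: "AE x in M. P x"
  shows "AE x in M. P (\<alpha> g x)"
proof -
  interpret prob_space M by (rule stat_actionD(1)[OF act])
  obtain N where N: "{x\<in>space M. \<not> P x} \<subseteq> N" "N \<in> null_sets M"
    using P unfolding eventually_ae_filter by auto
  obtain C where "measure M (\<alpha> g -` N \<inter> space M) \<le> C * measure M N"
    using stat_action_bound[OF gen, of g] act null_setsD2[OF N(2)] by blast
  then have "measure M (\<alpha> g -` N \<inter> space M) = 0"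
    by (simp add: measure_eq_0_null_sets[OF N(2)] measure_le_0_iff)
  then have "\<alpha> g -` N \<inter> space M \<in> null_sets M"
    using measurable_sets[OF stat_actionD(2)[OF act] null_setsD2[OF N(2)], of g]
    by (intro null_setsI) (auto simp: emeasure_eq_measure)
  from AE_not_in[OF this] AE_space show ?thesis
    by eventually_elim (use N(1) measurable_space[OF stat_actionD(2)[OF act]] in blast)
qed

lemma stat_action_inverse:
  assumes "stat_action \<mu> M \<alpha>"
  shows "AE x in M. \<alpha> (- g) (\<alpha> g x) = x" "AE x in M. \<alpha> g (\<alpha> (- g) x) = x"
  using stat_actionD(3)[OF assms] stat_actionD(4)[OF assms, of "- g" g] stat_actionD(4)[OF assms, of g "- g"]
  by (auto elim!: AE_mp)

lemma stat_action_null_iff: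
  assumes gen: "gen_semigroup (set_pmf \<mu>) = UNIV" and act: "stat_action \<mu> M \<alpha>" and E: "E \<in> sets M"
  shows "emeasure M (\<alpha> g -` E \<inter> space M) = 0 \<longleftrightarrow> emeasure M E = 0"
proof -
  note meas = stat_actionD(2)[OF act]
  have E': "\<alpha> g -` E \<inter> space M \<in> sets M" using meas E by (rule measurable_sets)
  have "(AE x in M. \<alpha> g x \<notin> E) \<longleftrightarrow> (AE x in M. x \<notin> E)"
  proof
    assume "AE x in M. \<alpha> g x \<notin> E"
    from stat_action_AE[OF gen act this, of "- g"] stat_action_inverse(2)[OF act, of g]
    show "AE x in M. x \<notin> E" by eventually_elim simp
  qed (rule stat_action_AE[OF gen act])
  moreover have "emeasure M E = 0 \<longleftrightarrow> (AE x in M. x \<notin> E)"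
    unfolding AE_iff_null_sets[OF E, symmetric] using E by auto
  moreover have "emeasure M (\<alpha> g -` E \<inter> space M) = 0 \<longleftrightarrow> (AE x in M. x \<notin> \<alpha> g -` E \<inter> space M)"
    unfolding AE_iff_null_sets[OF E', symmetric] using E' by auto
  moreover have "(AE x in M. x \<notin> \<alpha> g -` E \<inter> space M) \<longleftrightarrow> (AE x in M. \<alpha> g x \<notin> E)"
    using AE_space by (auto elim!: AE_mp)
  ultimately show ?thesis by simp
qed

lemma stat_action_nonsingular:
  assumes "gen_semigroup (set_pmf \<mu>) = UNIV" "stat_action \<mu> M \<alpha>"
  shows "nonsingular_action M \<alpha>"
  unfolding nonsingular_action_def
  using stat_actionD[OF assms(2)] stat_action_null_iff[OF assms] by blast

lemma measurable_shift_action [measurable]: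
  "shift_action g \<in> borel_measurable (borel :: ('g::{group_add,countable} \<Rightarrow> 'z::second_countable_topology) measure)"
  unfolding shift_action_def by (rule measurable_coordinatewise_then_product) measurable

lemma P_mu_iff:
  fixes \<eta> :: "('g::{group_add,countable} \<Rightarrow> 'z::second_countable_topology) measure"
  shows "\<eta> \<in> P_mu \<mu> \<longleftrightarrow> sets \<eta> = sets borel \<and> stat_action \<mu> \<eta> shift_action"
proof -
  have 1: "shift_action 0 x = x" "shift_action (g + h) x = shift_action g (shift_action h x)"
    for g h :: 'g and x :: "'g \<Rightarrow> 'z"
    by (simp_all add: shift_action_def minus_add add.assoc diff_conv_add_uminus del: add_uminus_conv_diff)
  have 2: "emeasure (distr \<eta> borel (shift_action g)) E = emeasure \<eta> (shift_action g -` E \<inter> space \<eta>)"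
    if "sets \<eta> = sets borel" "E \<in> sets \<eta>" for g E
    using that by (subst emeasure_distr) (auto simp: measurable_cong_sets[OF that(1) refl])
  have 3: "shift_action g \<in> measurable \<eta> \<eta>" if "sets \<eta> = sets borel" for g
    using measurable_cong_sets[OF that that] measurable_shift_action by blast
  show ?thesis
  proof (cases "sets \<eta> = sets borel")
    case True
    have "(\<forall>E\<in>sets \<eta>. emeasure \<eta> E =
         (\<integral>\<^sup>+ g. emeasure (distr \<eta> borel (shift_action g)) E \<partial>measure_pmf \<mu>)) \<longleftrightarrow>
       (\<forall>E\<in>sets \<eta>. emeasure \<eta> E =
         (\<integral>\<^sup>+ g. emeasure \<eta> (shift_action g -` E \<inter> space \<eta>) \<partial>measure_pmf \<mu>))"
      by (rule ball_cong) (simp_all only: 2[OF True])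
    moreover have "AE x in \<eta>. shift_action 0 x = x"
      "\<forall>g h. AE x in \<eta>. shift_action (g + h) x = shift_action g (shift_action h x)"
      by (simp_all add: 1)
    ultimately show ?thesis
      unfolding P_mu_def stat_action_def mem_Collect_eq using 3[OF True] True by blast
  qed (auto simp: P_mu_def)
qed

text \<open>\<open>A_mu\<close> does not state that the neutral element acts trivially. It follows
  because \<open>a 0\<close> is idempotent and has a left inverse \<open>S\<close> almost
  everywhere; nonsingularity allows \<open>S\<close> to be cancelled also at the point
  \<open>a 0 x\<close>. Conversely \<open>a (- g)\<close> serves as the inverse required by
  \<open>aut_star\<close>.\<close>

lemma A_mu_iff:
  assumes gen: "gen_semigroup (set_pmf \<mu>) = UNIV" and "prob_space M"
  shows "a \<in> A_mu \<mu> M \<longleftrightarrow> stat_action \<mu> M a"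
proof -
  have eq: "emeasure (distr M M (a g)) E = emeasure M (a g -` E \<inter> space M)"
    if "\<forall>g. a g \<in> measurable M M" "E \<in> sets M" for g E
    using that by (simp add: emeasure_distr)
  show ?thesis
  proof
    assume a: "a \<in> A_mu \<mu> M"
    then have meas: "\<forall>g. a g \<in> measurable M M" by (simp add: A_mu_def aut_star_def)
    obtain S where S: "S \<in> measurable M M" "AE x in M. S (a 0 x) = x"
      using a unfolding A_mu_def aut_star_def by blast
    have ns: "\<And>A. A \<in> sets M \<Longrightarrow> emeasure M (a 0 -` A \<inter> space M) = 0 \<longleftrightarrow> emeasure M A = 0"
      using a unfolding A_mu_def aut_star_def by blast
    obtain N where N: "{x\<in>space M. S (a 0 x) \<noteq> x} \<subseteq> N" "N \<in> null_sets M"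
      using S(2) unfolding eventually_ae_filter by auto
    have "a 0 -` N \<inter> space M \<in> null_sets M"
      using N(2) ns[of N] meas by (intro null_setsI) (auto intro: measurable_sets simp: null_sets_def)
    then have "AE x in M. S (a 0 (a 0 x)) = a 0 x"
      by (rule AE_mp[OF AE_not_in], intro AE_I2)
        (use N(1) meas in \<open>auto dest: measurable_space\<close>)
    moreover have "AE x in M. a (0 + 0) x = a 0 (a 0 x)" using a unfolding A_mu_def by blast
    ultimately have "AE x in M. a 0 x = x" using S(2) by eventually_elim simp
    then show "stat_action \<mu> M a"
      using a assms(2) meas eq[OF meas] unfolding stat_action_def A_mu_def by simp
  next
    assume a: "stat_action \<mu> M a"
    have meas: "\<forall>g. a g \<in> measurable M M" using stat_actionD(2)[OF a] by blast
    have "a g \<in> aut_star M" for g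
      unfolding aut_star_def using meas stat_action_null_iff[OF gen a] stat_action_inverse[OF a, of g]
      by (auto intro!: exI[of _ "a (- g)"])
    then show "a \<in> A_mu \<mu> M"
      unfolding A_mu_def using stat_actionD(4,5)[OF a] eq[OF meas] by simp
  qed
qed

section \<open>Orbit maps and orbit laws\<close>

definition orb :: "('g::group_add \<Rightarrow> 'a \<Rightarrow> 'a) \<Rightarrow> ('a \<Rightarrow> 'z) \<Rightarrow> 'a \<Rightarrow> 'g \<Rightarrow> 'z" where
  "orb \<alpha> f x = (\<lambda>k. f (\<alpha> (- k) x))"

definition orb_law ::
  "'a measure \<Rightarrow> ('g::group_add \<Rightarrow> 'a \<Rightarrow> 'a) \<Rightarrow> ('a \<Rightarrow> 'z::topological_space) \<Rightarrow> ('g \<Rightarrow> 'z) measure" where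
  "orb_law M \<alpha> f = distr M borel (orb \<alpha> f)"

lemma measurable_orb:
  fixes \<alpha> :: "'g::{group_add,countable} \<Rightarrow> 'a \<Rightarrow> 'a" and f :: "'a \<Rightarrow> 'z::second_countable_topology"
  assumes "\<And>g. \<alpha> g \<in> measurable M M" "f \<in> borel_measurable M"
  shows "orb \<alpha> f \<in> borel_measurable M"
  unfolding orb_def by (rule measurable_coordinatewise_then_product) (rule measurable_compose[OF assms])

text \<open>The sign in \<open>orb\<close> is chosen for this: coordinate \<open>k\<close> of the
  orbit of \<open>\<alpha> g x\<close> involves \<open>- k + g\<close>, the negative of the index
  \<open>- g + k\<close> read by the shift. Countability of the group merges the null sets over all
  \<open>k\<close>.\<close>

lemma orb_equivariant:
  assumes act: "stat_action \<mu> M \<alpha>"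
  shows "AE x in M. orb \<alpha> f (\<alpha> g x) = shift_action g (orb \<alpha> f x)"
proof -
  have "AE x in M. \<forall>k. \<alpha> (- k + g) x = \<alpha> (- k) (\<alpha> g x)"
    using stat_actionD(4)[OF act] by (simp add: AE_all_countable)
  then show ?thesis
    by eventually_elim (simp add: orb_def shift_action_def minus_add fun_eq_iff)
qed

lemma orb_law_in_P_mu:
  fixes f :: "'a \<Rightarrow> 'z::second_countable_topology"
  assumes act: "stat_action \<mu> M \<alpha>" and f: "f \<in> borel_measurable M"
  shows "orb_law M \<alpha> f \<in> P_mu \<mu>"
proof -
  have orb [measurable]: "orb \<alpha> f \<in> borel_measurable M" by (rule measurable_orb[OF stat_actionD(2)[OF act] f])
  have [simp]: "sets (orb_law M \<alpha> f) = sets borel" "space (orb_law M \<alpha> f) = UNIV"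
    by (auto simp: orb_law_def)
  interpret prob_space M by (rule stat_actionD(1)[OF act])
  note [measurable] = stat_actionD(2)[OF act]
  have "emeasure (orb_law M \<alpha> f) E = (\<integral>\<^sup>+ g. emeasure (orb_law M \<alpha> f) (shift_action g -` E) \<partial>measure_pmf \<mu>)"
    if E: "E \<in> sets borel" for E
  proof -
    define F where "F = orb \<alpha> f -` E \<inter> space M"
    have F: "F \<in> sets M" unfolding F_def using orb E by (rule measurable_sets)
    have "emeasure (orb_law M \<alpha> f) E = emeasure M F"
      unfolding orb_law_def F_def using E by (simp add: emeasure_distr)
    also have "\<dots> = (\<integral>\<^sup>+ g. emeasure M (\<alpha> g -` F \<inter> space M) \<partial>measure_pmf \<mu>)"
      by (rule stat_actionD(5)[OF act F])
    also have "\<dots> = (\<integral>\<^sup>+ g. emeasure (orb_law M \<alpha> f) (shift_action g -` E) \<partial>measure_pmf \<mu>)"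
    proof (rule nn_integral_cong)
      fix g
      have sE: "shift_action g -` E \<in> sets borel"
        using measurable_sets[OF measurable_shift_action E, of g] by simp
      have "emeasure M (\<alpha> g -` F \<inter> space M) = emeasure M (orb \<alpha> f -` (shift_action g -` E) \<inter> space M)"
      proof (rule emeasure_eq_AE)
        show "AE x in M. (x \<in> \<alpha> g -` F \<inter> space M) = (x \<in> orb \<alpha> f -` (shift_action g -` E) \<inter> space M)"
          using orb_equivariant[OF act, of f g] AE_space
          by eventually_elim (auto simp: F_def intro: measurable_space[OF stat_actionD(2)[OF act]])
      qed (use F measurable_sets[OF orb sE] in measurable)
      also have "\<dots> = emeasure (orb_law M \<alpha> f) (shift_action g -` E)"
        unfolding orb_law_def using sE by (simp add: emeasure_distr)
      finally show "emeasure M (\<alpha> g -` F \<inter> space M) = emeasure (orb_law M \<alpha> f) (shift_action g -` E)" .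
    qed
    finally show ?thesis .
  qed
  moreover have "prob_space (orb_law M \<alpha> f)" unfolding orb_law_def by (rule prob_space_distr[OF orb])
  ultimately show ?thesis
    unfolding P_mu_def by (simp add: emeasure_distr measurable_cong_sets[OF \<open>sets (orb_law M \<alpha> f) = sets borel\<close> refl])
qed

text \<open>When \<open>f\<close> is almost everywhere injective, coordinate 0 alone recovers the
  point: \<open>e (y 0)\<close> inverts the orbit map. The remaining coordinates are then determined
  by it.\<close>

lemma conjugate_orb_law:
  fixes f :: "'a \<Rightarrow> 'z::polish_space" and \<mu> :: "'g::{group_add,countable} pmf"
  assumes gen: "gen_semigroup (set_pmf \<mu>) = UNIV" and act: "stat_action \<mu> M \<alpha>"
    and f: "f \<in> borel_measurable M" and e: "e \<in> measurable borel M" and ef: "AE x in M. e (f x) = x"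
  shows "conjugate M \<alpha> (orb_law M \<alpha> f) shift_action"
proof -
  have orb: "orb \<alpha> f \<in> borel_measurable M" by (rule measurable_orb[OF stat_actionD(2)[OF act] f])
  have P: "orb_law M \<alpha> f \<in> P_mu \<mu>" by (rule orb_law_in_P_mu[OF act f])
  have sets: "sets (orb_law M \<alpha> f) = sets borel" using P unfolding P_mu_def by blast
  define \<psi> where "\<psi> y = e (y 0)" for y :: "'g \<Rightarrow> 'z"
  have [measurable]: "\<psi> \<in> measurable borel M" unfolding \<psi>_def
    by (rule measurable_compose[OF measurable_product_coordinates e])
  have *: "AE x in M. \<psi> (orb \<alpha> f x) = x"
    using ef stat_actionD(3)[OF act] by eventually_elim (simp add: \<psi>_def orb_def)
  have "{y \<in> space borel. orb \<alpha> f (\<psi> y) = y} \<in> sets borel"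
    by (rule measurable_equality_set[OF measurable_compose[OF _ orb]]) auto
  moreover have "AE x in M. orb \<alpha> f (\<psi> (orb \<alpha> f x)) = orb \<alpha> f x"
    using * by eventually_elim simp
  ultimately have **: "AE y in orb_law M \<alpha> f. orb \<alpha> f (\<psi> y) = y"
    unfolding orb_law_def using AE_distr_iff[OF orb] by simp
  show ?thesis
    unfolding conjugate_def
  proof (intro conjI exI allI)
    show "nonsingular_action M \<alpha>" by (rule stat_action_nonsingular[OF gen act])
    show "nonsingular_action (orb_law M \<alpha> f) shift_action"
      using P[unfolded P_mu_iff] by (intro stat_action_nonsingular[OF gen]) simp
    show "orb \<alpha> f \<in> measurable M (orb_law M \<alpha> f)"
      using orb by (simp add: measurable_cong_sets[OF refl sets])
    show "\<psi> \<in> measurable (orb_law M \<alpha> f) M"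
      by (simp add: measurable_cong_sets[OF sets refl])
    show "distr M (orb_law M \<alpha> f) (orb \<alpha> f) = orb_law M \<alpha> f"
      unfolding orb_law_def by (rule distr_cong) (auto simp: sets)
  qed (fact * ** orb_equivariant[OF act])+
qed

text \<open>In the action law the identity \<open>p (q y) = y\<close> is used at moved points
  \<open>\<alpha> h y\<close>, so its null set is first pulled back along the action on
  \<open>M\<close> and then along \<open>p\<close>.\<close>

lemma stat_action_transport:
  assumes gen: "gen_semigroup (set_pmf \<mu>) = UNIV" and act: "stat_action \<mu> M \<alpha>"
    and N: "prob_space N" and p: "p \<in> measurable N M" and q: "q \<in> measurable M N"
    and law: "distr N M p = M" and qp: "AE x in N. q (p x) = x" and pq: "AE y in M. p (q y) = y"
  shows "stat_action \<mu> N (\<lambda>g x. q (\<alpha> g (p x)))"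
proof -
  note [measurable] = stat_actionD(2)[OF act] p q
  have pull: "AE x in N. P (p x)" if "AE y in M. P y" for P
    using that by (subst (asm) law[symmetric]) (rule AE_distrD[OF p])
  have meas: "(\<lambda>x. q (\<alpha> g (p x))) \<in> measurable N N" for g by measurable
  have hom: "AE x in N. q (\<alpha> (g + h) (p x)) = q (\<alpha> g (p (q (\<alpha> h (p x)))))" for g h
  proof -
    have "AE y in M. q (\<alpha> (g + h) y) = q (\<alpha> g (p (q (\<alpha> h y))))"
      using stat_actionD(4)[OF act, of g h] stat_action_AE[OF gen act pq, of h]
      by eventually_elim simp
    then show ?thesis by (rule pull)
  qed
  have "emeasure N E = (\<integral>\<^sup>+ g. emeasure N ((\<lambda>x. q (\<alpha> g (p x))) -` E \<inter> space N) \<partial>measure_pmf \<mu>)"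
    if [measurable]: "E \<in> sets N" for E
  proof -
    define F where "F = q -` E \<inter> space M"
    have F [measurable]: "F \<in> sets M" unfolding F_def by measurable
    have *: "emeasure M B = emeasure N (p -` B \<inter> space N)" if "B \<in> sets M" for B
      using that by (subst law[symmetric]) (simp add: emeasure_distr)
    have "emeasure N E = emeasure N (p -` F \<inter> space N)"
    proof (rule emeasure_eq_AE)
      show "AE x in N. (x \<in> E) = (x \<in> p -` F \<inter> space N)"
        using qp AE_space
        by eventually_elim (auto simp: F_def intro: measurable_space[OF p])
    qed measurable
    also have "\<dots> = emeasure M F" by (rule *[symmetric]) (rule F)
    also have "\<dots> = (\<integral>\<^sup>+ g. emeasure M (\<alpha> g -` F \<inter> space M) \<partial>measure_pmf \<mu>)"
      by (rule stat_actionD(5)[OF act F])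
    also have "\<dots> = (\<integral>\<^sup>+ g. emeasure N ((\<lambda>x. q (\<alpha> g (p x))) -` E \<inter> space N) \<partial>measure_pmf \<mu>)"
    proof (rule nn_integral_cong)
      fix g
      have "p -` (\<alpha> g -` F \<inter> space M) \<inter> space N = (\<lambda>x. q (\<alpha> g (p x))) -` E \<inter> space N"
        using measurable_space[OF p] measurable_space[OF stat_actionD(2)[OF act, of g]] by (auto simp: F_def)
      then show "emeasure M (\<alpha> g -` F \<inter> space M) = emeasure N ((\<lambda>x. q (\<alpha> g (p x))) -` E \<inter> space N)"
        using *[of "\<alpha> g -` F \<inter> space M"] by simp
    qed
    finally show ?thesis .
  qed
  moreover have "AE x in N. q (\<alpha> 0 (p x)) = x"
    using pull[OF stat_actionD(3)[OF act]] qp by eventually_elim simp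
  ultimately show ?thesis unfolding stat_action_def using N meas hom by blast
qed

section \<open>The very weak topology in coordinates\<close>

lemma tendsto_fun_iff:
  fixes f :: "'a \<Rightarrow> 'i \<Rightarrow> 'b::topological_space"
  shows "(f \<longlongrightarrow> l) F \<longleftrightarrow> (\<forall>i. ((\<lambda>x. f x i) \<longlongrightarrow> l i) F)"
  using limitin_componentwise[of "\<lambda>_. euclidean :: 'b topology" "UNIV :: 'i set" f l F]
  by (simp add: euclidean_product_topology)

lemma limitin_pullback_topology:
  assumes "l \<in> A" "\<forall>\<^sub>F x in F. f x \<in> A" "limitin T (\<lambda>x. \<phi> (f x)) (\<phi> l) F"
  shows "limitin (pullback_topology A \<phi> T) f l F"
  unfolding limitin_def
proof (intro conjI allI impI)
  show "l \<in> topspace (pullback_topology A \<phi> T)"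
    using assms(1,3) by (simp add: topspace_pullback_topology limitin_def)
  fix U assume "openin (pullback_topology A \<phi> T) U \<and> l \<in> U"
  then obtain V where V: "openin T V" "U = \<phi> -` V \<inter> A" "\<phi> l \<in> V" by (auto simp: openin_pullback_topology)
  then have "\<forall>\<^sub>F x in F. \<phi> (f x) \<in> V" using assms(3) unfolding limitin_def by blast
  then show "\<forall>\<^sub>F x in F. f x \<in> U" using assms(2) by eventually_elim (simp add: V)
qed

text \<open>Were some point of \<open>S\<close> without a ball of coordinates staying in
  \<open>S\<close>, counterexamples at distance below \<open>1 / Suc k\<close> would form a
  forbidden sequence. The union of the balls is the required open set.\<close>

lemma openin_pullback_of_sequences:
  fixes \<phi> :: "'a \<Rightarrow> 'b::metric_space"
  assumes S: "S \<subseteq> A"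
    and seq: "\<And>b a. \<lbrakk>\<And>k. b k \<in> A; a \<in> S; (\<lambda>k. \<phi> (b k)) \<longlonglongrightarrow> \<phi> a\<rbrakk> \<Longrightarrow> \<exists>k::nat. b k \<in> S"
  shows "openin (pullback_topology A \<phi> euclidean) S"
  unfolding openin_pullback_topology
proof -
  have "\<exists>e>0. \<forall>b\<in>A. dist (\<phi> b) (\<phi> a) < e \<longrightarrow> b \<in> S" if a: "a \<in> S" for a
  proof (rule ccontr)
    assume "\<not> ?thesis"
    then have "\<forall>k. \<exists>b. b \<in> A \<and> dist (\<phi> b) (\<phi> a) < 1 / real (Suc k) \<and> b \<notin> S"
      by (meson of_nat_0_less_iff zero_less_Suc zero_less_divide_1_iff)
    then obtain b where b: "\<And>k. b k \<in> A" "\<And>k. dist (\<phi> (b k)) (\<phi> a) < 1 / real (Suc k)"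
      "\<And>k. b k \<notin> S" by metis
    have "(\<lambda>k. \<phi> (b k)) \<longlonglongrightarrow> \<phi> a"
    proof (rule metric_tendsto_imp_tendsto[OF LIMSEQ_inverse_real_of_nat])
      show "\<forall>\<^sub>F k in sequentially. dist (\<phi> (b k)) (\<phi> a) \<le> dist (inverse (real (Suc k))) 0"
        using b(2) by (intro always_eventually) (auto simp: inverse_eq_divide intro: less_imp_le)
    qed
    then show False using seq[of b a] b a by blast
  qed
  then obtain e where e: "\<And>a. a \<in> S \<Longrightarrow> e a > 0"
    "\<And>a b. a \<in> S \<Longrightarrow> b \<in> A \<Longrightarrow> dist (\<phi> b) (\<phi> a) < e a \<Longrightarrow> b \<in> S" by metis
  show "\<exists>U. openin euclidean U \<and> S = \<phi> -` U \<inter> A"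
  proof (intro exI conjI)
    show "openin euclidean (\<Union>a\<in>S. ball (\<phi> a) (e a))" by auto
    show "S = \<phi> -` (\<Union>a\<in>S. ball (\<phi> a) (e a)) \<inter> A" (is "_ = ?R")
    proof
      show "S \<subseteq> ?R" using e(1) S by fastforce
      show "?R \<subseteq> S"
      proof
        fix b assume "b \<in> ?R"
        then obtain a where "a \<in> S" "dist (\<phi> a) (\<phi> b) < e a" "b \<in> A" by auto
        then show "b \<in> S" using e(2)[of a b] by (simp add: dist_commute)
      qed
    qed
  qed
qed

lemma continuous_map_pullback_of_sequences:
  fixes \<phi> :: "'a \<Rightarrow> 'b::metric_space"
  assumes "\<And>b a. \<lbrakk>\<And>k. b k \<in> A; a \<in> A; (\<lambda>k. \<phi> (b k)) \<longlonglongrightarrow> \<phi> a\<rbrakk> \<Longrightarrow> limitin Y (\<lambda>k. g (b k)) (g a) sequentially"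
  shows "continuous_map (pullback_topology A \<phi> euclidean) Y g"
  unfolding continuous_map_alt
proof (intro conjI allI impI)
  show "g \<in> topspace (pullback_topology A \<phi> euclidean) \<rightarrow> topspace Y"
    using assms[of "\<lambda>_. a" a for a] by (auto simp: topspace_pullback_topology)
  fix U assume U: "openin Y U"
  have "openin (pullback_topology A \<phi> euclidean) (g -` U \<inter> A)"
  proof (rule openin_pullback_of_sequences)
    fix b a assume "\<And>k. b k \<in> A" "a \<in> g -` U \<inter> A" "(\<lambda>k. \<phi> (b k)) \<longlonglongrightarrow> \<phi> a"
    then have "\<forall>\<^sub>F k in sequentially. g (b k) \<in> U" "\<And>k. b k \<in> A"
      using assms[of b a] U unfolding limitin_def by auto
    then show "\<exists>k. b k \<in> g -` U \<inter> A" by (auto dest: eventually_happens)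
  qed simp
  then show "openin (pullback_topology A \<phi> euclidean) (g -` U \<inter> topspace (pullback_topology A \<phi> euclidean))"
    by (simp add: topspace_pullback_topology)
qed

text \<open>A criterion for countably many real coordinates to generate a topology given by many
  more: it suffices that convergence of the coordinates along sequences implies convergence in
  \<open>X\<close>.\<close>

lemma pullback_topology_of_sequences:
  fixes \<phi> :: "'a \<Rightarrow> 'b::metric_space"
  assumes cont: "continuous_map X euclidean \<phi>"
    and seq: "\<And>b a. \<lbrakk>\<And>k. b k \<in> topspace X; a \<in> topspace X; (\<lambda>k. \<phi> (b k)) \<longlonglongrightarrow> \<phi> a\<rbrakk> \<Longrightarrow> limitin X b a sequentially"
  shows "X = pullback_topology (topspace X) \<phi> euclidean"
  unfolding topology_eq
proof (intro allI iffI)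
  fix S assume S: "openin X S"
  show "openin (pullback_topology (topspace X) \<phi> euclidean) S"
  proof (rule openin_pullback_of_sequences)
    fix b a assume b: "\<And>k. b k \<in> topspace X" and a: "a \<in> S" "(\<lambda>k. \<phi> (b k)) \<longlonglongrightarrow> \<phi> a"
    then have "limitin X b a sequentially" using S openin_subset by (intro seq) auto
    then have "\<forall>\<^sub>F k in sequentially. b k \<in> S" using S a unfolding limitin_def by blast
    then show "\<exists>k. b k \<in> S" by (auto dest: eventually_happens)
  qed (use S openin_subset in blast)
next
  fix S assume "openin (pullback_topology (topspace X) \<phi> euclidean) S"
  then obtain U where U: "open U" "S = \<phi> -` U \<inter> topspace X" by (auto simp: openin_pullback_topology)
  have "openin X {x \<in> topspace X. \<phi> x \<in> U}"
    using cont U(1) by (intro openin_continuous_map_preimage) auto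
  also have "{x \<in> topspace X. \<phi> x \<in> U} = S" unfolding U(2) by auto
  finally show "openin X S" .
qed

text \<open>Integration against the Radon-Nikodym derivative is integration against the image
  measure. Pulling back by \<open>T\<close> turns the inverse in \<open>U1\<close> into the
  identity, leaving the indicator of \<open>A\<close> times that of \<open>B\<close> composed with
  \<open>T\<close>.\<close>

lemma very_weak_coords_eq:
  assumes M: "prob_space M" and T: "T \<in> aut_star M" and A: "A \<in> sets M" and B: "B \<in> sets M"
  shows "very_weak_coords M T (A, B) = measure M (A \<inter> (T -` B \<inter> space M))"
proof -
  interpret prob_space M by fact
  have T': "T \<in> measurable M M" "\<And>E. E \<in> sets M \<Longrightarrow> emeasure M (T -` E \<inter> space M) = 0 \<longleftrightarrow> emeasure M E = 0"
    "\<exists>S. S \<in> measurable M M \<and> (AE x in M. S (T x) = x) \<and> (AE x in M. T (S x) = x)"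
    using T unfolding aut_star_def by auto
  define S where "S = aut_inv M T"
  have S: "S \<in> measurable M M" "AE x in M. S (T x) = x"
    using someI_ex[OF T'(3)] unfolding S_def aut_inv_def by auto
  note [measurable] = T'(1) S(1) A B
  interpret N: prob_space "distr M M T" by (rule prob_space_distr) (rule T')
  have ac: "absolutely_continuous M (distr M M T)"
    unfolding absolutely_continuous_def
    using T' by (auto simp: null_sets_def emeasure_distr)
  obtain D where D: "D \<in> borel_measurable M" "AE x in M. RN_deriv M (distr M M T) x = ennreal (D x)"
     "\<And>x. 0 \<le> D x"
    using real_RN_deriv[OF N.finite_measure_axioms ac] by auto
  have dens: "distr M M T = density M D"
    using density_RN_deriv[OF ac] density_cong[OF _ _ D(2)] D(1) by simp
  define f :: "'a \<Rightarrow> real" where "f x = indicator A (S x) * indicator B x" for x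
  have [measurable]: "f \<in> borel_measurable M" unfolding f_def by measurable
  have "very_weak_coords M T (A, B) = (\<integral>x. D x * f x \<partial>M)"
  proof -
    have "very_weak_coords M T (A, B) =
        (\<integral>x. enn2real (RN_deriv M (distr M M T) x) * f x \<partial>M)"
      unfolding very_weak_coords_def U1_def S_def[symmetric] f_def using A B by (simp add: mult.assoc)
    also have "\<dots> = (\<integral>x. D x * f x \<partial>M)"
    proof (rule integral_cong_AE)
      show "AE x in M. enn2real (RN_deriv M (distr M M T) x) * f x = D x * f x"
        using D(2) by eventually_elim (simp add: D(3))
    qed (use D(1) in measurable)
    finally show ?thesis .
  qed
  also have "\<dots> = (\<integral>x. f x \<partial>density M D)"
    by (subst integral_density) (use D in auto)
  also have "\<dots> = (\<integral>x. f (T x) \<partial>M)"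
    unfolding dens[symmetric] by (rule integral_distr) auto
  also have "\<dots> = (\<integral>x. indicator (A \<inter> (T -` B \<inter> space M)) x \<partial>M)"
  proof (rule integral_cong_AE)
    show "AE x in M. f (T x) = indicator (A \<inter> (T -` B \<inter> space M)) x"
      using S(2) AE_space by eventually_elim (auto simp: f_def split: split_indicator)
  qed measurable
  also have "\<dots> = measure M (A \<inter> (T -` B \<inter> space M))" by simp
  finally show ?thesis .
qed

section \<open>Reduction to countably many rational thresholds\<close>

lemma borel_eq_atMost_rat: "(borel :: real measure) = sigma UNIV (range (\<lambda>q::rat. {..of_rat q}))"
proof (rule borel_eq_sigmaI1[OF borel_eq_atMost])
  fix X :: "real set" assume "X \<in> range atMost"
  then obtain a where X: "X = {..a}" by blast
  have "{..a} = (\<Inter>q\<in>{q::rat. a \<le> of_rat q}. {..of_rat q})"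
  proof (intro antisym subsetI)
    fix x :: real assume x: "x \<in> (\<Inter>q\<in>{q::rat. a \<le> of_rat q}. {..of_rat q})"
    show "x \<in> {..a}"
    proof (rule ccontr)
      assume "x \<notin> {..a}"
      then obtain q :: rat where "a < of_rat q" "of_rat q < x" using of_rat_dense[of a x] by auto
      moreover have "x \<le> of_rat q" using x calculation(1) by force
      ultimately show False by simp
    qed
  qed auto
  also have "\<dots> \<in> sets (sigma UNIV (range (\<lambda>q::rat. {..of_rat q})))"
  proof (rule sets.countable_INT')
    obtain q :: rat where "a < of_rat q" using of_rat_dense[of a "a+1"] by auto
    then have "a \<le> of_rat q" by simp
    then show "{q::rat. a \<le> of_rat q} \<noteq> {}" by blast
  qed auto
  finally show "X \<in> sets (sigma UNIV (range (\<lambda>q::rat. {..real_of_rat q})))" unfolding X .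
qed auto

text \<open>The Borel sets for which convergence holds form a Dynkin class containing the rational
  half lines. Setwise convergence would not survive countable unions by itself; the fixed finite
  measure \<open>L\<close> dominates the terms, so Tannery's theorem applies.\<close>

lemma tendsto_measure_of_atMost_rat:
  fixes X :: "nat \<Rightarrow> 'a \<Rightarrow> real"
  assumes M: "prob_space M" and X: "\<And>k. X k \<in> borel_measurable M" and X0: "X0 \<in> borel_measurable M"
    and R: "\<And>k. R k \<in> sets M" and R0: "R0 \<in> sets M"
    and L: "finite_measure L" "sets L = sets borel"
    and bound: "\<And>k E. E \<in> sets borel \<Longrightarrow> measure M {x\<in>space M. X k x \<in> E} \<le> C * measure L E"
    and univ: "(\<lambda>k. measure M (R k)) \<longlonglongrightarrow> measure M R0"
    and lim: "\<And>q::rat. (\<lambda>k. measure M {x\<in>R k. X k x \<le> of_rat q}) \<longlonglongrightarrow> measure M {x\<in>R0. X0 x \<le> of_rat q}"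
    and A: "A \<in> sets borel"
  shows "(\<lambda>k. measure M {x\<in>R k. X k x \<in> A}) \<longlonglongrightarrow> measure M {x\<in>R0. X0 x \<in> A}"
proof -
  interpret prob_space M by fact
  interpret L: finite_measure L by fact
  have meas: "{x\<in>S. Y x \<in> E} \<in> sets M" if "S \<in> sets M" "Y \<in> borel_measurable M" "E \<in> sets borel" for S E and Y :: "'a \<Rightarrow> real"
  proof -
    have "{x\<in>S. Y x \<in> E} = S \<inter> (Y -` E \<inter> space M)" using sets.sets_into_space[OF that(1)] by auto
    then show ?thesis using that by (simp add: measurable_sets)
  qed
  have cpl: "measure M {x\<in>S. Y x \<in> UNIV - E} = measure M S - measure M {x\<in>S. Y x \<in> E}"
    if "S \<in> sets M" "Y \<in> borel_measurable M" "E \<in> sets borel" for S E and Y :: "'a \<Rightarrow> real"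
  proof -
    have "{x\<in>S. Y x \<in> UNIV - E} = S - {x\<in>S. Y x \<in> E}" by auto
    then show ?thesis using finite_measure_Diff[OF that(1) meas[OF that]] by auto
  qed
  have un: "(\<lambda>i. measure M {x\<in>S. Y x \<in> E i}) sums measure M {x\<in>S. Y x \<in> (\<Union>i. E i)}"
    if "S \<in> sets M" "Y \<in> borel_measurable M" "range E \<subseteq> sets borel" "disjoint_family E" for S and E :: "nat \<Rightarrow> real set" and Y
  proof -
    have "{x\<in>S. Y x \<in> (\<Union>i. E i)} = (\<Union>i. {x\<in>S. Y x \<in> E i})" by auto
    moreover have "(\<lambda>i. measure M {x\<in>S. Y x \<in> E i}) sums measure M (\<Union>i. {x\<in>S. Y x \<in> E i})"
      using that meas[OF that(1,2)] by (intro finite_measure_UNION) (auto simp: disjoint_family_on_def)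
    ultimately show ?thesis by simp
  qed
  define G where "G = range (\<lambda>q::rat. {..(of_rat q :: real)})"
  have G: "sigma_sets UNIV G = sets borel"
    unfolding G_def by (subst borel_eq_atMost_rat) simp
  have "Int_stable G"
  proof (rule Int_stableI)
    fix a b assume "a \<in> G" "b \<in> G"
    then obtain q r :: rat where qr: "a = {..of_rat q}" "b = {..of_rat r}" unfolding G_def by blast
    have "a \<inter> b = {..of_rat (min q r)}" 
      unfolding qr min_def by (cases "q \<le> r") (auto simp: of_rat_less_eq intro: order_trans)
    then show "a \<inter> b \<in> G" unfolding G_def by blast
  qed
  moreover have "G \<subseteq> Pow UNIV" by simp
  moreover have "A \<in> sigma_sets UNIV G" using A G by simp
  ultimately show ?thesis
  proof (induction rule: sigma_sets_induct_disjoint)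
    case (basic E)
    then obtain q where "E = {..of_rat q}" unfolding G_def by blast
    then show ?case using lim[of q] by simp
  next
    case empty
    show ?case by simp
  next
    case (compl E)
    then have E: "E \<in> sets borel" using G by simp
    show ?case
      unfolding cpl[OF R X E] cpl[OF R0 X0 E] by (intro tendsto_diff univ compl(2))
  next
    case (union E)
    have E: "range E \<subseteq> sets borel" using union(2) G by simp
    have "summable (\<lambda>i. measure L (E i))"
      using E union(1) L(2) L.finite_measure_UNION[of E] by (auto dest: sums_summable)
    then have s: "summable (\<lambda>i. C * measure L (E i))" by (rule summable_mult)
    have b: "measure M {x \<in> R k. X k x \<in> E i} \<le> C * measure L (E i)" for i k
    proof -
      have "measure M {x \<in> R k. X k x \<in> E i} \<le> measure M {x \<in> space M. X k x \<in> E i}"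
        using meas[OF sets.top X, of "E i" k] E sets.sets_into_space[OF R, of k] by (intro finite_measure_mono) auto
      also have "\<dots> \<le> C * measure L (E i)" using E by (intro bound) auto
      finally show ?thesis .
    qed
    have "(\<lambda>k. \<Sum>i. measure M {x \<in> R k. X k x \<in> E i}) \<longlonglongrightarrow> (\<Sum>i. measure M {x \<in> R0. X0 x \<in> E i})"
      by (rule tannerys_theorem[OF union(3) _ s, THEN conjunct2, THEN conjunct2])
        (use b in \<open>auto intro!: always_eventually\<close>)
    then show ?case
      using un[OF R X E union(1)] un[OF R0 X0 E union(1)] by (simp add: sums_iff)
  qed
qed

text \<open>Joint distribution functions of the ranks of \<open>x\<close> and \<open>a g x\<close>
  at rational thresholds. The countable index set makes the target a metric space with a countable
  base.\<close>

definition acoord :: "'x::polish_space measure \<Rightarrow> ('g \<Rightarrow> 'x \<Rightarrow> 'x) \<Rightarrow> 'g \<times> rat \<times> rat \<Rightarrow> real" where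
  "acoord \<nu> a = (\<lambda>(g, u, v). measure \<nu> {x. rank \<nu> x \<le> of_rat u \<and> rank \<nu> (a g x) \<le> of_rat v})"

lemma rank_le_1: "nonatomic_prob m \<Longrightarrow> rank m x \<le> 1"
  unfolding rank_def
  by (metis real_distribution_hlaw real_distribution.axioms(1) prob_space.prob_le_1 cdf_def)

text \<open>The threshold on \<open>x\<close> is extended to Borel sets first, the one on the moved
  point second. The dominating measure is the law of the rank, with factor 1 in the first extension
  and with the constant of \<open>stat_action_bound\<close> in the second.\<close>

lemma tendsto_of_acoord:
  fixes b :: "nat \<Rightarrow> 'g::{group_add,countable} \<Rightarrow> 'x::polish_space \<Rightarrow> 'x"
  assumes gen: "gen_semigroup (set_pmf \<mu>) = UNIV" and \<nu>: "nonatomic_prob \<nu>"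
    and b: "\<And>k. stat_action \<mu> \<nu> (b k)" and a: "stat_action \<mu> \<nu> a"
    and lim: "(\<lambda>k. acoord \<nu> (b k)) \<longlonglongrightarrow> acoord \<nu> a"
    and A: "A \<in> sets borel" and B: "B \<in> sets borel"
  shows "(\<lambda>k. measure \<nu> (A \<inter> b k g -` B)) \<longlonglongrightarrow> measure \<nu> (A \<inter> a g -` B)"
proof -
  interpret prob_space \<nu> using \<nu> unfolding nonatomic_prob_def by blast
  have S: "sets \<nu> = sets borel" "space \<nu> = UNIV"
    using \<nu> space_nonatomic_prob unfolding nonatomic_prob_def by blast+
  have [measurable]: "rank \<nu> \<in> borel_measurable borel" "sec \<nu> \<in> borel_measurable borel"
    using measurable_rank[OF \<nu>] measurable_sec[OF \<nu>] by auto
  have r: "rank \<nu> \<in> borel_measurable \<nu>" using measurable_rank[OF \<nu>] by (simp add: measurable_nonatomic_prob[OF \<nu>])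
  have bm: "b k g \<in> measurable borel borel" "a g \<in> measurable borel borel" for k
    using stat_actionD(2)[OF b, of k g] stat_actionD(2)[OF a, of g] by (simp_all add: measurable_nonatomic_prob[OF \<nu>])
  note [measurable] = bm
  obtain C where C: "\<And>\<alpha> E. stat_action \<mu> \<nu> \<alpha> \<Longrightarrow> E \<in> sets borel \<Longrightarrow> measure \<nu> (\<alpha> g -` E) \<le> C * measure \<nu> E"
    using stat_action_bound[OF gen, of g, where 'a = 'x] S by fastforce
  define L where "L = distr \<nu> borel (rank \<nu>)"
  have fin: "finite_measure L" "sets L = sets borel"
    unfolding L_def using prob_space_distr[OF r] by (auto simp: prob_space_def)
  have Lm: "measure L E = measure \<nu> {x. rank \<nu> x \<in> E}" if "E \<in> sets borel" for E
    unfolding L_def using that by (subst measure_distr[OF r]) (auto simp: S vimage_def)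
  have step1: "(\<lambda>k. measure \<nu> {x\<in>{x. rank \<nu> (b k g x) \<le> of_rat v}. rank \<nu> x \<in> E})
      \<longlonglongrightarrow> measure \<nu> {x\<in>{x. rank \<nu> (a g x) \<le> of_rat v}. rank \<nu> x \<in> E}" if E: "E \<in> sets borel" for v E
  proof (rule tendsto_measure_of_atMost_rat[where L = L and C = 1, OF prob_space_axioms r r _ _ fin _ _ _ E])
    show lim1: "(\<lambda>k. measure \<nu> {x \<in> {x. rank \<nu> (b k g x) \<le> of_rat v}. rank \<nu> x \<le> of_rat q})
        \<longlonglongrightarrow> measure \<nu> {x \<in> {x. rank \<nu> (a g x) \<le> of_rat v}. rank \<nu> x \<le> of_rat q}" for q
      using lim[unfolded tendsto_fun_iff, rule_format, of "(g, q, v)"] by (simp add: acoord_def conj_commute)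
    \<comment> \<open>Ranks never exceed 1, so the threshold 1 is vacuous and yields convergence of
      the total masses.\<close>
    show "(\<lambda>k. measure \<nu> {x. rank \<nu> (b k g x) \<le> of_rat v}) \<longlonglongrightarrow> measure \<nu> {x. rank \<nu> (a g x) \<le> of_rat v}"
      using lim1[of 1] rank_le_1[OF \<nu>] by simp
  qed (auto simp: Lm S)
  have step2: "(\<lambda>k. measure \<nu> {x\<in>{x. rank \<nu> x \<in> E}. rank \<nu> (b k g x) \<in> F})
      \<longlonglongrightarrow> measure \<nu> {x\<in>{x. rank \<nu> x \<in> E}. rank \<nu> (a g x) \<in> F}" if E: "E \<in> sets borel" and F: "F \<in> sets borel" for E F
  proof (rule tendsto_measure_of_atMost_rat[where L = L and C = C, OF prob_space_axioms _ _ _ _ fin _ _ _ F])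
    show "(\<lambda>k. measure \<nu> {x \<in> {x. rank \<nu> x \<in> E}. rank \<nu> (b k g x) \<le> of_rat q})
        \<longlonglongrightarrow> measure \<nu> {x \<in> {x. rank \<nu> x \<in> E}. rank \<nu> (a g x) \<le> of_rat q}" for q
      using step1[OF E, of q] by (simp add: conj_commute)
    show "(\<lambda>x. rank \<nu> (b k g x)) \<in> borel_measurable \<nu>" "(\<lambda>x. rank \<nu> (a g x)) \<in> borel_measurable \<nu>" for k
      by (simp_all add: measurable_nonatomic_prob[OF \<nu>])
    show "measure \<nu> {x \<in> space \<nu>. rank \<nu> (b k g x) \<in> E'} \<le> C * measure L E'" if "E' \<in> sets borel" for k E'
    proof -
      have "{x. rank \<nu> x \<in> E'} \<in> sets borel" using measurable_sets[OF measurable_rank[OF \<nu>] that] by (simp add: vimage_def)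
      from C[OF b this, of k] show ?thesis using that by (simp add: Lm S vimage_def)
    qed
  qed (use E measurable_sets[OF measurable_rank[OF \<nu>] E] in \<open>auto simp: S vimage_def\<close>)
  \<comment> \<open>Up to a null set a point is \<open>sec\<close> of its rank, at \<open>x\<close>
    as well as at \<open>c g x\<close>, so conditions on points become conditions on ranks.\<close>
  have *: "measure \<nu> (A \<inter> c g -` B) =
      measure \<nu> {x\<in>{x. rank \<nu> x \<in> sec \<nu> -` A}. rank \<nu> (c g x) \<in> sec \<nu> -` B}" if c: "stat_action \<mu> \<nu> c" for c
  proof (rule measure_eq_AE)
    have [measurable]: "c g \<in> borel \<rightarrow>\<^sub>M borel"
      using stat_actionD(2)[OF c, of g] by (simp add: measurable_nonatomic_prob[OF \<nu>])
    show "AE x in \<nu>. (x \<in> A \<inter> c g -` B) = (x \<in> {x\<in>{x. rank \<nu> x \<in> sec \<nu> -` A}. rank \<nu> (c g x) \<in> sec \<nu> -` B})"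
      using sec_rank[OF \<nu>] stat_action_AE[OF gen c sec_rank[OF \<nu>], of g] by eventually_elim simp
    show "A \<inter> c g -` B \<in> sets \<nu>"
      using A measurable_sets[OF \<open>c g \<in> borel \<rightarrow>\<^sub>M borel\<close> B] unfolding S by (simp add: sets.Int)
    have "(\<lambda>x. sec \<nu> (rank \<nu> x)) -` A \<inter> (\<lambda>x. sec \<nu> (rank \<nu> (c g x))) -` B \<in> sets borel"
      using measurable_sets[of "\<lambda>x. sec \<nu> (rank \<nu> x)" borel borel A] A
        measurable_sets[of "\<lambda>x. sec \<nu> (rank \<nu> (c g x))" borel borel B] B by (intro sets.Int) auto
    then show "{x\<in>{x. rank \<nu> x \<in> sec \<nu> -` A}. rank \<nu> (c g x) \<in> sec \<nu> -` B} \<in> sets \<nu>"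
      unfolding S by (simp add: vimage_def Collect_conj_eq)
  qed
  show ?thesis
    unfolding *[OF b] *[OF a]
    using measurable_sets[OF measurable_sec[OF \<nu>] A] measurable_sets[OF measurable_sec[OF \<nu>] B]
    by (intro step2) auto
qed

lemma topspace_A_mu_topology: "topspace (A_mu_topology \<mu> M) = A_mu \<mu> M"
  unfolding A_mu_topology_def very_weak_topology_def
  by (auto simp: topspace_pullback_topology A_mu_def)

text \<open>The very weak topology is given by all pairs of measurable sets. Knowing that rational
  rank coordinates suffice makes sequences available and gives the countable family of basic open
  sets used in the category argument.\<close>

lemma A_mu_topology_eq:
  fixes \<mu> :: "'g::{group_add,countable} pmf"
  assumes gen: "gen_semigroup (set_pmf \<mu>) = UNIV" and \<nu>: "nonatomic_prob \<nu>"
  shows "A_mu_topology \<mu> \<nu> = pullback_topology (A_mu \<mu> \<nu>) (acoord \<nu>) euclidean"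
proof -
  interpret prob_space \<nu> using \<nu> unfolding nonatomic_prob_def by blast
  have S: "sets \<nu> = sets borel" "space \<nu> = UNIV"
    using \<nu> space_nonatomic_prob unfolding nonatomic_prob_def by blast+
  have A: "a \<in> A_mu \<mu> \<nu> \<longleftrightarrow> stat_action \<mu> \<nu> a" for a by (rule A_mu_iff[OF gen prob_space_axioms])
  have aut: "a g \<in> aut_star \<nu>" if "a \<in> A_mu \<mu> \<nu>" for a g using that unfolding A_mu_def by blast
  have coords: "very_weak_coords \<nu> (a g) (E, F) = measure \<nu> (E \<inter> a g -` F)"
    if "a \<in> A_mu \<mu> \<nu>" "E \<in> sets borel" "F \<in> sets borel" for a g E F
    using very_weak_coords_eq[OF prob_space_axioms aut[OF that(1), of g], of E F] that by (simp add: S)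
  have "A_mu_topology \<mu> \<nu> = pullback_topology (topspace (A_mu_topology \<mu> \<nu>)) (acoord \<nu>) euclidean"
  proof (rule pullback_topology_of_sequences)
    have "continuous_map (A_mu_topology \<mu> \<nu>) euclideanreal (\<lambda>a. acoord \<nu> a i)" for i
    proof -
      obtain g u v where i: "i = (g, u, v)" by (metis prod_cases3)
      define E where "E q = {x. rank \<nu> x \<le> of_rat q}" for q
      have E: "E q \<in> sets borel" for q
        using measurable_sets[OF measurable_rank[OF \<nu>], of "{..of_rat q}"] by (simp add: E_def vimage_def atMost_def)
      have "continuous_map (product_topology (\<lambda>g::'g. very_weak_topology \<nu>) UNIV) (very_weak_topology \<nu>) (\<lambda>a. a g)"
        by (rule continuous_map_product_projection) simp
      moreover have "continuous_map (very_weak_topology \<nu>) euclideanreal ((\<lambda>c. c (E u, E v)) \<circ> very_weak_coords \<nu>)"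
        unfolding very_weak_topology_def by (rule continuous_map_pullback) simp
      ultimately have "continuous_map (A_mu_topology \<mu> \<nu>) euclideanreal
         (((\<lambda>c. c (E u, E v)) \<circ> very_weak_coords \<nu>) \<circ> (\<lambda>a. a g))"
        unfolding A_mu_topology_def
        by (intro continuous_map_from_subtopology) (rule continuous_map_compose)
      then show ?thesis
        by (rule continuous_map_eq)
          (auto simp: topspace_A_mu_topology coords E i acoord_def, auto simp: E_def vimage_def Int_def)
    qed
    then show "continuous_map (A_mu_topology \<mu> \<nu>) euclidean (acoord \<nu>)"
      unfolding euclidean_product_topology[symmetric] continuous_map_componentwise_UNIV by blast
  next
    fix b a
    assume *: "\<And>k::nat. b k \<in> topspace (A_mu_topology \<mu> \<nu>)" "a \<in> topspace (A_mu_topology \<mu> \<nu>)"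
      "(\<lambda>k. acoord \<nu> (b k)) \<longlonglongrightarrow> acoord \<nu> a"
    then have ba: "\<And>k. b k \<in> A_mu \<mu> \<nu>" "a \<in> A_mu \<mu> \<nu>" by (simp_all add: topspace_A_mu_topology)
    have "(\<lambda>k. very_weak_coords \<nu> (b k g) EF) \<longlonglongrightarrow> very_weak_coords \<nu> (a g) EF" for g EF
    proof (cases "fst EF \<in> sets borel \<and> snd EF \<in> sets borel")
      case True
      then obtain E F where "EF = (E, F)" "E \<in> sets borel" "F \<in> sets borel" by (cases EF) auto
      then show ?thesis
        using tendsto_of_acoord[OF gen \<nu> _ _ *(3), of E F g] ba coords by (simp add: A)
    next
      case False
      then show ?thesis by (cases EF) (auto simp: very_weak_coords_def S)
    qed
    then have "limitin (very_weak_topology \<nu>) (\<lambda>k. b k g) (a g) sequentially" for g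
      unfolding very_weak_topology_def using ba aut
      by (intro limitin_pullback_topology) (auto simp: tendsto_fun_iff)
    then show "limitin (A_mu_topology \<mu> \<nu>) b a sequentially"
      unfolding A_mu_topology_def limitin_subtopology limitin_componentwise
      using ba by (auto simp: very_weak_topology_def topspace_pullback_topology aut intro!: always_eventually)
  qed
  then show ?thesis unfolding topspace_A_mu_topology .
qed

section \<open>Injective perturbations in perfect Polish spaces\<close>

text \<open>\<open>U - N\<close> is open and nonempty, and perfectness forbids it to be a singleton.
  A radius of at most a third of the distance of two of its points separates the closed
  balls.\<close>

lemma split_balls:
  fixes U :: "'z::{polish_space,perfect_space} set"
  assumes U: "open U" "U \<noteq> {}" and N: "closed N" "interior N = {}" and "\<epsilon> > 0"
  shows "\<exists>c d r. 0 < r \<and> r \<le> \<epsilon> \<and> cball c r \<subseteq> U - N \<and> cball d r \<subseteq> U - N \<and> cball c r \<inter> cball d r = {}"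
proof -
  have o: "open (U - N)" using U N by (simp add: open_Diff)
  have "U - N \<noteq> {}" using U N by (metis Diff_eq_empty_iff interior_maximal subset_empty)
  then obtain c where c: "c \<in> U - N" by blast
  have "U - N \<noteq> {c}" using o not_open_singleton by metis
  then obtain d where d: "d \<in> U - N" "d \<noteq> c" using c by blast
  obtain r1 where r1: "r1 > 0" "cball c r1 \<subseteq> U - N" using o c by (meson open_contains_cball)
  obtain r2 where r2: "r2 > 0" "cball d r2 \<subseteq> U - N" using o d by (meson open_contains_cball)
  define r where "r = Min {r1, r2, \<epsilon>, dist c d / 3}"
  have r: "0 < r" "r \<le> r1" "r \<le> r2" "r \<le> \<epsilon>" "r \<le> dist c d / 3"
    using r1 r2 d assms(5) by (auto simp: r_def)
  have "cball c r \<inter> cball d r = {}"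
  proof (rule ccontr)
    assume "cball c r \<inter> cball d r \<noteq> {}"
    then obtain x where x: "dist c x \<le> r" "dist d x \<le> r" by auto
    have "dist c d \<le> dist c x + dist d x" by (metis dist_triangle2)
    then have "dist c d \<le> 2 * (dist c d / 3)" using x r(5) by linarith
    then show False using d(2) by simp
  qed
  moreover have "cball c r \<subseteq> U - N" "cball d r \<subseteq> U - N"
    using r1(2) r2(2) subset_cball[OF r(2), of c] subset_cball[OF r(3), of d] by auto
  ultimately show ?thesis using r(1,4) by blast
qed

text \<open>The newest bit stands first, so that passing to one more bit is a \<open>Cons\<close>
  and matches the recursion of the tree below.\<close>

definition prefix_list :: "(nat \<Rightarrow> bool) \<Rightarrow> nat \<Rightarrow> bool list" where
  "prefix_list s n = rev (map s [0..<n])"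

lemma prefix_list_simps [simp]:
  "prefix_list s 0 = []" "prefix_list s (Suc n) = s n # prefix_list s n" "length (prefix_list s n) = n"
  by (simp_all add: prefix_list_def)

lemma measurable_prefix_list:
  assumes [measurable]: "\<And>n. Measurable.pred M (\<lambda>\<omega>. s \<omega> n)"
  shows "(\<lambda>\<omega>. prefix_list (s \<omega>) n) \<in> measurable M (count_space UNIV)"
proof (induction n)
  case (Suc n)
  have "(\<lambda>\<omega>. (if s \<omega> n then True # l else False # l)) \<in> measurable M (count_space UNIV)" for l
    by measurable
  from measurable_compose_countable[OF this Suc]
  have "(\<lambda>\<omega>. if s \<omega> n then True # prefix_list (s \<omega>) n else False # prefix_list (s \<omega>) n) \<in> measurable M (count_space UNIV)" .
  then show ?case by (rule measurable_cong[THEN iffD1, rotated]) auto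
qed simp

text \<open>A binary tree of closed balls: the children of a node of length \<open>n\<close> are
  disjoint, avoid \<open>N n\<close>, and have radius at most half of the preceding bound. Removing
  one nowhere dense closed set per level makes every branch avoid all of them.\<close>

lemma cantor_scheme:
  fixes U :: "'z::{polish_space,perfect_space} set" and N :: "nat \<Rightarrow> 'z set"
  assumes U: "open U" "U \<noteq> {}" and N: "\<And>n. closed (N n)" "\<And>n. interior (N n) = {}"
  obtains K :: "bool list \<Rightarrow> 'z set" and c :: "bool list \<Rightarrow> 'z" where
    "\<And>l. closed (K l)" "\<And>l. c l \<in> K l" "\<And>b l. K (b # l) \<subseteq> K l" "\<And>b l. K (b # l) \<subseteq> U - N (length l)"
    "\<And>l. K (True # l) \<inter> K (False # l) = {}"
    "\<And>l x. x \<in> K l \<Longrightarrow> dist x (c l) \<le> (1/2)^length l"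
proof -
  define good where "good n x q \<longleftrightarrow> (case q of (c0, c1, r') \<Rightarrow>
      0 < r' \<and> r' \<le> (1/2)^Suc n \<and> cball c0 r' \<subseteq> ball (fst x) (snd x) - N n
      \<and> cball c1 r' \<subseteq> ball (fst x) (snd x) - N n \<and> cball c0 r' \<inter> cball c1 r' = {})"
    for n and x :: "'z \<times> real" and q
  have ex: "\<exists>q. 0 < snd x \<longrightarrow> good n x q" for n x
  proof (cases "0 < snd x")
    case True
    then obtain c d r where "0 < r" "r \<le> (1/2)^Suc n" "cball c r \<subseteq> ball (fst x) (snd x) - N n"
      "cball d r \<subseteq> ball (fst x) (snd x) - N n" "cball c r \<inter> cball d r = {}"
      using split_balls[of "ball (fst x) (snd x)" "N n" "(1/2)^Suc n"] N by auto
    then have "good n x (c, d, r)" unfolding good_def by simp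
    then show ?thesis by blast
  qed simp
  define p where "p n x = (SOME q. 0 < snd x \<longrightarrow> good n x q)" for n x
  have p': "0 < snd x \<Longrightarrow> good n x (p n x)" for n x
    using someI_ex[OF ex[of x n]] unfolding p_def by blast
  have p: "case p n (c, r) of (c0, c1, r') \<Rightarrow>
      0 < r' \<and> r' \<le> (1/2)^Suc n \<and> cball c0 r' \<subseteq> ball c r - N n \<and> cball c1 r' \<subseteq> ball c r - N n
      \<and> cball c0 r' \<inter> cball c1 r' = {}" if "0 < r" for n c r
    using p'[of "(c, r)" n] that unfolding good_def by simp
  obtain x0 where "x0 \<in> U" using U by blast
  then obtain r0 where r0: "0 < r0" "ball x0 r0 \<subseteq> U" using U openE by blast
  define r1 where "r1 = min r0 1"
  have r1: "0 < r1" "r1 \<le> 1" "ball x0 r1 \<subseteq> U" using r0 subset_ball[of r1 r0 x0] by (auto simp: r1_def)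
  define x1 where "x1 = (x0, r1/2)"
  have x1: "0 < snd x1" "snd x1 \<le> 1" "ball (fst x1) (snd x1) \<subseteq> U"
    using r1 subset_ball[of "r1/2" r1 x0] by (auto simp: x1_def)
  define node :: "bool list \<Rightarrow> 'z \<times> real" where
    "node = rec_list x1 (\<lambda>b l y. case p (length l) y of (c0, c1, r') \<Rightarrow> (if b then c1 else c0, r'))"
  have node: "node [] = x1"
    "node (b # l) = (case p (length l) (node l) of (c0, c1, r') \<Rightarrow> (if b then c1 else c0, r'))" for b l
    by (simp_all add: node_def)
  define c where "c l = fst (node l)" for l
  define r where "r l = snd (node l)" for l
  have inv: "0 < r l \<and> r l \<le> (1/2)^length l \<and> ball (c l) (r l) \<subseteq> U" for l
  proof (induction l)
    case Nil
    show ?case using x1 by (simp add: r_def c_def node)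
  next
    case (Cons b l)
    obtain c0 c1 r' where q: "p (length l) (node l) = (c0, c1, r')" by (metis prod_cases3)
    have "p (length l) (c l, r l) = (c0, c1, r')" using q by (simp add: c_def r_def)
    with p[of "r l" "length l" "c l"] Cons
    have *: "0 < r'" "r' \<le> (1/2)^Suc (length l)" "cball c0 r' \<subseteq> ball (c l) (r l) - N (length l)"
      "cball c1 r' \<subseteq> ball (c l) (r l) - N (length l)" by auto
    have "ball c0 r' \<subseteq> U" "ball c1 r' \<subseteq> U"
      using *(3,4) Cons ball_subset_cball[of c0 r'] ball_subset_cball[of c1 r'] by blast+
    then show ?case using *(1,2) unfolding r_def c_def node q by auto
  qed
  have step: "cball (c (b # l)) (r (b # l)) \<subseteq> ball (c l) (r l) - N (length l)"
    "cball (c (True # l)) (r (True # l)) \<inter> cball (c (False # l)) (r (False # l)) = {}" for b l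
  proof -
    obtain c0 c1 r' where q: "p (length l) (node l) = (c0, c1, r')" by (metis prod_cases3)
    have "p (length l) (c l, r l) = (c0, c1, r')" using q by (simp add: c_def r_def)
    with p[of "r l" "length l" "c l"] inv[of l]
    have *: "cball c0 r' \<subseteq> ball (c l) (r l) - N (length l)" "cball c1 r' \<subseteq> ball (c l) (r l) - N (length l)"
      "cball c0 r' \<inter> cball c1 r' = {}" by auto
    have n: "node (b # l) = (if b then c1 else c0, r')" for b by (simp add: node q)
    show "cball (c (b # l)) (r (b # l)) \<subseteq> ball (c l) (r l) - N (length l)"
      using * unfolding c_def[of "b # l"] r_def[of "b # l"] n by (cases b) auto
    show "cball (c (True # l)) (r (True # l)) \<inter> cball (c (False # l)) (r (False # l)) = {}"
      using *(3) unfolding c_def r_def n by auto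
  qed
  show thesis
  proof (rule that[of "\<lambda>l. cball (c l) (r l)" c])
    show "cball (c (b # l)) (r (b # l)) \<subseteq> cball (c l) (r l)" for b l
      using step(1)[of b l] ball_subset_cball[of "c l" "r l"] by blast
    show "cball (c (b # l)) (r (b # l)) \<subseteq> U - N (length l)" for b l
      using step(1)[of b l] inv[of l] by blast
    show "dist x (c l) \<le> (1/2)^length l" if "x \<in> cball (c l) (r l)" for x l
      using that inv[of l] by (auto simp: dist_commute)
    show "c l \<in> cball (c l) (r l)" for l using inv[of l] by simp
  qed (use step(2) in auto)
qed

text \<open>\<open>L s\<close> is the limit of the centres along the branch \<open>s\<close>. Nodes
  of equal length are disjoint, so bit \<open>n\<close> is read off by asking whether the point lies
  under some node that begins with \<open>True\<close>. Measurability of \<open>L\<close> is stated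
  for composites with measurable families of bits, which spares a structure on the space of bit
  sequences.\<close>

lemma cantor_injection:
  fixes U :: "'z::{polish_space,perfect_space} set" and N :: "nat \<Rightarrow> 'z set"
  assumes U: "open U" "U \<noteq> {}" and N: "\<And>n. closed (N n)" "\<And>n. interior (N n) = {}"
  shows "\<exists>(L :: (nat \<Rightarrow> bool) \<Rightarrow> 'z) (bits :: 'z \<Rightarrow> nat \<Rightarrow> bool).
    (\<forall>s. L s \<in> U \<and> (\<forall>n. L s \<notin> N n) \<and> bits (L s) = s) \<and>
    (\<forall>n. Measurable.pred borel (\<lambda>z. bits z n)) \<and>
    (\<forall>(M :: 'a measure) s. (\<forall>n. Measurable.pred M (\<lambda>\<omega>. s \<omega> n)) \<longrightarrow> (\<lambda>\<omega>. L (s \<omega>)) \<in> borel_measurable M)"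
proof (rule cantor_scheme[OF U N])
  fix K :: "bool list \<Rightarrow> 'z set" and c assume K: "\<And>l. closed (K l)" "\<And>l. c l \<in> K l" "\<And>b l. K (b # l) \<subseteq> K l"
    "\<And>b l. K (b # l) \<subseteq> U - N (length l)" "\<And>l. K (True # l) \<inter> K (False # l) = {}"
    "\<And>l x. x \<in> K l \<Longrightarrow> dist x (c l) \<le> (1/2)^length l"
  have mono: "K (prefix_list s (n + m)) \<subseteq> K (prefix_list s n)" for s n m
    by (induction m) (use K(3) in \<open>auto simp: subset_eq\<close>)
  have disj: "l = l'" if "x \<in> K l" "x \<in> K l'" "length l = length l'" for l l' x
    using that
  proof (induction l arbitrary: l')
    case (Cons b l)
    then obtain b' k where l': "l' = b' # k" "length l = length k" by (cases l') auto
    have "l = k" using Cons.IH[of k] Cons.prems K(3) l' by blast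
    moreover have "b = b'" using Cons.prems K(5)[of l] l' calculation by (cases b; cases b') auto
    ultimately show ?case using l' by simp
  qed simp
  define x where "x s n = c (prefix_list s n)" for s n
  have xK: "x s (n + m) \<in> K (prefix_list s n)" for s n m
    unfolding x_def using K(2) mono[of s n m] by blast
  have conv: "\<exists>z. x s \<longlonglongrightarrow> z" for s
  proof -
    have "Cauchy (x s)"
    proof (rule metric_CauchyI)
      fix e :: real assume "0 < e"
      then obtain n where n: "(1/2::real)^n < e / 2" using real_arch_pow_inv[of "e/2" "1/2"] by auto
      have "dist (x s m) (c (prefix_list s n)) < e / 2" if "n \<le> m" for m
        using K(6)[OF xK[of s n "m - n"]] n that by simp
      then show "\<exists>n0. \<forall>m\<ge>n0. \<forall>k\<ge>n0. dist (x s m) (x s k) < e"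
        by (intro exI[of _ n]) (meson dist_triangle_half_l)
    qed
    then show ?thesis using Cauchy_convergent convergent_def by blast
  qed
  define L where "L s = lim (x s)" for s
  have L: "x s \<longlonglongrightarrow> L s" for s using conv[of s] unfolding L_def by (metis limI)
  have LK: "L s \<in> K (prefix_list s n)" for s n
  proof (rule closed_sequentially[OF K(1)])
    show "(\<lambda>m. x s (n + m)) \<longlonglongrightarrow> L s" using LIMSEQ_ignore_initial_segment[OF L, of s n] by (simp add: add.commute)
  qed (rule xK)
  define bits where "bits z n \<longleftrightarrow> (\<exists>l. length l = n \<and> z \<in> K (True # l))" for z n
  show ?thesis
  proof (intro exI conjI allI impI)
    show "L s \<in> U" for s using LK[of s "Suc 0"] K(4) by auto
    show "L s \<notin> N n" for s n using LK[of s "Suc n"] K(4)[of "s n" "prefix_list s n"] by auto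
    show "bits (L s) = s" for s
    proof
      fix n
      show "bits (L s) n = s n"
      proof
        assume "bits (L s) n"
        then obtain l where l: "length l = n" "L s \<in> K (True # l)" unfolding bits_def by blast
        have "True # l = prefix_list s (Suc n)" by (rule disj[OF l(2) LK]) (simp add: l)
        then show "s n" by simp
      next
        assume "s n"
        then show "bits (L s) n" unfolding bits_def
          using LK[of s "Suc n"] by (intro exI[of _ "prefix_list s n"]) simp
      qed
    qed
    show "Measurable.pred borel (\<lambda>z. bits z n)" for n
    proof -
      have "{z. bits z n} = (\<Union>l\<in>{l. length l = n}. K (True # l))" unfolding bits_def by auto
      also have "\<dots> \<in> sets borel" using K(1) by (intro sets.countable_UN') auto
      finally show ?thesis by (simp add: pred_def)
    qed
    fix M :: "'a measure" and s :: "'a \<Rightarrow> nat \<Rightarrow> bool"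
    assume "\<forall>n. Measurable.pred M (\<lambda>\<omega>. s \<omega> n)"
    then have s: "Measurable.pred M (\<lambda>\<omega>. s \<omega> n)" for n by blast
    show "(\<lambda>\<omega>. L (s \<omega>)) \<in> borel_measurable M"
    proof (rule borel_measurable_LIMSEQ_metric[of "\<lambda>n \<omega>. x (s \<omega>) n"])
      show "(\<lambda>\<omega>. x (s \<omega>) n) \<in> borel_measurable M" for n
        unfolding x_def using measurable_prefix_list[where M = M and s = s and n = n, OF s]
        by (rule measurable_compose) simp
    qed (rule L)
  qed
qed

section \<open>Borel embeddings close to a given map\<close>

lemma interior_frontier_open: "open U \<Longrightarrow> interior (frontier U) = {}"
proof -
  assume U: "open U"
  have "interior (frontier U) \<inter> U = {}"
    using interior_subset[of "frontier U"] U by (auto simp: frontier_def interior_open)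
  then have "interior (frontier U) \<inter> closure U = {}" by (simp add: open_Int_closure_eq_empty)
  then show ?thesis using interior_subset[of "frontier U"] by (auto simp: frontier_def)
qed

text \<open>Injectivity with a Borel left inverse makes the orbit map an isomorphism onto its law;
  missing the frontiers makes that law a \<open>good_law\<close> when the source is
  nonatomic.\<close>

definition embeds :: "('x::polish_space \<Rightarrow> 'z::polish_space) \<Rightarrow> bool" where
  "embeds f \<longleftrightarrow> f \<in> borel_measurable borel \<and> (\<forall>x. f x \<notin> frontiers) \<and>
     (\<exists>e. e \<in> borel_measurable borel \<and> (\<forall>x. e (f x) = x))"

text \<open>Near each value \<open>r\<close> of \<open>F\<close> the bits of the code of
  \<open>x\<close> are written into a Cantor set inside a small ball around \<open>r\<close>. The
  balls are disjoint, so the decoder finds \<open>r\<close> from the ball it is in and then reads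
  the bits.\<close>

lemma embeds_near_simple:
  fixes F :: "'x::polish_space \<Rightarrow> 'z::{polish_space,perfect_space}"
  assumes F: "simple_function borel F" and \<epsilon>: "\<epsilon> > 0"
  shows "\<exists>f. embeds f \<and> (\<forall>x. dist (f x) (F x) < \<epsilon>)"
proof -
  define R where "R = range F"
  have R: "finite R" using F simple_functionD(1)[OF F] by (simp add: R_def)
  obtain d where d: "d > 0" "\<And>r r'. r \<in> R \<Longrightarrow> r' \<in> R \<Longrightarrow> r \<noteq> r' \<Longrightarrow> d \<le> dist r r'"
  proof -
    \<comment> \<open>The added 1 keeps the minimum meaningful when \<open>F\<close> takes a single
      value.\<close>
    define D where "D = insert 1 ((\<lambda>(r, r'). dist r r') ` {p \<in> R \<times> R. fst p \<noteq> snd p})"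
    have D: "finite D" "D \<noteq> {}" "\<And>x. x \<in> D \<Longrightarrow> x > 0" using R by (auto simp: D_def)
    have "Min D \<le> dist r r'" if "r \<in> R" "r' \<in> R" "r \<noteq> r'" for r r'
      using that by (intro Min_le[OF D(1)]) (force simp: D_def)
    moreover have "Min D > 0" using D Min_in by blast
    ultimately show thesis using that by blast
  qed
  define \<delta> where "\<delta> = min \<epsilon> (d / 2)"
  have \<delta>: "0 < \<delta>" "\<delta> \<le> \<epsilon>" "\<delta> \<le> d / 2" using \<epsilon> d(1) by (auto simp: \<delta>_def)
  have disj: "r = r'" if "r \<in> R" "r' \<in> R" "z \<in> ball r \<delta>" "z \<in> ball r' \<delta>" for r r' z
  proof (rule ccontr)
    assume "r \<noteq> r'"
    then have "d \<le> dist r r'" using d(2) that by blast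
    also have "dist r r' \<le> dist r z + dist r' z" by (metis dist_triangle2)
    also have "\<dots> < d / 2 + d / 2" using that(3,4) \<delta>(3) by auto
    finally show False by simp
  qed
  define good where "good r L bits \<longleftrightarrow>
    (\<forall>s. L s \<in> ball r \<delta> \<and> (\<forall>n. L s \<notin> frontier (base_set n)) \<and> bits (L s) = s) \<and>
    (\<forall>n. Measurable.pred borel (\<lambda>z. bits z n)) \<and>
    (\<forall>(M :: 'x measure) s. (\<forall>n. Measurable.pred M (\<lambda>\<omega>. s \<omega> n)) \<longrightarrow> (\<lambda>\<omega>. L (s \<omega>)) \<in> borel_measurable M)"
    for r :: 'z and L :: "(nat \<Rightarrow> bool) \<Rightarrow> 'z" and bits
  have "\<exists>L bits. good r L bits" for r
    unfolding good_def
    by (rule cantor_injection) (use \<delta> in \<open>auto simp: interior_frontier_open open_base_set\<close>)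
  then obtain L bits where good: "\<And>r. good r (L r) (bits r)" by metis
  note good' = good[unfolded good_def]
  have L: "L r s \<in> ball r \<delta>" "L r s \<notin> frontier (base_set n :: 'z set)" "bits r (L r s) = s"
    "Measurable.pred borel (\<lambda>z. bits r z n)" for r s n
    by (rule good'[THEN conjunct1, THEN spec, THEN conjunct1],
        rule good'[THEN conjunct1, THEN spec, THEN conjunct2, THEN conjunct1, THEN spec],
        rule good'[THEN conjunct1, THEN spec, THEN conjunct2, THEN conjunct2],
        rule good'[THEN conjunct2, THEN conjunct1, THEN spec])
  have L_meas: "(\<lambda>\<omega>. L r (s \<omega>)) \<in> borel_measurable M"
    if "\<And>n. Measurable.pred M (\<lambda>\<omega>. s \<omega> n)" for r and M :: "'x measure" and s
    by (rule good'[THEN conjunct2, THEN conjunct2, THEN spec, THEN spec, THEN mp]) (use that in blast)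
  define f where "f x = L (F x) (\<lambda>n. x \<in> base_set n)" for x
  define e :: "'z \<Rightarrow> 'x" where "e z = decode (code3 (\<lambda>n. \<exists>r\<in>R. z \<in> ball r \<delta> \<and> bits r z n))" for z
  have "f \<in> borel_measurable borel"
  proof -
    have "(\<lambda>x :: 'x. L r (\<lambda>n. x \<in> base_set n)) \<in> borel_measurable borel" for r
      by (rule L_meas) (simp add: pred_def open_base_set)
    moreover have "F \<in> measurable borel (count_space R)"
      using measurable_simple_function[OF F] unfolding measurable_def R_def by auto
    ultimately show ?thesis
      unfolding f_def by (rule measurable_compose_countable') (use R countable_finite in auto)
  qed
  moreover have "e \<in> borel_measurable borel"
  proof -
    have [measurable]: "Measurable.pred borel (\<lambda>z. \<exists>r\<in>R. z \<in> ball r \<delta> \<and> bits r z n)" for n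
    proof -
      have "{z. \<exists>r\<in>R. z \<in> ball r \<delta> \<and> bits r z n} = (\<Union>r\<in>R. ball r \<delta> \<inter> {z. bits r z n})" by auto
      also have "\<dots> \<in> sets borel" using R L(4) by (intro sets.finite_UN sets.Int) (auto simp: pred_def)
      finally show ?thesis by (simp add: pred_def)
    qed
    show ?thesis unfolding e_def by measurable
  qed
  moreover have "e (f x) = x" for x
  proof -
    have "(\<exists>r\<in>R. f x \<in> ball r \<delta> \<and> bits r (f x) n) = (x \<in> base_set n)" for n
    proof -
      have x: "F x \<in> R" "f x \<in> ball (F x) \<delta>" using L(1) by (auto simp: R_def f_def)
      then have "(\<exists>r\<in>R. f x \<in> ball r \<delta> \<and> bits r (f x) n) = bits (F x) (f x) n"
        using disj by blast
      then show ?thesis unfolding f_def L(3) .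
    qed
    then have "e (f x) = decode (hcode x)" unfolding e_def hcode_def by simp
    then show ?thesis by simp
  qed
  moreover have "f x \<notin> frontiers" for x unfolding f_def frontiers_def using L(2) by blast
  moreover have "dist (f x) (F x) < \<epsilon>" for x
    using L(1)[of "F x"] \<delta>(2) unfolding f_def by (auto simp: dist_commute intro: less_le_trans)
  ultimately show ?thesis unfolding embeds_def by blast
qed

lemma embeds_dense:
  fixes f :: "'x::polish_space \<Rightarrow> 'z::{polish_space,perfect_space}"
  assumes "f \<in> borel_measurable borel"
  shows "\<exists>F. (\<forall>k. embeds (F k)) \<and> (\<forall>x. (\<lambda>k. F k x) \<longlonglongrightarrow> f x)"
proof -
  obtain G where G: "\<And>k. simple_function borel (G k)" "\<And>x. (\<lambda>k. G k x) \<longlonglongrightarrow> f x"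
    using borel_measurable_implies_sequence_metric[OF assms, of undefined] by auto
  have "\<forall>k. \<exists>F. embeds F \<and> (\<forall>x. dist (F x) (G k x) < 1 / real (Suc k))"
    by (intro allI embeds_near_simple[OF G(1)]) simp
  from choice[OF this] obtain F where F: "\<forall>k. embeds (F k) \<and> (\<forall>x. dist (F k x) (G k x) < 1 / real (Suc k))" ..
  have "(\<lambda>k. F k x) \<longlonglongrightarrow> f x" for x
  proof (rule metric_tendsto_imp_tendsto[where a = 0 and f = "\<lambda>k. inverse (real (Suc k)) + dist (G k x) (f x)"])
    have "(\<lambda>k. dist (G k x) (f x)) \<longlonglongrightarrow> 0" using G(2)[of x] by (rule tendsto_dist_iff[THEN iffD1])
    from tendsto_add[OF LIMSEQ_inverse_real_of_nat this]
    show "(\<lambda>k. inverse (real (Suc k)) + dist (G k x) (f x)) \<longlonglongrightarrow> 0" by simp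
    have "dist (F k x) (f x) \<le> dist (inverse (real (Suc k)) + dist (G k x) (f x)) 0" for k
    proof -
      have "dist (F k x) (G k x) \<le> inverse (real (Suc k))"
        using F by (simp add: inverse_eq_divide less_imp_le)
      then show ?thesis using dist_triangle[of "F k x" "f x" "G k x"] by (simp add: dist_real_def)
    qed
    then show "\<forall>\<^sub>F k in sequentially. dist (F k x) (f x) \<le> dist (inverse (real (Suc k)) + dist (G k x) (f x)) 0"
      by (rule always_eventually[OF allI])
  qed
  then show ?thesis using F by blast
qed

section \<open>The space of stationary measures and orbit laws\<close>

lemma topspace_P_mu_topology: "topspace (P_mu_topology \<mu>) = P_mu \<mu>"
  unfolding P_mu_topology_def by (simp add: topspace_pullback_topology)

lemma openin_P_mu_integral_less:
  fixes \<phi> :: "('g::{group_add,countable} \<Rightarrow> 'z::topological_space) \<Rightarrow> real"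
  assumes "continuous_on UNIV \<phi>" "bounded (range \<phi>)"
  shows "openin (P_mu_topology \<mu>) {\<eta> \<in> P_mu \<mu>. (\<integral>x. \<phi> x \<partial>\<eta>) < c}"
proof -
  define W where "W = {F :: (('g \<Rightarrow> 'z) \<Rightarrow> real) \<Rightarrow> real. F \<phi> < c}"
  have "open W" unfolding W_def
    by (intro open_Collect_less continuous_on_const continuous_on_product_coordinates)
  then show ?thesis
    unfolding P_mu_topology_def openin_pullback_topology
    using assms by (intro exI[of _ W]) (auto simp: W_def)
qed

text \<open>The portmanteau inequality in the form used throughout: the measure of a closed set is
  the infimum of integrals of bounded continuous functions decreasing to its indicator, so the
  sublevel set is a union of open ones.\<close>

lemma openin_P_mu_closed_less:
  fixes C :: "('g::{group_add,countable} \<Rightarrow> 'z::polish_space) set"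
  assumes C: "closed C"
  shows "openin (P_mu_topology \<mu>) {\<eta> \<in> P_mu \<mu>. measure \<eta> C < c}"
proof (cases "C = {}")
  case True
  have "openin (P_mu_topology \<mu>) (topspace (P_mu_topology \<mu>))" by (rule openin_topspace)
  then show ?thesis unfolding True topspace_P_mu_topology by (cases "0 < c") auto
next
  case False
  define \<phi> where "\<phi> j y = max 0 (1 - real j * infdist y C)" for j :: nat and y :: "'g \<Rightarrow> 'z"
  have cont: "continuous_on UNIV (\<phi> j)" for j
    unfolding \<phi>_def by (intro continuous_intros)
  have bnd: "0 \<le> \<phi> j y" "\<phi> j y \<le> 1" for j y by (auto simp: \<phi>_def infdist_nonneg)
  have bdd: "bounded (range (\<phi> j))" for j
    unfolding bounded_iff using bnd by (auto intro!: exI[of _ 1])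
  have meas [measurable]: "\<phi> j \<in> borel_measurable borel" for j
    by (rule borel_measurable_continuous_onI[OF cont])
  have Cb: "C \<in> sets borel" using C by simp
  have lim: "(\<lambda>j. \<phi> j y) \<longlonglongrightarrow> indicator C y" for y
  proof (cases "y \<in> C")
    case True
    then show ?thesis by (simp add: \<phi>_def)
  next
    case y: False
    then have pos: "infdist y C > 0"
      using in_closed_iff_infdist_zero[OF C False] infdist_nonneg[of y C] by fastforce
    then obtain n where n: "1 < real n * infdist y C" using reals_Archimedean3 by blast
    have "\<phi> j y = 0" if "j \<ge> n" for j
    proof -
      have "real n * infdist y C \<le> real j * infdist y C" using that pos by (simp add: mult_right_mono)
      then show ?thesis using n by (simp add: \<phi>_def)
    qed
    then have "\<forall>\<^sub>F j in sequentially. \<phi> j y = 0" by (rule eventually_sequentiallyI)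
    then show ?thesis using y by (simp add: tendsto_eventually)
  qed
  have int: "measure \<eta> C < c \<longleftrightarrow> (\<exists>j. (\<integral>y. \<phi> j y \<partial>\<eta>) < c)" if \<eta>: "\<eta> \<in> P_mu \<mu>" for \<eta>
  proof -
    have S: "sets \<eta> = sets borel" "prob_space \<eta>" using \<eta> unfolding P_mu_def by auto
    interpret prob_space \<eta> by fact
    have m: "\<phi> j \<in> borel_measurable \<eta>" for j using meas[of j] by (simp add: measurable_cong_sets[OF S(1) refl])
    have i: "integrable \<eta> (\<phi> j)" for j using bnd by (intro integrable_const_bound[of _ 1] m) auto
    have ind: "(\<integral>y. indicator C y \<partial>\<eta>) = measure \<eta> C" using Cb S sets.sets_into_space[of C \<eta>] by (simp add: Int_absorb1)
    have "measure \<eta> C \<le> (\<integral>y. \<phi> j y \<partial>\<eta>)" for j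
    proof -
      have "(\<integral>y. indicator C y \<partial>\<eta>) \<le> (\<integral>y. \<phi> j y \<partial>\<eta>)"
      proof (rule integral_mono)
        show "integrable \<eta> (indicator C :: _ \<Rightarrow> real)" using Cb S by (simp add: finite_measure.integrable_const_bound emeasure_eq_measure)
        show "indicator C y \<le> \<phi> j y" for y using bnd(1)[of j y] by (auto simp: \<phi>_def split: split_indicator)
      qed (rule i)
      then show ?thesis unfolding ind .
    qed
    moreover have "(\<lambda>j. \<integral>y. \<phi> j y \<partial>\<eta>) \<longlonglongrightarrow> (\<integral>y. indicator C y \<partial>\<eta>)"
      using Cb bnd by (intro integral_dominated_convergence[where w = "\<lambda>_. 1"] m lim AE_I2)
        (auto simp: measurable_cong_sets[OF S(1) refl])
    then have "(\<lambda>j. \<integral>y. \<phi> j y \<partial>\<eta>) \<longlonglongrightarrow> measure \<eta> C" unfolding ind .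
    ultimately show ?thesis
      by (metis eventually_happens' le_less_trans order_tendstoD(2) sequentially_bot)
  qed
  have "{\<eta> \<in> P_mu \<mu>. measure \<eta> C < c} = (\<Union>j. {\<eta> \<in> P_mu \<mu>. (\<integral>y. \<phi> j y \<partial>\<eta>) < c})"
    using int by auto
  also have "openin (P_mu_topology \<mu>) \<dots>"
    by (intro openin_Union) (auto intro!: openin_P_mu_integral_less cont bdd)
  finally show ?thesis .
qed

lemma limitin_P_mu_topology:
  fixes \<eta> :: "('g::{group_add,countable} \<Rightarrow> 'z::topological_space) measure"
  assumes "\<And>k. N k \<in> P_mu \<mu>" "\<eta> \<in> P_mu \<mu>"
    and "\<And>\<phi> :: ('g \<Rightarrow> 'z) \<Rightarrow> real. continuous_on UNIV \<phi> \<Longrightarrow> bounded (range \<phi>) \<Longrightarrow>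
      (\<lambda>k. \<integral>x. \<phi> x \<partial>N k) \<longlonglongrightarrow> (\<integral>x. \<phi> x \<partial>\<eta>)"
  shows "limitin (P_mu_topology \<mu>) N \<eta> sequentially"
  unfolding P_mu_topology_def
  using assms by (intro limitin_pullback_topology) (auto simp: tendsto_fun_iff)

lemma integral_orb_law_tendsto:
  fixes f :: "nat \<Rightarrow> 'a \<Rightarrow> 'z::polish_space" and \<phi> :: "('g::{group_add,countable} \<Rightarrow> 'z) \<Rightarrow> real"
  assumes M: "prob_space M" and orb: "\<And>k. orb (\<alpha> k) (f k) \<in> borel_measurable M" "orb \<beta> h \<in> borel_measurable M"
    and lim: "AE x in M. (\<lambda>k. orb (\<alpha> k) (f k) x) \<longlonglongrightarrow> orb \<beta> h x"
    and \<phi>: "continuous_on UNIV \<phi>" "bounded (range \<phi>)"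
  shows "(\<lambda>k. \<integral>x. \<phi> x \<partial>orb_law M (\<alpha> k) (f k)) \<longlonglongrightarrow> (\<integral>x. \<phi> x \<partial>orb_law M \<beta> h)"
proof -
  interpret prob_space M by fact
  have [measurable]: "\<phi> \<in> borel_measurable borel" by (rule borel_measurable_continuous_onI[OF \<phi>(1)])
  note [measurable] = orb
  obtain B where B: "\<And>y. \<bar>\<phi> y\<bar> \<le> B" using \<phi>(2) unfolding bounded_iff by auto
  have "(\<lambda>k. \<integral>x. \<phi> (orb (\<alpha> k) (f k) x) \<partial>M) \<longlonglongrightarrow> (\<integral>x. \<phi> (orb \<beta> h x) \<partial>M)"
  proof (rule integral_dominated_convergence[where w = "\<lambda>_. B"])
    show "AE x in M. (\<lambda>k. \<phi> (orb (\<alpha> k) (f k) x)) \<longlonglongrightarrow> \<phi> (orb \<beta> h x)"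
      using lim
    proof eventually_elim
      case (elim x)
      have "isCont \<phi> (orb \<beta> h x)" using \<phi>(1) by (simp add: continuous_on_eq_continuous_at)
      then show ?case using elim by (rule isCont_tendsto_compose)
    qed
  qed (use B in auto)
  then show ?thesis unfolding orb_law_def by (simp add: integral_distr)
qed

text \<open>The null set of nonconvergence is pulled back under every group element, so the orbit
  sequences converge coordinatewise almost everywhere.\<close>

lemma limitin_orb_law_fun:
  fixes f :: "nat \<Rightarrow> 'a \<Rightarrow> 'z::polish_space"
  assumes gen: "gen_semigroup (set_pmf \<mu>) = UNIV" and act: "stat_action \<mu> M \<alpha>"
    and f: "\<And>k. f k \<in> borel_measurable M" "h \<in> borel_measurable M"
    and lim: "AE x in M. (\<lambda>k. f k x) \<longlonglongrightarrow> h x"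
  shows "limitin (P_mu_topology \<mu>) (\<lambda>k. orb_law M \<alpha> (f k)) (orb_law M \<alpha> h) sequentially"
proof (rule limitin_P_mu_topology)
  have "AE x in M. \<forall>g. (\<lambda>k. f k (\<alpha> (- g) x)) \<longlonglongrightarrow> h (\<alpha> (- g) x)"
    using stat_action_AE[OF gen act lim] by (simp add: AE_all_countable)
  then have conv: "AE x in M. (\<lambda>k. orb \<alpha> (f k) x) \<longlonglongrightarrow> orb \<alpha> h x"
    by eventually_elim (simp add: tendsto_fun_iff orb_def)
  fix \<phi> :: "('b \<Rightarrow> 'z) \<Rightarrow> real" assume "continuous_on UNIV \<phi>" "bounded (range \<phi>)"
  then show "(\<lambda>k. \<integral>x. \<phi> x \<partial>orb_law M \<alpha> (f k)) \<longlonglongrightarrow> (\<integral>x. \<phi> x \<partial>orb_law M \<alpha> h)"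
    by (rule integral_orb_law_tendsto[OF stat_actionD(1)[OF act]
        measurable_orb[OF stat_actionD(2)[OF act] f(1)] measurable_orb[OF stat_actionD(2)[OF act] f(2)] conv])
qed (rule orb_law_in_P_mu[OF act f(1)], rule orb_law_in_P_mu[OF act f(2)])

text \<open>Very weak convergence is upgraded to convergence in measure by testing against the limit
  itself: for a countable partition into pieces \<open>C i\<close> on which \<open>f\<close> varies
  little, the mass of points moved into the same piece by \<open>b k g\<close> and
  \<open>a g\<close> tends to the mass moved there by \<open>a g\<close>. Tannery's theorem sums
  these to 1.\<close>

lemma tendsto_integral_min_dist:
  fixes f :: "'x::polish_space \<Rightarrow> 'z::polish_space"
    and b :: "nat \<Rightarrow> 'g::{group_add,countable} \<Rightarrow> 'x \<Rightarrow> 'x"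
  assumes gen: "gen_semigroup (set_pmf \<mu>) = UNIV" and \<nu>: "nonatomic_prob \<nu>"
    and b: "\<And>k. stat_action \<mu> \<nu> (b k)" and a: "stat_action \<mu> \<nu> a"
    and lim: "(\<lambda>k. acoord \<nu> (b k)) \<longlonglongrightarrow> acoord \<nu> a"
    and f: "f \<in> borel_measurable borel"
  shows "(\<lambda>k. \<integral>x. min (dist (f (b k g x)) (f (a g x))) 1 \<partial>\<nu>) \<longlonglongrightarrow> 0"
proof (rule LIMSEQ_I)
  fix \<epsilon> :: real assume \<epsilon>: "0 < \<epsilon>"
  interpret prob_space \<nu> using \<nu> unfolding nonatomic_prob_def by blast
  have S: "sets \<nu> = sets borel" "space \<nu> = UNIV"
    using \<nu> space_nonatomic_prob unfolding nonatomic_prob_def by blast+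
  have bm: "b k g \<in> measurable borel borel" "a g \<in> measurable borel borel" for k
    using stat_actionD(2)[OF b, of k g] stat_actionD(2)[OF a, of g] by (simp_all add: measurable_nonatomic_prob[OF \<nu>])
  note [measurable] = bm f
  obtain D :: "'z set" where D: "countable D" "\<And>X. open X \<Longrightarrow> X \<noteq> {} \<Longrightarrow> \<exists>d\<in>D. d \<in> X"
    by (erule countable_dense_setE)
  have ne: "D \<noteq> {}" using D(2)[of UNIV] by auto
  \<comment> \<open>Radius \<open>\<epsilon>/4\<close> makes the oscillation of \<open>f\<close> on
    a piece less than \<open>\<epsilon>/2\<close>; the other half of \<open>\<epsilon>\<close> pays
    for the points outside the good set.\<close>
  define A where "A i = f -` ball (from_nat_into D i) (\<epsilon>/4)" for i
  have Am: "A i \<in> sets borel" for i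
    unfolding A_def using measurable_sets[OF f, of "ball (from_nat_into D i) (\<epsilon>/4)"] by simp
  have cover: "(\<Union>i. A i) = UNIV"
  proof (intro equalityI subsetI UNIV_I)
    fix x
    obtain d where "d \<in> D" "d \<in> ball (f x) (\<epsilon>/4)" using D(2)[of "ball (f x) (\<epsilon>/4)"] \<epsilon> by auto
    moreover then obtain i where "d = from_nat_into D i" using from_nat_into_surj[OF D(1)] by metis
    ultimately show "x \<in> (\<Union>i. A i)" by (auto simp: A_def dist_commute)
  qed
  define C where "C = disjointed A"
  have Cm: "C i \<in> sets borel" for i
    using sets.range_disjointed_sets[of A borel] Am unfolding C_def by blast
  have CU: "(\<Union>i. C i) = UNIV" unfolding C_def UN_disjointed_eq cover ..
  have Cd: "disjoint_family C" unfolding C_def by (rule disjoint_family_disjointed)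
  have CA: "C i \<subseteq> A i" for i unfolding C_def by (rule disjointed_subset)
  define E where "E i k = a g -` C i \<inter> b k g -` C i" for i k
  have pre: "a g -` C i \<in> sets borel" "b k g -` C i \<in> sets borel" for i k
    using measurable_sets[OF bm(1) Cm] measurable_sets[OF bm(2) Cm] by simp_all
  have Em: "E i k \<in> sets \<nu>" for i k unfolding E_def S using pre by (intro sets.Int) auto
  have "(\<lambda>i. measure \<nu> (a g -` C i)) sums measure \<nu> (\<Union>i. a g -` C i)"
  proof (rule finite_measure_UNION)
    show "disjoint_family (\<lambda>i. a g -` C i)" using Cd unfolding disjoint_family_on_def by blast
  qed (use pre in \<open>auto simp: S\<close>)
  moreover have "(\<Union>i. a g -` C i) = UNIV" using CU by blast
  ultimately have sm: "(\<lambda>i. measure \<nu> (a g -` C i)) sums 1" using prob_space S by simp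
  have "(\<lambda>k. \<Sum>i. measure \<nu> (E i k)) \<longlonglongrightarrow> (\<Sum>i. measure \<nu> (a g -` C i))"
  proof (rule tannerys_theorem[OF _ _ sums_summable[OF sm], THEN conjunct2, THEN conjunct2])
    show "(\<lambda>k. measure \<nu> (E i k)) \<longlonglongrightarrow> measure \<nu> (a g -` C i)" for i
      using tendsto_of_acoord[OF gen \<nu> b a lim pre(1)[of i] Cm[of i], of g] unfolding E_def by simp
    have "measure \<nu> (E i k) \<le> measure \<nu> (a g -` C i)" for i k
      using pre(1)[of i] by (intro finite_measure_mono) (auto simp: E_def S)
    then show "\<forall>\<^sub>F (i, k) in at_top \<times>\<^sub>F sequentially. norm (measure \<nu> (E i k)) \<le> measure \<nu> (a g -` C i)"
      by (intro always_eventually) auto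
  qed simp
  then have "(\<lambda>k. \<Sum>i. measure \<nu> (E i k)) \<longlonglongrightarrow> 1" using sm by (simp add: sums_iff)
  then have "\<forall>\<^sub>F k in sequentially. (\<Sum>i. measure \<nu> (E i k)) > 1 - \<epsilon>/2"
    by (rule order_tendstoD) (use \<epsilon> in simp)
  then obtain n where n: "\<And>k. k \<ge> n \<Longrightarrow> (\<Sum>i. measure \<nu> (E i k)) > 1 - \<epsilon>/2"
    by (auto simp: eventually_sequentially)
  have "norm ((\<integral>x. min (dist (f (b k g x)) (f (a g x))) 1 \<partial>\<nu>) - 0) < \<epsilon>" if "k \<ge> n" for k
  proof -
    define G where "G = (\<Union>i. E i k)"
    have Gm: "G \<in> sets \<nu>" unfolding G_def using Em by auto
    have "(\<lambda>i. measure \<nu> (E i k)) sums measure \<nu> G" unfolding G_def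
    proof (rule finite_measure_UNION)
      show "disjoint_family (\<lambda>i. E i k)" using Cd unfolding disjoint_family_on_def E_def by blast
    qed (use Em in auto)
    then have G1: "measure \<nu> G > 1 - \<epsilon>/2" using n[OF that] by (simp add: sums_iff)
    define m where "m x = min (dist (f (b k g x)) (f (a g x))) 1" for x
    have mm: "m \<in> borel_measurable \<nu>" unfolding m_def measurable_nonatomic_prob[OF \<nu>] by measurable
    have mb: "0 \<le> m x" "m x \<le> 1" for x by (auto simp: m_def)
    have "m x \<le> \<epsilon>/2 + indicator (UNIV - G) x" for x
    proof (cases "x \<in> G")
      case True
      then obtain i where "a g x \<in> A i" "b k g x \<in> A i" using CA unfolding G_def E_def by blast
      then have "dist (from_nat_into D i) (f (a g x)) < \<epsilon>/4" "dist (from_nat_into D i) (f (b k g x)) < \<epsilon>/4"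
        by (auto simp: A_def)
      then have "dist (f (b k g x)) (f (a g x)) < \<epsilon>/2"
        using dist_triangle3[of "f (b k g x)" "f (a g x)" "from_nat_into D i"] by linarith
      then show ?thesis using True by (simp add: m_def)
    qed (use mb \<epsilon> in \<open>simp add: m_def\<close>)
    then have "(\<integral>x. m x \<partial>\<nu>) \<le> (\<integral>x. \<epsilon>/2 + indicator (UNIV - G) x \<partial>\<nu>)"
    proof (intro integral_mono)
      show "integrable \<nu> m" using mm mb by (intro integrable_const_bound[of _ 1]) auto
      have "UNIV - G \<in> sets \<nu>" using sets.compl_sets[OF Gm] by (simp add: S)
      then show "integrable \<nu> (\<lambda>x. \<epsilon>/2 + indicator (UNIV - G) x)"
        using \<epsilon> by (intro integrable_const_bound[of _ "\<epsilon>/2 + 1"]) (auto split: split_indicator)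
    qed
    also have "\<dots> = \<epsilon>/2 + measure \<nu> (UNIV - G)"
    proof -
      have G': "UNIV - G \<in> sets \<nu>" using sets.compl_sets[OF Gm] by (simp add: S)
      then have "integrable \<nu> (indicator (UNIV - G) :: _ \<Rightarrow> real)"
        by (intro integrable_const_bound[of _ 1]) (auto split: split_indicator)
      then show ?thesis using G' prob_space by (simp add: S)
    qed
    also have "measure \<nu> (UNIV - G) = 1 - measure \<nu> G" using prob_compl[OF Gm] by (simp add: S)
    finally have "(\<integral>x. m x \<partial>\<nu>) < \<epsilon>" using G1 by simp
    moreover have "0 \<le> (\<integral>x. m x \<partial>\<nu>)" using mb by (simp add: integral_nonneg)
    ultimately show ?thesis unfolding m_def real_norm_def diff_0_right by (simp only: abs_of_nonneg)
  qed
  then show "\<exists>n0. \<forall>k\<ge>n0. norm ((\<integral>x. min (dist (f (b k g x)) (f (a g x))) 1 \<partial>\<nu>) - 0) < \<epsilon>" by blast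
qed

text \<open>The product metric is a sum of truncated coordinate distances, so the expected distance
  of the two orbits tends to 0. A subsequence violating convergence would contain one with almost
  everywhere convergent orbits, contradicting dominated convergence.\<close>

lemma limitin_orb_law_action:
  fixes f :: "'x::polish_space \<Rightarrow> 'z::polish_space"
    and b :: "nat \<Rightarrow> 'g::{group_add,countable} \<Rightarrow> 'x \<Rightarrow> 'x"
  assumes gen: "gen_semigroup (set_pmf \<mu>) = UNIV" and \<nu>: "nonatomic_prob \<nu>"
    and b: "\<And>k. stat_action \<mu> \<nu> (b k)" and a: "stat_action \<mu> \<nu> a"
    and lim: "(\<lambda>k. acoord \<nu> (b k)) \<longlonglongrightarrow> acoord \<nu> a"
    and f: "f \<in> borel_measurable borel"
  shows "limitin (P_mu_topology \<mu>) (\<lambda>k. orb_law \<nu> (b k) f) (orb_law \<nu> a f) sequentially"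
proof (rule limitin_P_mu_topology)
  interpret prob_space \<nu> using \<nu> unfolding nonatomic_prob_def by blast
  have f': "f \<in> borel_measurable \<nu>" using f by (simp add: measurable_nonatomic_prob[OF \<nu>])
  have orb [measurable]: "orb (b k) f \<in> borel_measurable \<nu>" "orb a f \<in> borel_measurable \<nu>" for k
    by (rule measurable_orb[OF stat_actionD(2)[OF b] f'], rule measurable_orb[OF stat_actionD(2)[OF a] f'])
  define d where "d k x = dist (orb (b k) f x) (orb a f x)" for k x
  define t where "t n k x = (1/2)^n * min (dist (f (b k (- from_nat n) x)) (f (a (- from_nat n) x))) 1" for n k x
  have dt: "d k x = (\<Sum>n. t n k x)" for k x unfolding d_def t_def dist_fun_def orb_def ..
  have tb: "0 \<le> t n k x" "t n k x \<le> (1/2)^n" for n k x by (auto simp: t_def mult_left_le)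
  have ts: "summable (\<lambda>n. t n k x)" for k x
    by (rule summable_comparison_test'[of "\<lambda>n. (1/2)^n"]) (use tb in \<open>auto simp: summable_geometric_iff\<close>)
  have tm [measurable]: "t n k \<in> borel_measurable \<nu>" for n k
    unfolding t_def using measurable_compose[OF stat_actionD(2)[OF b] f'] measurable_compose[OF stat_actionD(2)[OF a] f']
    by measurable
  have ti: "integrable \<nu> (t n k)" for n k
    using tb by (intro integrable_const_bound[of _ "(1/2)^n"] tm) auto
  have tint: "0 \<le> (\<integral>x. t n k x \<partial>\<nu>)" "(\<integral>x. t n k x \<partial>\<nu>) \<le> (1/2)^n" for n k
  proof -
    show "0 \<le> (\<integral>x. t n k x \<partial>\<nu>)" using tb(1) by (intro Bochner_Integration.integral_nonneg)
    have "(\<integral>x. t n k x \<partial>\<nu>) \<le> (\<integral>x. (1/2)^n \<partial>\<nu>)" using tb(2) by (intro integral_mono ti) auto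
    then show "(\<integral>x. t n k x \<partial>\<nu>) \<le> (1/2)^n" by (simp add: prob_space)
  qed
  have sint: "summable (\<lambda>n. \<integral>x. t n k x \<partial>\<nu>)" for k
    by (rule summable_comparison_test'[of "\<lambda>n. (1/2)^n"]) (use tint in \<open>auto simp: summable_geometric_iff\<close>)
  have dint: "(\<integral>x. d k x \<partial>\<nu>) = (\<Sum>n. \<integral>x. t n k x \<partial>\<nu>)" for k
    unfolding dt by (rule integral_suminf) (use ti ts sint tb in auto)
  have "(\<lambda>k. \<Sum>n. \<integral>x. t n k x \<partial>\<nu>) \<longlonglongrightarrow> (\<Sum>n. 0)"
  proof (rule tannerys_theorem[where M = "\<lambda>n. (1/2)^n", THEN conjunct2, THEN conjunct2])
    show "(\<lambda>k. \<integral>x. t n k x \<partial>\<nu>) \<longlonglongrightarrow> 0" for n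
      unfolding t_def using tendsto_mult_left[OF tendsto_integral_min_dist[OF gen \<nu> b a lim f, of "- from_nat n"], of "(1/2)^n"]
      by simp
    show "\<forall>\<^sub>F (n, k) in at_top \<times>\<^sub>F sequentially. norm (\<integral>x. t n k x \<partial>\<nu>) \<le> (1/2)^n"
      using tint by (intro always_eventually) auto
  qed (auto simp: summable_geometric_iff)
  then have dlim: "(\<lambda>k. \<integral>x. d k x \<partial>\<nu>) \<longlonglongrightarrow> 0" by (simp add: dint)
  have d2: "0 \<le> d k x" "d k x \<le> 2" for k x
  proof -
    have "d k x \<le> (\<Sum>n. (1/2)^n)" unfolding dt
      by (rule suminf_le[OF _ ts]) (use tb in \<open>auto simp: summable_geometric_iff\<close>)
    also have "\<dots> = 2" by (subst suminf_geometric) auto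
    finally show "d k x \<le> 2" .
  qed (simp add: d_def)
  have dm: "d k \<in> borel_measurable \<nu>" for k unfolding d_def by measurable
  have di: "integrable \<nu> (d k)" for k using d2 by (intro integrable_const_bound[of _ 2] dm) auto
  fix \<phi> :: "('g \<Rightarrow> 'z) \<Rightarrow> real" assume \<phi>: "continuous_on UNIV \<phi>" "bounded (range \<phi>)"
  define X where "X k = (\<integral>x. \<phi> x \<partial>orb_law \<nu> (b k) f)" for k
  define L where "L = (\<integral>x. \<phi> x \<partial>orb_law \<nu> a f)"
  show "(\<lambda>k. \<integral>x. \<phi> x \<partial>orb_law \<nu> (b k) f) \<longlonglongrightarrow> (\<integral>x. \<phi> x \<partial>orb_law \<nu> a f)"
    unfolding X_def[symmetric] L_def[symmetric]
  proof (rule ccontr)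
    assume "\<not> X \<longlonglongrightarrow> L"
    then obtain e where e: "e > 0" "\<not> (\<forall>\<^sub>F k in sequentially. dist (X k) L < e)" unfolding tendsto_iff by blast
    then obtain r :: "nat \<Rightarrow> nat" where r: "strict_mono r" "\<And>n. \<not> dist (X (r n)) L < e"
      using not_eventually_sequentiallyD[OF e(2)] by blast
    have "(\<lambda>k. \<integral>x. norm (d (r k) x) \<partial>\<nu>) \<longlonglongrightarrow> 0"
      using LIMSEQ_subseq_LIMSEQ[OF dlim r(1)] d2 by (simp add: comp_def)
    from tendsto_L1_AE_subseq[OF di this] obtain s :: "nat \<Rightarrow> nat" where s: "strict_mono s" "AE x in \<nu>. (\<lambda>k. d (r (s k)) x) \<longlonglongrightarrow> 0"
      by auto
    have "AE x in \<nu>. (\<lambda>k. orb (b (r (s k))) f x) \<longlonglongrightarrow> orb a f x"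
      using s(2) by eventually_elim (subst tendsto_dist_iff, simp add: d_def)
    from integral_orb_law_tendsto[OF prob_space_axioms orb(1) orb(2) this \<phi>]
    have "(\<lambda>k. X (r (s k))) \<longlonglongrightarrow> L" unfolding X_def L_def .
    then have "\<forall>\<^sub>F k in sequentially. dist (X (r (s k))) L < e" using e(1) unfolding tendsto_iff by blast
    then show False using r(2) by (auto dest: eventually_happens)
  qed
next
  have "f \<in> borel_measurable \<nu>" using f by (simp add: measurable_nonatomic_prob[OF \<nu>])
  note P = orb_law_in_P_mu[OF _ this]
  show "orb_law \<nu> (b k) f \<in> P_mu \<mu>" for k by (rule P[OF b])
  show "orb_law \<nu> a f \<in> P_mu \<mu>" by (rule P[OF a])
qed

lemma continuous_map_orb_law:
  fixes f :: "'x::polish_space \<Rightarrow> 'z::polish_space" and \<mu> :: "'g::{group_add,countable} pmf"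
  assumes gen: "gen_semigroup (set_pmf \<mu>) = UNIV" and \<nu>: "nonatomic_prob \<nu>" and f: "f \<in> borel_measurable borel"
  shows "continuous_map (A_mu_topology \<mu> \<nu>) (P_mu_topology \<mu>) (\<lambda>a. orb_law \<nu> a f)"
  unfolding A_mu_topology_eq[OF gen \<nu>]
proof (rule continuous_map_pullback_of_sequences)
  have "prob_space \<nu>" using \<nu> unfolding nonatomic_prob_def by blast
  note A = A_mu_iff[OF gen this]
  fix b a assume "\<And>k::nat. b k \<in> A_mu \<mu> \<nu>" "a \<in> A_mu \<mu> \<nu>" "(\<lambda>k. acoord \<nu> (b k)) \<longlonglongrightarrow> acoord \<nu> a"
  then show "limitin (P_mu_topology \<mu>) (\<lambda>k. orb_law \<nu> (b k) f) (orb_law \<nu> a f) sequentially"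
    using limitin_orb_law_action[OF gen \<nu> _ _ _ f] A by blast
qed

section \<open>Laws of the zeroth coordinate\<close>

definition law0 :: "('g::group_add \<Rightarrow> 'z::topological_space) measure \<Rightarrow> 'z measure" where
  "law0 \<eta> = distr \<eta> borel (\<lambda>y. y 0)"

definition good_law :: "'z::polish_space measure \<Rightarrow> bool" where
  "good_law m \<longleftrightarrow> nonatomic_prob m \<and> measure m frontiers = 0"

lemma P_muD:
  fixes \<eta> :: "('g::{group_add,countable} \<Rightarrow> 'z::polish_space) measure"
  assumes "\<eta> \<in> P_mu \<mu>"
  shows "sets \<eta> = sets borel" "space \<eta> = UNIV" "prob_space \<eta>" "stat_action \<mu> \<eta> shift_action"
    "measurable \<eta> N = measurable borel N"
proof -
  show *: "sets \<eta> = sets borel" "prob_space \<eta>" "stat_action \<mu> \<eta> shift_action"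
    using assms stat_actionD(1) unfolding P_mu_iff by auto
  show "space \<eta> = UNIV" using sets_eq_imp_space_eq[OF *(1)] by simp
  show "measurable \<eta> N = measurable borel N" using measurable_cong_sets[OF *(1) refl] .
qed

lemma shift_action_0 [simp]: "shift_action g y 0 = y (- g)"
  by (simp add: shift_action_def)

lemma law0:
  fixes \<eta> :: "('g::{group_add,countable} \<Rightarrow> 'z::polish_space) measure"
  assumes \<eta>: "\<eta> \<in> P_mu \<mu>"
  shows sets_law0: "sets (law0 \<eta>) = sets borel"
    and prob_space_law0: "prob_space (law0 \<eta>)"
    and measure_law0: "E \<in> sets borel \<Longrightarrow> measure (law0 \<eta>) E = measure \<eta> {y. y 0 \<in> E}"
    and AE_law0D: "AE z in law0 \<eta>. P z \<Longrightarrow> AE y in \<eta>. P (y 0)"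
proof -
  have m: "(\<lambda>y. y 0) \<in> borel_measurable \<eta>" unfolding P_muD(5)[OF \<eta>] by simp
  show "sets (law0 \<eta>) = sets borel" by (simp add: law0_def)
  show "prob_space (law0 \<eta>)" unfolding law0_def by (rule prob_space.prob_space_distr[OF P_muD(3)[OF \<eta>] m])
  show "measure (law0 \<eta>) E = measure \<eta> {y. y 0 \<in> E}" if "E \<in> sets borel"
    unfolding law0_def using that by (subst measure_distr[OF m]) (auto simp: vimage_def P_muD(2)[OF \<eta>])
  show "AE y in \<eta>. P (y 0)" if "AE z in law0 \<eta>. P z"
    using that unfolding law0_def by (rule AE_distrD[OF m])
qed

text \<open>Coordinate \<open>g\<close> is coordinate 0 after a shift, so null sets of the zeroth
  law are null for every coordinate even though the coordinate laws may differ.\<close>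

lemma AE_coord:
  fixes \<eta> :: "('g::{group_add,countable} \<Rightarrow> 'z::polish_space) measure"
  assumes gen: "gen_semigroup (set_pmf \<mu>) = UNIV" and \<eta>: "\<eta> \<in> P_mu \<mu>" and P: "AE z in law0 \<eta>. P z"
  shows "AE y in \<eta>. P (y g)"
  using stat_action_AE[OF gen P_muD(4)[OF \<eta>] AE_law0D[OF \<eta> P], of "- g"] by simp

lemma law0_orb_law:
  fixes f :: "'a \<Rightarrow> 'z::polish_space" and \<alpha> :: "'g::{group_add,countable} \<Rightarrow> 'a \<Rightarrow> 'a"
  assumes act: "stat_action \<mu> M \<alpha>" and f: "f \<in> borel_measurable M"
  shows "law0 (orb_law M \<alpha> f) = distr M borel f"
proof -
  have orb: "orb \<alpha> f \<in> borel_measurable M" by (rule measurable_orb[OF stat_actionD(2)[OF act] f])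
  have "law0 (orb_law M \<alpha> f) = distr M borel (\<lambda>x. orb \<alpha> f x 0)"
    unfolding law0_def orb_law_def by (subst distr_distr[OF _ orb]) (auto simp: comp_def)
  also have "\<dots> = distr M borel f"
  proof (rule distr_cong_AE)
    show "AE x in M. orb \<alpha> f x 0 = f x"
      using stat_actionD(3)[OF act] by eventually_elim (simp add: orb_def)
  qed (use f measurable_compose[OF orb measurable_product_coordinates] in auto)
  finally show ?thesis .
qed

lemma orb_law_cong_AE:
  fixes f h :: "'a \<Rightarrow> 'z::polish_space" and \<alpha> :: "'g::{group_add,countable} \<Rightarrow> 'a \<Rightarrow> 'a"
  assumes gen: "gen_semigroup (set_pmf \<mu>) = UNIV" and act: "stat_action \<mu> M \<alpha>"
    and f: "f \<in> borel_measurable M" and h: "h \<in> borel_measurable M" and eq: "AE x in M. f x = h x"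
  shows "orb_law M \<alpha> f = orb_law M \<alpha> h"
  unfolding orb_law_def
proof (rule distr_cong_AE)
  have "AE x in M. \<forall>g. f (\<alpha> (- g) x) = h (\<alpha> (- g) x)"
    using stat_action_AE[OF gen act eq] by (simp add: AE_all_countable)
  then show "AE x in M. orb \<alpha> f x = orb \<alpha> h x" by eventually_elim (simp add: orb_def)
qed (use measurable_orb[OF stat_actionD(2)[OF act]] f h in auto)

lemma orb_law_transport:
  fixes f :: "'b \<Rightarrow> 'z::polish_space" and \<alpha> :: "'g::{group_add,countable} \<Rightarrow> 'b \<Rightarrow> 'b"
  assumes gen: "gen_semigroup (set_pmf \<mu>) = UNIV" and act: "stat_action \<mu> M \<alpha>"
    and p: "p \<in> measurable N M" and q: "q \<in> measurable M N"
    and law: "distr N M p = M" and pq: "AE y in M. p (q y) = y" and f: "f \<in> borel_measurable M"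
  shows "orb_law N (\<lambda>g x. q (\<alpha> g (p x))) (\<lambda>x. f (p x)) = orb_law M \<alpha> f"
proof -
  note m [measurable] = stat_actionD(2)[OF act] p q f
  have "AE y in M. \<forall>g. p (q (\<alpha> (- g) y)) = \<alpha> (- g) y"
    using stat_action_AE[OF gen act pq] by (simp add: AE_all_countable)
  then have "AE y in distr N M p. \<forall>g. p (q (\<alpha> (- g) y)) = \<alpha> (- g) y" unfolding law .
  then have *: "AE x in N. \<forall>g. p (q (\<alpha> (- g) (p x))) = \<alpha> (- g) (p x)"
    by (rule AE_distrD[OF p])
  have o: "orb \<alpha> f \<in> borel_measurable M" by (rule measurable_orb[OF stat_actionD(2)[OF act] f])
  have "orb_law N (\<lambda>g x. q (\<alpha> g (p x))) (\<lambda>x. f (p x)) = distr N borel (\<lambda>x. orb \<alpha> f (p x))"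
    unfolding orb_law_def
  proof (rule distr_cong_AE)
    show "AE x in N. orb (\<lambda>g x. q (\<alpha> g (p x))) (\<lambda>x. f (p x)) x = orb \<alpha> f (p x)"
      using * by eventually_elim (simp add: orb_def)
    show "orb (\<lambda>g x. q (\<alpha> g (p x))) (\<lambda>x. f (p x)) \<in> borel_measurable N"
      by (rule measurable_orb) measurable
    show "(\<lambda>x. orb \<alpha> f (p x)) \<in> borel_measurable N" by (rule measurable_compose[OF p o])
  qed simp_all
  also have "\<dots> = distr (distr N M p) borel (orb \<alpha> f)"
    by (subst distr_distr[OF o p]) (simp add: comp_def)
  also have "\<dots> = orb_law M \<alpha> f" unfolding law orb_law_def ..
  finally show ?thesis .
qed

section \<open>Every stationary measure is an orbit law\<close>

instance prod :: (polish_space, polish_space) polish_space ..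

text \<open>Adding an atomless coordinate on which the group acts trivially makes the measure nonatomic.\<close>

lemma stat_action_times_unif:
  fixes \<eta> :: "('g::{group_add,countable} \<Rightarrow> 'z::polish_space) measure"
  assumes \<eta>: "\<eta> \<in> P_mu \<mu>"
  shows "nonatomic_prob (\<eta> \<Otimes>\<^sub>M unif)"
    and "stat_action \<mu> (\<eta> \<Otimes>\<^sub>M unif) (\<lambda>g (y, t). (shift_action g y, t))"
    and "distr (\<eta> \<Otimes>\<^sub>M unif) borel fst = \<eta>"
proof -
  interpret \<eta>: prob_space \<eta> by (rule P_muD(3)[OF \<eta>])
  interpret U: prob_space unif by (rule prob_space_unif)
  interpret pair_prob_space \<eta> unif ..
  define W where "W = \<eta> \<Otimes>\<^sub>M unif"
  have S: "sets W = sets borel"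
    unfolding W_def borel_prod[symmetric] by (rule sets_pair_measure_cong[OF P_muD(1)[OF \<eta>] sets_unif])
  have SW: "space W = UNIV" using sets_eq_imp_space_eq[OF S] by simp
  have act: "stat_action \<mu> \<eta> shift_action" by (rule P_muD(4)[OF \<eta>])
  note [measurable] = stat_actionD(2)[OF act]
  have "measure W {p} = 0" for p
  proof -
    obtain y t where p: "p = (y, t)" by (cases p)
    have "emeasure W ({y} \<times> {t}) = emeasure \<eta> {y} * emeasure unif {t}"
      unfolding W_def by (rule U.emeasure_pair_measure_Times) (auto simp: P_muD(1)[OF \<eta>])
    moreover have "AE u in unif. u \<notin> {t}" by (rule AE_unif_countable) simp
    then have "emeasure unif {t} = 0" by (subst (asm) AE_iff_null_sets[symmetric]) (auto simp: null_sets_def)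
    ultimately show ?thesis by (simp add: p measure_def)
  qed
  then show "nonatomic_prob (\<eta> \<Otimes>\<^sub>M unif)"
    using S prob_space_axioms unfolding nonatomic_prob_def W_def by blast
  have m [measurable]: "(\<lambda>(y, t). (shift_action g y, t)) \<in> measurable W W" for g
    unfolding W_def by measurable
  have "emeasure W E = (\<integral>\<^sup>+ g. emeasure W ((\<lambda>(y, t). (shift_action g y, t)) -` E \<inter> space W) \<partial>measure_pmf \<mu>)"
    if E: "E \<in> sets W" for E
  proof -
    define s where "s t = (\<lambda>y. (y, t)) -` E" for t
    have s: "s t \<in> sets \<eta>" for t unfolding s_def using E unfolding W_def by (rule sets_Pair2)
    have gm: "(\<lambda>t. emeasure \<eta> (shift_action g -` s t \<inter> space \<eta>)) \<in> borel_measurable unif" for g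
    proof -
      have "(\<lambda>(y, t). (shift_action g y, t)) -` E \<inter> space W \<in> sets (\<eta> \<Otimes>\<^sub>M unif)"
        using measurable_sets[OF m E, of g] unfolding W_def .
      from measurable_emeasure_Pair2[OF this]
      show ?thesis by (simp add: s_def vimage_def SW P_muD(2)[OF \<eta>])
    qed
    have "emeasure W E = (\<integral>\<^sup>+ t. emeasure \<eta> (s t) \<partial>unif)"
      unfolding W_def s_def using E[unfolded W_def] by (rule emeasure_pair_measure_alt2)
    also have "\<dots> = (\<integral>\<^sup>+ t. (\<integral>\<^sup>+ g. emeasure \<eta> (shift_action g -` s t \<inter> space \<eta>) \<partial>measure_pmf \<mu>) \<partial>unif)"
      by (intro nn_integral_cong stat_actionD(5)[OF act s])
    also have "\<dots> = (\<integral>\<^sup>+ t. (\<integral>\<^sup>+ g. pmf \<mu> g * emeasure \<eta> (shift_action g -` s t \<inter> space \<eta>) \<partial>count_space UNIV) \<partial>unif)"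
      by (simp add: nn_integral_measure_pmf)
    also have "\<dots> = (\<integral>\<^sup>+ g. (\<integral>\<^sup>+ t. pmf \<mu> g * emeasure \<eta> (shift_action g -` s t \<inter> space \<eta>) \<partial>unif) \<partial>count_space UNIV)"
      using gm by (intro nn_integral_count_space_nn_integral) auto
    also have "\<dots> = (\<integral>\<^sup>+ g. (\<integral>\<^sup>+ t. emeasure \<eta> (shift_action g -` s t \<inter> space \<eta>) \<partial>unif) \<partial>measure_pmf \<mu>)"
      using gm by (simp add: nn_integral_measure_pmf nn_integral_cmult)
    also have "\<dots> = (\<integral>\<^sup>+ g. emeasure W ((\<lambda>(y, t). (shift_action g y, t)) -` E \<inter> space W) \<partial>measure_pmf \<mu>)"
    proof (rule nn_integral_cong)
      fix g
      have "(\<lambda>(y, t). (shift_action g y, t)) -` E \<inter> space W \<in> sets (\<eta> \<Otimes>\<^sub>M unif)"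
        using measurable_sets[OF m E, of g] unfolding W_def .
      from emeasure_pair_measure_alt2[OF this]
      show "(\<integral>\<^sup>+ t. emeasure \<eta> (shift_action g -` s t \<inter> space \<eta>) \<partial>unif) =
          emeasure W ((\<lambda>(y, t). (shift_action g y, t)) -` E \<inter> space W)"
        unfolding W_def[symmetric] by (simp add: s_def vimage_def SW P_muD(2)[OF \<eta>])
    qed
    finally show ?thesis .
  qed
  moreover have "shift_action 0 y = y" "shift_action (g + h) y = shift_action g (shift_action h y)"
    for g h and y :: "'g \<Rightarrow> 'z"
    by (simp_all add: shift_action_def minus_add add.assoc diff_conv_add_uminus del: add_uminus_conv_diff)
  ultimately show "stat_action \<mu> (\<eta> \<Otimes>\<^sub>M unif) (\<lambda>g (y, t). (shift_action g y, t))"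
    unfolding stat_action_def using m prob_space_axioms unfolding W_def by (simp add: case_prod_beta')
  have "distr (\<eta> \<Otimes>\<^sub>M unif) borel fst = distr (\<eta> \<Otimes>\<^sub>M unif) \<eta> fst"
    by (rule distr_cong) (auto simp: P_muD(1)[OF \<eta>])
  also have "\<dots> = \<eta>" by (rule U.distr_pair_fst)
  finally show "distr (\<eta> \<Otimes>\<^sub>M unif) borel fst = \<eta>" .
qed

text \<open>The product of \<eta> with \<open>unif\<close> is nonatomic and hence isomorphic to
  \<nu>. The observed function is coordinate 0 of the first factor; its orbit forgets the auxiliary
  coordinate and leaves exactly \<eta>. At this stage \<open>f\<close> may be far from
  injective.\<close>

lemma P_mu_orb_law:
  fixes \<eta> :: "('g::{group_add,countable} \<Rightarrow> 'z::polish_space) measure" and \<nu> :: "'x::polish_space measure"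
  assumes gen: "gen_semigroup (set_pmf \<mu>) = UNIV" and \<nu>: "nonatomic_prob \<nu>" and \<eta>: "\<eta> \<in> P_mu \<mu>"
  shows "\<exists>a f. stat_action \<mu> \<nu> a \<and> f \<in> borel_measurable borel \<and> orb_law \<nu> a f = \<eta>"
proof -
  define W where "W = \<eta> \<Otimes>\<^sub>M unif"
  note W = stat_action_times_unif[OF \<eta>, folded W_def]
  define \<alpha> :: "'g \<Rightarrow> ('g \<Rightarrow> 'z) \<times> real \<Rightarrow> _" where "\<alpha> = (\<lambda>g (y, t). (shift_action g y, t))"
  define p where "p = iso \<nu> W"
  define q where "q = iso W \<nu>"
  have SW: "sets W = sets borel" using W(1) unfolding nonatomic_prob_def by blast
  have pq: "p \<in> measurable \<nu> W" "q \<in> measurable W \<nu>"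
    unfolding p_def q_def using measurable_iso[OF \<nu> W(1)] measurable_iso[OF W(1) \<nu>]
    by (simp_all add: measurable_nonatomic_prob[OF \<nu>] measurable_nonatomic_prob[OF W(1)])
  have law: "distr \<nu> W p = W"
    using distr_iso[OF \<nu> W(1)] unfolding p_def by (metis distr_cong SW)
  have act: "stat_action \<mu> \<nu> (\<lambda>g x. q (\<alpha> g (p x)))"
    using W(2) \<nu> iso_inverse[OF \<nu> W(1)] iso_inverse[OF W(1) \<nu>] unfolding p_def[symmetric] q_def[symmetric]
    by (intro stat_action_transport[OF gen _ _ pq law]) (auto simp: \<alpha>_def nonatomic_prob_def)
  have f: "(\<lambda>w. fst w 0) \<in> borel_measurable W"
  proof -
    have "(\<lambda>w :: ('g \<Rightarrow> 'z) \<times> real. fst w 0) \<in> borel_measurable borel"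
      by (rule measurable_compose[OF _ measurable_product_coordinates])
        (intro borel_measurable_continuous_onI continuous_on_fst continuous_on_id)
    then show ?thesis by (simp add: measurable_nonatomic_prob[OF W(1)])
  qed
  have "orb_law \<nu> (\<lambda>g x. q (\<alpha> g (p x))) (\<lambda>x. fst (p x) 0) = orb_law W \<alpha> (\<lambda>w. fst w 0)"
    using W(2) iso_inverse[OF W(1) \<nu>] unfolding p_def[symmetric] q_def[symmetric]
    by (intro orb_law_transport[OF gen _ pq law _ f]) (auto simp: \<alpha>_def)
  also have "\<dots> = distr W borel fst"
  proof -
    have "orb \<alpha> (\<lambda>w. fst w 0) = fst"
      by (auto simp: orb_def \<alpha>_def fun_eq_iff)
    then show ?thesis unfolding orb_law_def by simp
  qed
  also have "\<dots> = \<eta>" by (rule W(3))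
  finally have "orb_law \<nu> (\<lambda>g x. q (\<alpha> g (p x))) (\<lambda>x. fst (p x) 0) = \<eta>" .
  moreover have "(\<lambda>x. fst (p x) 0) \<in> borel_measurable borel"
    using measurable_compose[OF pq(1) f] by (simp add: measurable_nonatomic_prob[OF \<nu>])
  ultimately show ?thesis using act by blast
qed

text \<open>The action is kept and only the observing function is perturbed into an embedding, which
  moves the orbit law continuously.\<close>

lemma P_mu_embeds_dense:
  fixes U :: "('g::{group_add,countable} \<Rightarrow> 'z::{polish_space,perfect_space}) measure set"
    and \<nu> :: "'x::polish_space measure"
  assumes gen: "gen_semigroup (set_pmf \<mu>) = UNIV" and \<nu>: "nonatomic_prob \<nu>"
    and U: "openin (P_mu_topology \<mu>) U" "U \<noteq> {}"
  shows "\<exists>a f. stat_action \<mu> \<nu> a \<and> embeds f \<and> orb_law \<nu> a f \<in> U"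
proof -
  obtain \<eta> where \<eta>: "\<eta> \<in> U" "\<eta> \<in> P_mu \<mu>" using U openin_subset topspace_P_mu_topology by blast
  obtain a f where a: "stat_action \<mu> \<nu> a" and f: "f \<in> borel_measurable borel" and af: "orb_law \<nu> a f = \<eta>"
    using P_mu_orb_law[OF gen \<nu> \<eta>(2)] by blast
  obtain F where F: "\<And>k. embeds (F k)" "\<And>x. (\<lambda>k. F k x) \<longlonglongrightarrow> f x" using embeds_dense[OF f] by blast
  have "limitin (P_mu_topology \<mu>) (\<lambda>k. orb_law \<nu> a (F k)) (orb_law \<nu> a f) sequentially"
    using F f by (intro limitin_orb_law_fun[OF gen a]) (auto simp: measurable_nonatomic_prob[OF \<nu>] embeds_def)
  then have "\<forall>\<^sub>F k in sequentially. orb_law \<nu> a (F k) \<in> U" using U(1) \<eta>(1) unfolding limitin_def af by blast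
  then obtain k where "orb_law \<nu> a (F k) \<in> U" by (auto dest: eventually_happens)
  then show ?thesis using a F(1) by blast
qed

section \<open>Measures generated by the zeroth coordinate\<close>

text \<open>The stationary measures given by a pair of an action and a good law: the law determines
  the observing function, the quantile isomorphism, and nothing else is left to choose.\<close>

definition Good :: "'g::{group_add,countable} pmf \<Rightarrow> 'x::polish_space measure \<Rightarrow> ('g \<Rightarrow> 'z::polish_space) measure set" where
  "Good \<mu> \<nu> = {\<eta> \<in> P_mu \<mu>. good_law (law0 \<eta>) \<and>
     (\<exists>a. stat_action \<mu> \<nu> a \<and> orb_law \<nu> a (iso \<nu> (law0 \<eta>)) = \<eta>)}"

lemma measure_unif_interval_le: "a \<le> b \<Longrightarrow> measure unif {a..b} \<le> b - a"
proof -
  assume ab: "a \<le> b"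
  have "emeasure unif {a..b} = emeasure lborel ({a..b} \<inter> {0<..<1})"
    unfolding unif_def
    by (subst emeasure_distr[OF measurable_id_restrict]) (auto simp: emeasure_restrict_space space_restrict_space)
  also have "\<dots> \<le> emeasure lborel {a..b}" by (intro emeasure_mono) auto
  finally have "emeasure unif {a..b} \<le> ennreal (b - a)" using ab by simp
  then show ?thesis unfolding measure_def using ab by (metis enn2real_ennreal enn2real_mono diff_ge_0_iff_ge ennreal_less_top)
qed

lemma measure_rank_vimage:
  fixes m :: "'z::polish_space measure"
  assumes m: "nonatomic_prob m" and E: "E \<in> sets borel"
  shows "measure m {z. rank m z \<in> E} = measure unif E"
proof -
  have r: "rank m \<in> borel_measurable m" using measurable_rank[OF m] by (simp add: measurable_nonatomic_prob[OF m])
  show ?thesis unfolding distr_rank[OF m, symmetric] using E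
    by (subst measure_distr[OF r]) (auto simp: space_nonatomic_prob[OF m] vimage_def)
qed

lemma isCont_rank:
  fixes m :: "'z::polish_space measure"
  assumes m: "nonatomic_prob m" and z: "z \<notin> frontiers"
  shows "isCont (rank m) z"
  unfolding rank_def by (rule isCont_o2[OF isCont_hcode[OF z] isCont_cdf_hlaw[OF m]])

lemma good_law_AE: "good_law m \<Longrightarrow> AE z in m. z \<notin> frontiers"
proof -
  assume m: "good_law m"
  then interpret prob_space m unfolding good_law_def nonatomic_prob_def by blast
  have "frontiers \<in> null_sets m"
    using m by (intro null_setsI) (auto simp: good_law_def nonatomic_prob_def emeasure_eq_measure)
  then show ?thesis by (rule AE_not_in)
qed

text \<open>The space is cut along ranks into \<open>N\<close> slices of mass at most
  \<open>1/N\<close>. Since \<open>rank\<close> is continuous off the frontiers, taking closures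
  adds only a null set.\<close>

lemma closed_cover_of_good_law:
  assumes m: "good_law m" and \<epsilon>: "\<epsilon> > 0"
  shows "\<exists>\<C>. finite \<C> \<and> \<C> \<noteq> {} \<and> (\<forall>C\<in>\<C>. closed C \<and> measure m C < \<epsilon>) \<and> \<Union>\<C> = UNIV"
proof -
  have na: "nonatomic_prob m" using m unfolding good_law_def by blast
  interpret prob_space m using na unfolding nonatomic_prob_def by blast
  have S: "sets m = sets borel" using na unfolding nonatomic_prob_def by blast
  obtain N :: nat where N: "N > 0" "1 / real N < \<epsilon>" using reals_Archimedean2[of "1/\<epsilon>"] \<epsilon>
    by (metis divide_less_eq mult.commute not_gr_zero of_nat_0 of_nat_0_less_iff divide_pos_pos less_asym zero_less_one)
  define E where "E i = {z. rank m z \<in> {real i / N .. real (Suc i) / N}}" for i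
  have Em: "E i \<in> sets m" for i
    unfolding E_def S using measurable_sets[OF measurable_rank[OF na], of "{real i / N .. real (Suc i) / N}"]
    by (simp add: vimage_def)
  have "measure m (closure (E i)) < \<epsilon>" for i
  proof -
    have "z \<in> E i" if z: "z \<in> closure (E i)" "z \<notin> frontiers" for z
    proof -
      obtain y where y: "\<And>n. y n \<in> E i" "y \<longlonglongrightarrow> z" using z(1) unfolding closure_sequential by blast
      have "(\<lambda>n. rank m (y n)) \<longlonglongrightarrow> rank m z" by (rule isCont_tendsto_compose[OF isCont_rank[OF na z(2)] y(2)])
      then have "rank m z \<in> {real i / N .. real (Suc i) / N}"
        by (rule closed_sequentially[OF closed_atLeastAtMost, rotated]) (use y(1) in \<open>simp add: E_def\<close>)
      then show ?thesis unfolding E_def by blast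
    qed
    then have "closure (E i) \<subseteq> E i \<union> frontiers" by blast
    then have "measure m (closure (E i)) \<le> measure m (E i \<union> frontiers)"
      using Em by (intro finite_measure_mono) (auto simp: S)
    also have "\<dots> \<le> measure m (E i) + measure m frontiers"
      using Em by (intro measure_Un_le) (auto simp: S)
    also have "\<dots> = measure unif {real i / N .. real (Suc i) / N}"
      using m unfolding good_law_def E_def by (subst measure_rank_vimage[OF na]) auto
    also have "\<dots> \<le> real (Suc i) / N - real i / N"
      by (rule measure_unif_interval_le) (simp add: divide_right_mono)
    also have "\<dots> = 1 / N" by (simp add: diff_divide_distrib[symmetric])
    finally show ?thesis using N(2) by simp
  qed
  moreover have "\<exists>i<N. z \<in> closure (E i)" for z
  proof -
    have r: "0 \<le> rank m z" "rank m z \<le> 1" using rank_le_1[OF na]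
      by (auto simp: rank_def cdf_def)
    \<comment> \<open>The cap at \<open>N - 1\<close> puts points of rank exactly 1 into the last
      slice.\<close>
    define i where "i = min (nat \<lfloor>rank m z * N\<rfloor>) (N - 1)"
    have "real i \<le> rank m z * N"
    proof -
      have "real (nat \<lfloor>rank m z * N\<rfloor>) \<le> rank m z * N" using r(1) by (simp add: of_nat_nat)
      then show ?thesis unfolding i_def by linarith
    qed
    moreover have "rank m z * N \<le> real (Suc i)"
    proof (cases "nat \<lfloor>rank m z * N\<rfloor> \<le> N - 1")
      case True
      then have "i = nat \<lfloor>rank m z * N\<rfloor>" unfolding i_def by simp
      then show ?thesis using r(1) by simp linarith
    next
      case False
      then have "Suc i = N" unfolding i_def using N(1) by simp
      then show ?thesis using r(2) mult_right_mono[OF r(2), of "real N"] by simp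
    qed
    ultimately have "z \<in> E i" unfolding E_def using N(1) by (simp add: field_simps)
    moreover have "i < N" unfolding i_def using N(1) by auto
    ultimately show ?thesis using closure_subset by blast
  qed
  ultimately show ?thesis
    using N(1) by (intro exI[of _ "(\<lambda>i. closure (E i)) ` {..<N}"]) auto
qed

text \<open>Regularity encloses \<open>E\<close> between a compact and an open set with small error,
  and normality separates the compact set from the complement of the open one. Complements of the
  separating open sets are closed and cover the space, so they approximate \<open>E\<close> and its
  complement in a form that openness arguments can use.\<close>

lemma closed_splitting:
  fixes m :: "'z::polish_space measure"
  assumes m: "finite_measure m" "sets m = sets borel" and E: "E \<in> sets borel" and \<epsilon>: "\<epsilon> > 0"
  shows "\<exists>C1 C2. closed C1 \<and> closed C2 \<and> C1 \<union> C2 = UNIV \<and> measure m (E \<inter> C2) < \<epsilon> \<and> measure m (C1 - E) < \<epsilon>"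
proof -
  interpret finite_measure m by fact
  have fin: "emeasure m (space m) \<noteq> \<infinity>" by (simp add: emeasure_eq_measure)
  have "\<exists>K. K \<subseteq> E \<and> compact K \<and> measure m E < measure m K + \<epsilon>"
  proof (rule ccontr)
    assume "\<not> ?thesis"
    then have *: "measure m K \<le> measure m E - \<epsilon>" if "K \<subseteq> E" "compact K" for K
      using that by (meson le_diff_eq not_less)
    have pos: "0 \<le> measure m E - \<epsilon>" using *[of "{}"] by simp
    have "emeasure m E \<le> ennreal (measure m E - \<epsilon>)"
      unfolding inner_regular[OF m(2) fin E]
      by (rule SUP_least) (use * in \<open>auto simp: emeasure_eq_measure intro!: ennreal_leI\<close>)
    then have "measure m E \<le> measure m E - \<epsilon>" using pos by (simp add: emeasure_eq_measure)
    then show False using \<epsilon> by simp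
  qed
  then obtain K where K: "K \<subseteq> E" "compact K" "measure m E < measure m K + \<epsilon>" by blast
  have "\<exists>U. E \<subseteq> U \<and> open U \<and> measure m U < measure m E + \<epsilon>"
  proof (rule ccontr)
    assume "\<not> ?thesis"
    then have *: "measure m E + \<epsilon> \<le> measure m U" if "E \<subseteq> U" "open U" for U
      using that by (meson not_less)
    have "ennreal (measure m E + \<epsilon>) \<le> emeasure m E"
      unfolding outer_regular[OF m(2) fin E]
      by (rule INF_greatest) (use * in \<open>auto simp: emeasure_eq_measure intro!: ennreal_leI\<close>)
    then have "measure m E + \<epsilon> \<le> measure m E" by (simp add: emeasure_eq_measure)
    then show False using \<epsilon> by simp
  qed
  then obtain U where U: "E \<subseteq> U" "open U" "measure m U < measure m E + \<epsilon>" by blast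
  have "closed K" "closed (- U)" using K(2) U(2) by (auto simp: compact_imp_closed)
  moreover have "K \<inter> - U = {}" using K(1) U(1) by blast
  ultimately obtain V1 V2 where V: "open V1" "open V2" "K \<subseteq> V1" "- U \<subseteq> V2" "V1 \<inter> V2 = {}"
    using t4_space by meson
  have sets: "E \<in> sets m" "K \<in> sets m" "U \<in> sets m" "V1 \<in> sets m" "V2 \<in> sets m"
    using E K(2) U(2) V m(2) by (auto intro: borel_compact)
  have "measure m (E \<inter> - V1) \<le> measure m (E - K)" using V(3) sets by (intro finite_measure_mono) auto
  also have "\<dots> = measure m E - measure m K" using sets K(1) by (intro finite_measure_Diff)
  finally have 1: "measure m (E \<inter> - V1) < \<epsilon>" using K(3) by simp
  have "measure m (- V2 - E) \<le> measure m (U - E)" using V(4) sets by (intro finite_measure_mono) auto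
  also have "\<dots> = measure m U - measure m E" using sets U(1) by (intro finite_measure_Diff)
  finally have 2: "measure m (- V2 - E) < \<epsilon>" using U(3) by simp
  show ?thesis using 1 2 V by (intro exI[of _ "- V2"] exI[of _ "- V1"]) auto
qed

text \<open>Open conditions on stationary measures whose conjunction over all indices says that the zeroth
  coordinate has a nonatomic law avoiding the frontiers and generates the whole \<open>\<sigma>\<close>-algebra.\<close>

definition small_frontier :: "'g::{group_add,countable} pmf \<Rightarrow> nat \<times> nat \<Rightarrow> ('g \<Rightarrow> 'z::polish_space) measure set" where
  "small_frontier \<mu> = (\<lambda>(n, k). {\<eta> \<in> P_mu \<mu>. measure \<eta> {y. y 0 \<in> frontier (base_set n)} < 1 / Suc k})"

definition small_cover :: "'g::{group_add,countable} pmf \<Rightarrow> nat \<Rightarrow> ('g \<Rightarrow> 'z::polish_space) measure set" where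
  "small_cover \<mu> k = {\<eta> \<in> P_mu \<mu>. \<exists>\<C>. finite \<C> \<and> \<C> \<noteq> {} \<and> (\<forall>C\<in>\<C>. closed C \<and> measure \<eta> {y. y 0 \<in> C} < 1 / Suc k) \<and> \<Union>\<C> = UNIV}"

text \<open>\<open>C1\<close> and \<open>C2\<close> approximate, through coordinate 0, the event
  that coordinate \<open>g\<close> lies in a basic set and the opposite event. The closure in one
  line and the complement in the other make both bad events closed, hence the condition open; the
  bound \<open>(1/2)^k\<close> is summable for Borel-Cantelli.\<close>

definition nearly_generated :: "'g::{group_add,countable} pmf \<Rightarrow> 'g \<times> nat \<times> nat \<Rightarrow> ('g \<Rightarrow> 'z::polish_space) measure set" where
  "nearly_generated \<mu> = (\<lambda>(g, n, k). {\<eta> \<in> P_mu \<mu>. \<exists>C1 C2. closed C1 \<and> closed C2 \<and> C1 \<union> C2 = UNIV \<and>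
     measure \<eta> {y. y g \<in> closure (base_set n) \<and> y 0 \<in> C2} < (1/2)^k \<and>
     measure \<eta> {y. y g \<notin> base_set n \<and> y 0 \<in> C1} < (1/2)^k})"

lemma closed_coord:
  fixes C :: "'z::topological_space set"
  assumes "closed C"
  shows "closed {y :: 'g \<Rightarrow> 'z. y g \<in> C}"
  using closed_vimage[OF assms continuous_on_product_coordinates] by (simp add: vimage_def)

lemma openin_small_frontier: "openin (P_mu_topology \<mu>) (small_frontier \<mu> i)"
  unfolding small_frontier_def by (cases i) (auto intro!: openin_P_mu_closed_less closed_coord)

lemma openin_small_cover: "openin (P_mu_topology \<mu>) (small_cover \<mu> k :: ('g::{group_add,countable} \<Rightarrow> 'z::polish_space) measure set)"
proof -
  define K where "K = {\<C> :: 'z set set. finite \<C> \<and> \<C> \<noteq> {} \<and> (\<forall>C\<in>\<C>. closed C) \<and> \<Union>\<C> = UNIV}"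
  define F where "F C = {\<eta> \<in> P_mu \<mu>. measure \<eta> {y :: 'g \<Rightarrow> 'z. y 0 \<in> C} < 1 / Suc k}" for C
  have "small_cover \<mu> k = (\<Union>\<C>\<in>K. \<Inter>C\<in>\<C>. F C)"
  proof (intro equalityI subsetI)
    fix \<eta> :: "('g \<Rightarrow> 'z) measure" assume "\<eta> \<in> small_cover \<mu> k"
    then obtain \<C> where "\<C> \<in> K" "\<forall>C\<in>\<C>. \<eta> \<in> F C"
      unfolding small_cover_def K_def F_def by auto
    then show "\<eta> \<in> (\<Union>\<C>\<in>K. \<Inter>C\<in>\<C>. F C)" by blast
  next
    fix \<eta> :: "('g \<Rightarrow> 'z) measure" assume "\<eta> \<in> (\<Union>\<C>\<in>K. \<Inter>C\<in>\<C>. F C)"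
    then obtain \<C> where C: "\<C> \<in> K" "\<forall>C\<in>\<C>. \<eta> \<in> F C" by blast
    then obtain C where "C \<in> \<C>" unfolding K_def by blast
    then have "\<eta> \<in> P_mu \<mu>" using C(2) unfolding F_def by blast
    then show "\<eta> \<in> small_cover \<mu> k" using C unfolding small_cover_def K_def F_def by auto
  qed
  moreover have "openin (P_mu_topology \<mu>) (\<Inter>C\<in>\<C>. F C)" if "\<C> \<in> K" for \<C>
    using that unfolding K_def F_def by (intro openin_INT2) (auto intro!: openin_P_mu_closed_less closed_coord)
  ultimately show ?thesis by (auto intro!: openin_Union)
qed

lemma openin_nearly_generated: "openin (P_mu_topology \<mu>) (nearly_generated \<mu> i :: ('g::{group_add,countable} \<Rightarrow> 'z::polish_space) measure set)"
proof -
  obtain g n k where i: "i = (g, n, k)" by (metis prod_cases3)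
  define K where "K = {C :: 'z set \<times> 'z set. closed (fst C) \<and> closed (snd C) \<and> fst C \<union> snd C = UNIV}"
  define F where "F = (\<lambda>(C1, C2). {\<eta> \<in> P_mu \<mu>. measure \<eta> {y :: 'g \<Rightarrow> 'z. y g \<in> closure (base_set n) \<and> y 0 \<in> C2} < (1/2)^k}
     \<inter> {\<eta> \<in> P_mu \<mu>. measure \<eta> {y :: 'g \<Rightarrow> 'z. y g \<notin> base_set n \<and> y 0 \<in> C1} < (1/2)^k})"
  have "nearly_generated \<mu> i = (\<Union>C\<in>K. F C)"
  proof (intro equalityI subsetI)
    fix \<eta> :: "('g \<Rightarrow> 'z) measure" assume "\<eta> \<in> nearly_generated \<mu> i"
    then obtain C1 C2 where "(C1, C2) \<in> K" "\<eta> \<in> F (C1, C2)"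
      unfolding nearly_generated_def K_def F_def i by auto
    then show "\<eta> \<in> (\<Union>C\<in>K. F C)" by blast
  next
    fix \<eta> :: "('g \<Rightarrow> 'z) measure" assume "\<eta> \<in> (\<Union>C\<in>K. F C)"
    then obtain C where C: "C \<in> K" "\<eta> \<in> F C" by blast
    obtain C1 C2 where C12: "C = (C1, C2)" by (cases C)
    show "\<eta> \<in> nearly_generated \<mu> i"
      using C unfolding nearly_generated_def i C12 prod.case mem_Collect_eq K_def F_def
      by (intro conjI exI[of _ C1] exI[of _ C2]) simp_all
  qed
  moreover have "openin (P_mu_topology \<mu>) (F C)" if "C \<in> K" for C
  proof -
    obtain C1 C2 where C12: "C = (C1, C2)" by (cases C)
    have C: "C = (C1, C2)" "closed C1" "closed C2" using that unfolding K_def C12 by auto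
    have c1: "closed {y :: 'g \<Rightarrow> 'z. y g \<in> closure (base_set n) \<and> y 0 \<in> C2}"
      unfolding Collect_conj_eq by (intro closed_Int closed_coord closed_closure C(3))
    have "closed {y :: 'g \<Rightarrow> 'z. y g \<in> - base_set n \<and> y 0 \<in> C1}"
      unfolding Collect_conj_eq by (intro closed_Int closed_coord C(2)) (simp add: closed_Compl open_base_set)
    then have c2: "closed {y :: 'g \<Rightarrow> 'z. y g \<notin> base_set n \<and> y 0 \<in> C1}" by simp
    show ?thesis unfolding F_def C(1) prod.case by (intro openin_Int openin_P_mu_closed_less c1 c2)
  qed
  ultimately show ?thesis by (auto intro!: openin_Union)
qed

lemma good_law_embeds:
  assumes \<nu>: "nonatomic_prob \<nu>" and f: "embeds f"
  shows "good_law (distr \<nu> borel f)"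
proof -
  interpret prob_space \<nu> using \<nu> unfolding nonatomic_prob_def by blast
  have fm: "f \<in> borel_measurable \<nu>" using f by (simp add: embeds_def measurable_nonatomic_prob[OF \<nu>])
  obtain e where e: "\<And>x. e (f x) = x" using f unfolding embeds_def by blast
  have "measure \<nu> (f -` {z} \<inter> space \<nu>) = 0" for z
  proof -
    have "f -` {z} \<inter> space \<nu> \<subseteq> {e z}" using e by auto
    then have "measure \<nu> (f -` {z} \<inter> space \<nu>) \<le> measure \<nu> {e z}"
      using \<nu> by (intro finite_measure_mono) (auto simp: nonatomic_prob_def)
    then show ?thesis using \<nu> measure_nonneg[of \<nu>] unfolding nonatomic_prob_def by (metis antisym)
  qed
  moreover have "f -` frontiers \<inter> space \<nu> = {}" using f unfolding embeds_def by blast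
  ultimately show ?thesis
    unfolding good_law_def nonatomic_prob_def using prob_space_distr[OF fm] fm by (simp add: measure_distr)
qed

text \<open>For an embedding, coordinate \<open>g\<close> is a Borel function of coordinate 0. The
  event to be approximated is therefore the preimage \<open>E\<close> of a basic set, and
  \<open>closed_splitting\<close> applies; replacing that basic set by its closure costs nothing
  because the frontiers are null for every coordinate.\<close>

lemma embeds_orb_law_generated:
  fixes f :: "'x::polish_space \<Rightarrow> 'z::polish_space" and \<mu> :: "'g::{group_add,countable} pmf"
  assumes gen: "gen_semigroup (set_pmf \<mu>) = UNIV" and \<nu>: "nonatomic_prob \<nu>" and a: "stat_action \<mu> \<nu> a" and f: "embeds f"
  shows "orb_law \<nu> a f \<in> small_frontier \<mu> i" "orb_law \<nu> a f \<in> small_cover \<mu> k" "orb_law \<nu> a f \<in> nearly_generated \<mu> j"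
proof -
  interpret prob_space \<nu> using \<nu> unfolding nonatomic_prob_def by blast
  have fm: "f \<in> borel_measurable \<nu>" using f by (simp add: embeds_def measurable_nonatomic_prob[OF \<nu>])
  define \<eta> where "\<eta> = orb_law \<nu> a f"
  have \<eta>: "\<eta> \<in> P_mu \<mu>" unfolding \<eta>_def by (rule orb_law_in_P_mu[OF a fm])
  have l: "law0 \<eta> = distr \<nu> borel f" unfolding \<eta>_def by (rule law0_orb_law[OF a fm])
  have good: "good_law (law0 \<eta>)" unfolding l by (rule good_law_embeds[OF \<nu> f])
  interpret \<eta>: prob_space \<eta> by (rule P_muD(3)[OF \<eta>])
  interpret l: prob_space "law0 \<eta>" by (rule prob_space_law0[OF \<eta>])
  have fr0: "measure (law0 \<eta>) (frontier (base_set n)) = 0" for n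
  proof -
    have "measure (law0 \<eta>) (frontier (base_set n)) \<le> measure (law0 \<eta>) frontiers"
      by (intro l.finite_measure_mono) (auto simp: frontiers_def sets_law0[OF \<eta>])
    then show ?thesis using good measure_nonneg[of "law0 \<eta>"] unfolding good_law_def by (metis antisym)
  qed
  show "orb_law \<nu> a f \<in> small_frontier \<mu> i"
    unfolding small_frontier_def \<eta>_def[symmetric] using \<eta>
    by (cases i) (simp add: measure_law0[OF \<eta>, symmetric] fr0)
  obtain \<C> where "finite \<C>" "\<C> \<noteq> {}" "\<forall>C\<in>\<C>. closed C \<and> measure (law0 \<eta>) C < 1 / Suc k" "\<Union>\<C> = UNIV"
    using closed_cover_of_good_law[OF good, of "1 / Suc k"] by auto
  then show "orb_law \<nu> a f \<in> small_cover \<mu> k"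
    unfolding small_cover_def \<eta>_def[symmetric] using \<eta> by (auto simp: measure_law0[OF \<eta>] intro!: exI[of _ \<C>])
  obtain g n k where j: "j = (g, n, k)" by (metis prod_cases3)
  obtain e where e: "e \<in> borel_measurable borel" "\<And>x. e (f x) = x" using f unfolding embeds_def by blast
  \<comment> \<open>Decode coordinate 0 to the point of X, move it, and observe again.\<close>
  define t where "t z = f (a (- g) (e z))" for z
  have tm: "t \<in> borel_measurable borel"
    using measurable_compose[OF measurable_compose[OF e(1)] , of "a (- g)" borel f borel] f stat_actionD(2)[OF a, of "- g"]
    unfolding t_def by (simp add: measurable_nonatomic_prob[OF \<nu>] embeds_def)
  have gt: "AE y in \<eta>. y g = t (y 0)"
  proof -
    have orb: "orb a f \<in> borel_measurable \<nu>" by (rule measurable_orb[OF stat_actionD(2)[OF a] fm])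
    have "{y \<in> space borel. y g = t (y 0)} \<in> sets (borel :: ('g \<Rightarrow> 'z) measure)"
      by (rule measurable_equality_set[OF _ measurable_compose[OF _ tm]]) auto
    moreover have "AE x in \<nu>. orb a f x g = t (orb a f x 0)"
      using stat_actionD(3)[OF a] by eventually_elim (simp add: orb_def t_def e(2))
    ultimately show ?thesis unfolding \<eta>_def orb_law_def using AE_distr_iff[OF orb] by simp
  qed
  define E where "E = t -` base_set n"
  have E: "E \<in> sets borel" unfolding E_def using measurable_sets[OF tm, of "base_set n"] by (simp add: open_base_set)
  obtain C1 C2 where C: "closed C1" "closed C2" "C1 \<union> C2 = UNIV" "measure (law0 \<eta>) (E \<inter> C2) < (1/2)^k"
    "measure (law0 \<eta>) (C1 - E) < (1/2)^k"
    using closed_splitting[OF l.finite_measure_axioms sets_law0[OF \<eta>] E, of "(1/2)^k"] by auto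
  have Cb: "C1 \<in> sets borel" "C2 \<in> sets borel" using C by auto
  have cm: "{y :: 'g \<Rightarrow> 'z. y h \<in> B} \<in> sets \<eta>" if "B \<in> sets borel" for h B
    using measurable_sets[OF measurable_product_coordinates that, of h] by (simp add: vimage_def P_muD(1)[OF \<eta>])
  have fr: "AE y in \<eta>. y g \<notin> frontiers" by (rule AE_coord[OF gen \<eta> good_law_AE[OF good]])
  have "measure \<eta> {y. y g \<in> closure (base_set n) \<and> y 0 \<in> C2} = measure \<eta> {y. y 0 \<in> E \<inter> C2}"
  proof (rule measure_eq_AE)
    show "AE y in \<eta>. (y \<in> {y. y g \<in> closure (base_set n) \<and> y 0 \<in> C2}) = (y \<in> {y. y 0 \<in> E \<inter> C2})"
      using gt fr
    proof eventually_elim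
      case (elim y)
      have "y g \<notin> frontier (base_set n)" using elim(2) unfolding frontiers_def by blast
      then have "y g \<in> closure (base_set n) \<longleftrightarrow> y g \<in> base_set n"
        using closure_subset[of "base_set n"] interior_open[OF open_base_set[of n]] unfolding frontier_def by blast
      then show ?case using elim(1) unfolding E_def by simp
    qed
    have "{y :: 'g \<Rightarrow> 'z. y g \<in> closure (base_set n)} \<inter> {y. y 0 \<in> C2} \<in> sets \<eta>"
      using cm[of "closure (base_set n)" g] cm[OF Cb(2), of 0] by auto
    then show "{y. y g \<in> closure (base_set n) \<and> y 0 \<in> C2} \<in> sets \<eta>" by (simp add: Collect_conj_eq)
  qed (use cm E Cb in blast)
  also have "\<dots> < (1/2)^k" using C(4) E Cb by (simp add: measure_law0[OF \<eta>])
  finally have 1: "measure \<eta> {y. y g \<in> closure (base_set n) \<and> y 0 \<in> C2} < (1/2)^k" .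
  have "measure \<eta> {y. y g \<notin> base_set n \<and> y 0 \<in> C1} = measure \<eta> {y. y 0 \<in> C1 - E}"
  proof (rule measure_eq_AE)
    show "AE y in \<eta>. (y \<in> {y. y g \<notin> base_set n \<and> y 0 \<in> C1}) = (y \<in> {y. y 0 \<in> C1 - E})"
      using gt by eventually_elim (auto simp: E_def)
    have "{y :: 'g \<Rightarrow> 'z. y g \<in> - base_set n} \<inter> {y. y 0 \<in> C1} \<in> sets \<eta>"
      using cm[of "- base_set n" g] cm[OF Cb(1), of 0] by (auto simp: open_base_set)
    then show "{y. y g \<notin> base_set n \<and> y 0 \<in> C1} \<in> sets \<eta>" by (simp add: Collect_conj_eq)
  qed (use cm E Cb in blast)
  also have "\<dots> < (1/2)^k" using C(5) E Cb by (simp add: measure_law0[OF \<eta>])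
  finally have 2: "measure \<eta> {y. y g \<notin> base_set n \<and> y 0 \<in> C1} < (1/2)^k" .
  show "orb_law \<nu> a f \<in> nearly_generated \<mu> j"
    unfolding nearly_generated_def j \<eta>_def[symmetric] using \<eta> C(1-3) 1 2 by auto
qed

lemma good_law_law0:
  fixes \<eta> :: "('g::{group_add,countable} \<Rightarrow> 'z::polish_space) measure"
  assumes fr: "\<And>i. \<eta> \<in> small_frontier \<mu> i" and cov: "\<And>k. \<eta> \<in> small_cover \<mu> k"
  shows "good_law (law0 \<eta>)"
proof -
  have \<eta>: "\<eta> \<in> P_mu \<mu>" using cov[of 0] unfolding small_cover_def by blast
  interpret l: prob_space "law0 \<eta>" by (rule prob_space_law0[OF \<eta>])
  note s = sets_law0[OF \<eta>]
  have "measure (law0 \<eta>) (frontier (base_set n)) = 0" for n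
  proof (rule ccontr)
    assume "measure (law0 \<eta>) (frontier (base_set n)) \<noteq> 0"
    then have "0 < measure (law0 \<eta>) (frontier (base_set n))" by (simp add: zero_less_measure_iff)
    then obtain k where "inverse (Suc k) < measure (law0 \<eta>) (frontier (base_set n))" using reals_Archimedean by blast
    moreover have "measure (law0 \<eta>) (frontier (base_set n)) < 1 / Suc k"
      using fr[of "(n, k)"] unfolding small_frontier_def by (simp add: measure_law0[OF \<eta>])
    ultimately show False by (simp add: inverse_eq_divide)
  qed
  then have "frontier (base_set n) \<in> null_sets (law0 \<eta>)" for n
    by (intro null_setsI) (auto simp: s l.emeasure_eq_measure)
  then have "frontiers \<in> null_sets (law0 \<eta>)" unfolding frontiers_def by (rule null_sets_UN)
  then have "measure (law0 \<eta>) frontiers = 0" by (rule measure_eq_0_null_sets)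
  moreover have "measure (law0 \<eta>) {z} = 0" for z
  proof (rule ccontr)
    assume "measure (law0 \<eta>) {z} \<noteq> 0"
    then have "0 < measure (law0 \<eta>) {z}" by (simp add: zero_less_measure_iff)
    then obtain k where k: "inverse (Suc k) < measure (law0 \<eta>) {z}" using reals_Archimedean by blast
    obtain \<C> where C: "\<forall>C\<in>\<C>. closed C \<and> measure \<eta> {y. y 0 \<in> C} < 1 / Suc k" "\<Union>\<C> = UNIV"
      using cov[of k] unfolding small_cover_def by blast
    then obtain C where "C \<in> \<C>" "z \<in> C" by blast
    then have "closed C" "measure (law0 \<eta>) C < 1 / Suc k" using C by (auto simp: measure_law0[OF \<eta>])
    moreover have "measure (law0 \<eta>) {z} \<le> measure (law0 \<eta>) C"
      using \<open>z \<in> C\<close> \<open>closed C\<close> by (intro l.finite_measure_mono) (auto simp: s)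
    ultimately show False using k by (simp add: inverse_eq_divide)
  qed
  ultimately show ?thesis
    unfolding good_law_def nonatomic_prob_def using s l.prob_space_axioms by blast
qed

text \<open>Each bit of the code of each coordinate agrees almost everywhere with an event about
  coordinate 0. Countably many bits reassemble, by decoding, into a Borel map giving the whole
  configuration.\<close>

lemma nearly_generated_determines:
  fixes \<eta> :: "('g::{group_add,countable} \<Rightarrow> 'z::polish_space) measure"
  assumes gen: "\<And>i. \<eta> \<in> nearly_generated \<mu> i"
  shows "\<exists>r. r \<in> borel_measurable borel \<and> (AE y in \<eta>. r (y 0) = y)"
proof -
  have \<eta>: "\<eta> \<in> P_mu \<mu>" using gen[of "(0, 0, 0)"] unfolding nearly_generated_def by blast
  interpret \<eta>: prob_space \<eta> by (rule P_muD(3)[OF \<eta>])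
  have cm: "{y :: 'g \<Rightarrow> 'z. y h \<in> B} \<in> sets \<eta>" if "B \<in> sets borel" for h B
    using measurable_sets[OF measurable_product_coordinates that, of h] by (simp add: vimage_def P_muD(1)[OF \<eta>])
  have "\<exists>E. E \<in> sets borel \<and> (AE y in \<eta>. y g \<in> base_set n \<longleftrightarrow> y 0 \<in> E)" for g n
  proof -
    define Q where "Q k p \<longleftrightarrow> (case p of (C1, C2) \<Rightarrow> closed C1 \<and> closed C2 \<and> C1 \<union> C2 = UNIV \<and>
     measure \<eta> {y. y g \<in> closure (base_set n) \<and> y 0 \<in> C2} < (1/2)^k \<and>
     measure \<eta> {y. y g \<notin> base_set n \<and> y 0 \<in> C1} < (1/2)^k)" for k and p :: "'z set \<times> 'z set"
    have "\<forall>k. \<exists>p. Q k p"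
    proof
      fix k
      show "\<exists>p. Q k p" using gen[of "(g, n, k)"] unfolding nearly_generated_def Q_def by auto
    qed
    from choice[OF this] obtain p where p: "\<And>k. Q k (p k)" by blast
    define C1 where "C1 k = fst (p k)" for k
    define C2 where "C2 k = snd (p k)" for k
    have C: "closed (C1 k)" "closed (C2 k)" "C1 k \<union> C2 k = UNIV"
     "measure \<eta> {y. y g \<in> closure (base_set n) \<and> y 0 \<in> C2 k} < (1/2)^k"
     "measure \<eta> {y. y g \<notin> base_set n \<and> y 0 \<in> C1 k} < (1/2)^k" for k
      using p[of k] unfolding Q_def C1_def C2_def by (auto simp: case_prod_beta)
    define B1 where "B1 k = {y :: 'g \<Rightarrow> 'z. y g \<in> closure (base_set n) \<and> y 0 \<in> C2 k}" for k
    define B2 where "B2 k = {y :: 'g \<Rightarrow> 'z. y g \<notin> base_set n \<and> y 0 \<in> C1 k}" for k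
    have B1: "B1 k \<in> sets \<eta>" for k
      unfolding B1_def Collect_conj_eq using cm[of "closure (base_set n)" g] cm[of "C2 k" 0] C(2) by auto
    have B2: "B2 k \<in> sets \<eta>" for k
      unfolding B2_def Collect_conj_eq using cm[of "- base_set n" g] cm[of "C1 k" 0] C(1) by (auto simp: open_base_set)
    have bc: "AE y in \<eta>. eventually (\<lambda>k. y \<in> space \<eta> - B k) sequentially"
      if B: "\<And>k. B k \<in> sets \<eta>" "\<And>k. measure \<eta> (B k) < (1/2)^k" for B
    proof (rule borel_cantelli_AE1[OF B(1)])
      show "summable (\<lambda>k. measure \<eta> (B k))"
        by (rule summable_comparison_test'[of "\<lambda>k. (1/2)^k"])
          (use B(2) in \<open>auto simp: summable_geometric_iff intro: less_imp_le\<close>)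
    qed (simp add: \<eta>.emeasure_eq_measure)
    \<comment> \<open>The lower limit of the sets \<open>C1 k\<close>: by Borel-Cantelli almost
      every point lies in only finitely many bad events of either kind, so membership of coordinate
      0 in \<open>E\<close> decides the basic set.\<close>
    define E where "E = (\<Union>m. \<Inter>k\<in>{m..}. C1 k)"
    have E: "z \<in> E \<longleftrightarrow> (\<forall>\<^sub>F k in sequentially. z \<in> C1 k)" for z
      unfolding E_def eventually_sequentially by auto
    have "E \<in> sets borel" unfolding E_def using C(1) by (intro sets.countable_UN sets.countable_INT'') auto
    moreover have "AE y in \<eta>. y g \<in> base_set n \<longleftrightarrow> y 0 \<in> E"
      using bc[of B1, OF B1 C(4)[folded B1_def]] bc[of B2, OF B2 C(5)[folded B2_def]]
    proof eventually_elim
      case (elim y)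
      show ?case
      proof
        assume y: "y g \<in> base_set n"
        show "y 0 \<in> E" unfolding E using elim(1)
        proof eventually_elim
          case (elim k)
          then show ?case using y closure_subset[of "base_set n"] C(3)[of k] unfolding B1_def by blast
        qed
      next
        assume "y 0 \<in> E"
        then have "\<forall>\<^sub>F k in sequentially. y 0 \<in> C1 k" unfolding E .
        then have "\<forall>\<^sub>F k in sequentially. y g \<in> base_set n" using elim(2)
          by eventually_elim (auto simp: B2_def)
        then show "y g \<in> base_set n" by simp
      qed
    qed
    ultimately show ?thesis by blast
  qed
  then have "\<forall>i. \<exists>E. E \<in> sets borel \<and> (AE y in \<eta>. y (fst i) \<in> base_set (snd i) \<longleftrightarrow> y 0 \<in> E)" by blast
  from choice[OF this] obtain E where
    E: "\<And>g n. E (g, n) \<in> sets borel" "\<And>g n. AE y in \<eta>. y g \<in> base_set n \<longleftrightarrow> y 0 \<in> E (g, n)" by auto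
  define r :: "'z \<Rightarrow> 'g \<Rightarrow> 'z" where "r z = (\<lambda>g. decode (code3 (\<lambda>n. z \<in> E (g, n))))" for z
  have "r \<in> borel_measurable borel" unfolding r_def
  proof (rule measurable_coordinatewise_then_product)
    fix g
    have [measurable]: "Measurable.pred borel (\<lambda>z. z \<in> E (g, n))" for n using E(1) by (simp add: pred_def)
    show "(\<lambda>z. decode (code3 (\<lambda>n. z \<in> E (g, n)))) \<in> borel_measurable borel" by measurable
  qed
  moreover have "AE y in \<eta>. \<forall>i. y (fst i) \<in> base_set (snd i) \<longleftrightarrow> y 0 \<in> E i"
    using E(2) by (simp add: AE_all_countable)
  then have "AE y in \<eta>. r (y 0) = y"
  proof eventually_elim
    case (elim y)
    have "r (y 0) g = y g" for g
    proof -
      have "(y 0 \<in> E (g, n)) = (y g \<in> base_set n)" for n using elim[rule_format, of "(g, n)"] by simp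
      then have "r (y 0) g = decode (hcode (y g))" unfolding r_def hcode_def by simp
      then show ?thesis by simp
    qed
    then show ?case by blast
  qed
  ultimately show ?thesis by blast
qed

section \<open>Residual sets and density\<close>

lemma residual_in_mono: "residual_in T S \<Longrightarrow> S \<subseteq> S' \<Longrightarrow> residual_in T S'"
  unfolding residual_in_def by blast

lemma residual_in_INT:
  fixes U :: "'i::countable \<Rightarrow> 'a set"
  assumes "\<And>i. openin T (U i)" "\<And>i. T closure_of U i = topspace T"
  shows "residual_in T (\<Inter>i. U i)"
  unfolding residual_in_def
proof (intro exI conjI allI)
  show "(\<Inter>n. U (from_nat n)) \<subseteq> (\<Inter>i. U i)"
  proof (rule INT_greatest)
    fix i show "(\<Inter>n. U (from_nat n)) \<subseteq> U i" using INT_lower[of "to_nat i" UNIV "\<lambda>n. U (from_nat n)"] by simp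
  qed
qed (use assms in auto)

lemma residual_in_Int:
  assumes "residual_in T S" "residual_in T S'"
  shows "residual_in T (S \<inter> S')"
proof -
  obtain U V :: "nat \<Rightarrow> 'a set" where
    U: "\<And>n. openin T (U n)" "\<And>n. T closure_of U n = topspace T" "(\<Inter>n. U n) \<subseteq> S" and
    V: "\<And>n. openin T (V n)" "\<And>n. T closure_of V n = topspace T" "(\<Inter>n. V n) \<subseteq> S'"
    using assms unfolding residual_in_def by metis
  define W where "W i = (case i of (True, n) \<Rightarrow> U n | (False, n) \<Rightarrow> V n)" for i
  have "residual_in T (\<Inter>i. W i)"
    by (rule residual_in_INT) (use U V in \<open>auto simp: W_def split: prod.split bool.split\<close>)
  moreover have "(\<Inter>i. W i) \<subseteq> S \<inter> S'"
  proof -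
    have 1: "(\<Inter>i. W i) \<subseteq> (\<Inter>n. U n)"
    proof (rule INT_greatest)
      fix n show "(\<Inter>i. W i) \<subseteq> U n" using INT_lower[of "(True, n)" UNIV W] by (simp add: W_def)
    qed
    have 2: "(\<Inter>i. W i) \<subseteq> (\<Inter>n. V n)"
    proof (rule INT_greatest)
      fix n show "(\<Inter>i. W i) \<subseteq> V n" using INT_lower[of "(False, n)" UNIV W] by (simp add: W_def)
    qed
    show ?thesis by (rule Int_greatest[OF order_trans[OF 1 U(3)] order_trans[OF 2 V(3)]])
  qed
  ultimately show ?thesis by (rule residual_in_mono)
qed

lemma closure_of_eq_topspace_iff:
  assumes "S \<subseteq> topspace T"
  shows "T closure_of S = topspace T \<longleftrightarrow> (\<forall>U. openin T U \<longrightarrow> U \<noteq> {} \<longrightarrow> U \<inter> S \<noteq> {})"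
proof
  assume *: "T closure_of S = topspace T"
  show "\<forall>U. openin T U \<longrightarrow> U \<noteq> {} \<longrightarrow> U \<inter> S \<noteq> {}"
    using openin_Int_closure_of_eq_empty[of T _ S] * openin_subset by (metis inf.absorb_iff1)
next
  assume *: "\<forall>U. openin T U \<longrightarrow> U \<noteq> {} \<longrightarrow> U \<inter> S \<noteq> {}"
  have "topspace T \<subseteq> T closure_of S"
  proof
    fix x assume x: "x \<in> topspace T"
    have "\<exists>y. y \<in> S \<and> y \<in> U" if "x \<in> U" "openin T U" for U using * that by blast
    then show "x \<in> T closure_of S" unfolding in_closure_of using x by simp
  qed
  then show "T closure_of S = topspace T" by (intro antisym closure_of_subset_topspace)
qed

text \<open>\<open>p\<close> runs the quantile isomorphism and then reconstructs the configuration
  by \<open>r\<close>; \<open>q\<close> reads coordinate 0 and goes back. They are inverse to each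
  other almost everywhere, so the shift transports to an action on X whose orbit law for the
  quantile isomorphism is \<eta>.\<close>

lemma generated_in_Good:
  fixes \<eta> :: "('g::{group_add,countable} \<Rightarrow> 'z::polish_space) measure" and \<nu> :: "'x::polish_space measure"
  assumes gen: "gen_semigroup (set_pmf \<mu>) = UNIV" and \<nu>: "nonatomic_prob \<nu>"
    and fr: "\<And>i. \<eta> \<in> small_frontier \<mu> i" and cov: "\<And>k. \<eta> \<in> small_cover \<mu> k"
    and ng: "\<And>j. \<eta> \<in> nearly_generated \<mu> j"
  shows "\<eta> \<in> Good \<mu> \<nu>"
proof -
  have \<eta>: "\<eta> \<in> P_mu \<mu>" using cov[of 0] unfolding small_cover_def by blast
  define l where "l = law0 \<eta>"
  have good: "good_law l" unfolding l_def by (rule good_law_law0[OF fr cov])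
  have na: "nonatomic_prob l" using good unfolding good_law_def by blast
  obtain r where r: "r \<in> borel_measurable borel" "AE y in \<eta>. r (y 0) = y"
    using nearly_generated_determines[OF ng] by blast
  define p where "p x = r (iso \<nu> l x)" for x
  define q where "q y = iso l \<nu> (y 0)" for y :: "'g \<Rightarrow> 'z"
  note [measurable] = measurable_iso[OF \<nu> na] measurable_iso[OF na \<nu>] r(1)
  have c0: "(\<lambda>y. y 0) \<in> borel_measurable \<eta>" unfolding P_muD(5)[OF \<eta>] by simp
  have "p \<in> borel_measurable borel" "q \<in> borel_measurable borel"
    unfolding p_def q_def by measurable
  then have p: "p \<in> measurable \<nu> \<eta>" and q: "q \<in> measurable \<eta> \<nu>"
    unfolding P_muD(5)[OF \<eta>] measurable_cong_sets[OF refl P_muD(1)[OF \<eta>]]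
    by (simp_all add: measurable_nonatomic_prob[OF \<nu>])
  have i: "iso \<nu> l \<in> borel_measurable \<nu>" using measurable_iso[OF \<nu> na] by (simp add: measurable_nonatomic_prob[OF \<nu>])
  have dr: "distr l \<eta> r = \<eta>"
  proof -
    have "distr l \<eta> r = distr \<eta> \<eta> (\<lambda>y. r (y 0))"
      unfolding l_def law0_def
      by (subst distr_distr[OF _ c0]) (use r(1) in \<open>auto simp: comp_def measurable_cong_sets[OF refl P_muD(1)[OF \<eta>]]\<close>)
    also have "\<dots> = distr \<eta> \<eta> (\<lambda>y. y)"
    proof (rule distr_cong_AE)
      show "(\<lambda>y. r (y 0)) \<in> measurable \<eta> \<eta>"
        using measurable_compose[OF c0 r(1)] by (simp add: measurable_cong_sets[OF refl P_muD(1)[OF \<eta>]])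
    qed (use r(2) in auto)
    also have "\<dots> = \<eta>" by (rule distr_id)
    finally show ?thesis .
  qed
  have law: "distr \<nu> \<eta> p = \<eta>"
  proof -
    have "distr \<nu> \<eta> p = distr (distr \<nu> borel (iso \<nu> l)) \<eta> r"
      unfolding p_def[abs_def] by (subst distr_distr[OF _ i])
        (use r(1) in \<open>auto simp: comp_def measurable_cong_sets[OF refl P_muD(1)[OF \<eta>]]\<close>)
    then show ?thesis unfolding distr_iso[OF \<nu> na] dr .
  qed
  have r0: "AE z in l. r z 0 = z"
  proof -
    have "{z \<in> space borel. r z 0 = z} \<in> sets borel"
      by (rule measurable_equality_set[OF measurable_compose[OF r(1) measurable_product_coordinates]]) simp
    moreover have "AE y in \<eta>. r (y 0) 0 = y 0" using r(2) by eventually_elim simp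
    ultimately show ?thesis unfolding l_def law0_def using AE_distr_iff[OF c0] by simp
  qed
  have r0': "AE x in \<nu>. p x 0 = iso \<nu> l x"
  proof -
    have "AE z in distr \<nu> borel (iso \<nu> l). r z 0 = z" unfolding distr_iso[OF \<nu> na] by (rule r0)
    from AE_distrD[OF i this] show ?thesis unfolding p_def .
  qed
  have qp: "AE x in \<nu>. q (p x) = x"
    using r0' iso_inverse[OF \<nu> na] by eventually_elim (simp add: q_def)
  have pq: "AE y in \<eta>. p (q y) = y"
    using r(2) AE_law0D[OF \<eta> iso_inverse[OF na \<nu>, unfolded l_def]]
    by eventually_elim (simp add: p_def q_def l_def)
  have prob: "prob_space \<nu>" using \<nu> unfolding nonatomic_prob_def by blast
  define a where "a = (\<lambda>g x. q (shift_action g (p x)))"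
  have a: "stat_action \<mu> \<nu> a"
    unfolding a_def by (rule stat_action_transport[OF gen P_muD(4)[OF \<eta>] prob p q law qp pq])
  have "orb_law \<nu> a (iso \<nu> l) = orb_law \<nu> a (\<lambda>x. p x 0)"
    by (rule orb_law_cong_AE[OF gen a i measurable_compose[OF p c0]]) (use r0' in \<open>auto elim: eventually_mono\<close>)
  also have "\<dots> = orb_law \<eta> shift_action (\<lambda>y. y 0)"
    unfolding a_def by (rule orb_law_transport[OF gen P_muD(4)[OF \<eta>] p q law pq c0])
  also have "\<dots> = distr \<eta> borel (\<lambda>y. y)"
  proof -
    have "orb shift_action (\<lambda>y. y 0) = (\<lambda>y :: 'g \<Rightarrow> 'z. y)" by (simp add: orb_def fun_eq_iff)
    then show ?thesis unfolding orb_law_def by simp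
  qed
  also have "\<dots> = \<eta>" by (rule distr_id2) (simp add: P_muD(1)[OF \<eta>])
  finally show ?thesis unfolding Good_def using \<eta> good a unfolding l_def by blast
qed

lemma embeds_orb_law_Good:
  fixes f :: "'x::polish_space \<Rightarrow> 'z::polish_space" and \<mu> :: "'g::{group_add,countable} pmf"
  assumes "gen_semigroup (set_pmf \<mu>) = UNIV" "nonatomic_prob \<nu>" "stat_action \<mu> \<nu> a" "embeds f"
  shows "orb_law \<nu> a f \<in> Good \<mu> \<nu>"
  using assms by (intro generated_in_Good embeds_orb_law_generated)

lemma Good_dense:
  fixes U :: "('g::{group_add,countable} \<Rightarrow> 'z::{polish_space,perfect_space}) measure set" and \<nu> :: "'x::polish_space measure"
  assumes "gen_semigroup (set_pmf \<mu>) = UNIV" "nonatomic_prob \<nu>" "openin (P_mu_topology \<mu>) U" "U \<noteq> {}"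
  shows "\<exists>\<eta>\<in>U. \<eta> \<in> Good \<mu> \<nu>"
  using P_mu_embeds_dense[OF assms] embeds_orb_law_Good[OF assms(1,2)] by blast

text \<open>All the countably many open conditions hold for orbit laws of embeddings, which are
  dense by \<open>P_mu_embeds_dense\<close>.\<close>

lemma residual_Good:
  fixes \<mu> :: "'g::{group_add,countable} pmf" and \<nu> :: "'x::polish_space measure"
  assumes gen: "gen_semigroup (set_pmf \<mu>) = UNIV" and \<nu>: "nonatomic_prob \<nu>"
  shows "residual_in (P_mu_topology \<mu>) (Good \<mu> \<nu> :: ('g \<Rightarrow> 'z::{polish_space,perfect_space}) measure set)"
proof -
  have dense: "P_mu_topology \<mu> closure_of D = topspace (P_mu_topology \<mu>)"
    if "openin (P_mu_topology \<mu>) D" "\<And>a f. stat_action \<mu> \<nu> a \<Longrightarrow> embeds f \<Longrightarrow> orb_law \<nu> a f \<in> D"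
    for D :: "('g \<Rightarrow> 'z) measure set"
  proof (subst closure_of_eq_topspace_iff[OF openin_subset[OF that(1)]], intro allI impI)
    fix U :: "('g \<Rightarrow> 'z) measure set" assume "openin (P_mu_topology \<mu>) U" "U \<noteq> {}"
    then obtain a f where "stat_action \<mu> \<nu> a" "embeds f" "orb_law \<nu> a f \<in> U"
      using P_mu_embeds_dense[OF gen \<nu>] by blast
    then show "U \<inter> D \<noteq> {}" using that(2) by blast
  qed
  have "residual_in (P_mu_topology \<mu>) ((\<Inter>i. small_frontier \<mu> i) \<inter> ((\<Inter>k. small_cover \<mu> k) \<inter> (\<Inter>j. nearly_generated \<mu> j)) :: ('g \<Rightarrow> 'z) measure set)"
    by (intro residual_in_Int residual_in_INT dense openin_small_frontier openin_small_cover openin_nearly_generated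
      embeds_orb_law_generated[OF gen \<nu>])
  then show ?thesis
    by (rule residual_in_mono) (auto intro!: generated_in_Good[OF gen \<nu>])
qed

section \<open>Recovering the action from a good measure\<close>

text \<open>The rank coordinates of the hidden action, expressed by the measure alone. The
  thresholds move with the zeroth law, which is why continuity needs a detour.\<close>

definition chat :: "('g::group_add \<Rightarrow> 'z::polish_space) measure \<Rightarrow> 'g \<times> rat \<times> rat \<Rightarrow> real" where
  "chat \<eta> = (\<lambda>(g, u, v). measure \<eta> {y. rank (law0 \<eta>) (y 0) \<le> of_rat u \<and> rank (law0 \<eta>) (y (- g)) \<le> of_rat v})"

text \<open>The same joint distribution functions with thresholds fixed on the code scale, so that
  their continuity is a portmanteau statement.\<close>

definition pcdf :: "('g::group_add \<Rightarrow> 'z::polish_space) measure \<Rightarrow> 'g \<times> rat \<times> rat \<Rightarrow> real" where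
  "pcdf \<eta> = (\<lambda>(g, s, t). measure \<eta> {y. hcode (y 0) \<le> of_rat s \<and> hcode (y (- g)) \<le> of_rat t})"

text \<open>The isomorphism \<open>iso\<close> preserves ranks, and coordinate \<open>- g\<close> of
  the orbit map observes the point moved by \<open>g\<close>.\<close>

lemma acoord_eq_chat:
  fixes a :: "'g::{group_add,countable} \<Rightarrow> 'x::polish_space \<Rightarrow> 'x" and m :: "'z::polish_space measure"
  assumes gen: "gen_semigroup (set_pmf \<mu>) = UNIV" and \<nu>: "nonatomic_prob \<nu>" and a: "stat_action \<mu> \<nu> a"
    and m: "nonatomic_prob m"
  shows "law0 (orb_law \<nu> a (iso \<nu> m)) = m" "acoord \<nu> a = chat (orb_law \<nu> a (iso \<nu> m))"
proof -
  interpret prob_space \<nu> using \<nu> unfolding nonatomic_prob_def by blast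
  define f where "f = iso \<nu> m"
  have f: "f \<in> borel_measurable \<nu>" using measurable_iso[OF \<nu> m] by (simp add: f_def measurable_nonatomic_prob[OF \<nu>])
  show l: "law0 (orb_law \<nu> a (iso \<nu> m)) = m"
    using law0_orb_law[OF a f] distr_iso[OF \<nu> m] unfolding f_def by simp
  have orb: "orb a f \<in> borel_measurable \<nu>" by (rule measurable_orb[OF stat_actionD(2)[OF a] f])
  show "acoord \<nu> a = chat (orb_law \<nu> a (iso \<nu> m))"
  proof (rule ext)
    fix i :: "'g \<times> rat \<times> rat"
    obtain g u v where i: "i = (g, u, v)" by (metis prod_cases3)
    define B where "B = {y :: 'g \<Rightarrow> 'z. rank m (y 0) \<le> of_rat u \<and> rank m (y (- g)) \<le> of_rat v}"
    note [measurable] = measurable_rank[OF m] measurable_rank[OF \<nu>]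
    have Bm: "B \<in> sets borel"
    proof -
      have 1: "(\<lambda>y :: 'g \<Rightarrow> 'z. rank m (y h)) \<in> borel_measurable borel" for h
        by (rule measurable_compose[OF measurable_product_coordinates measurable_rank[OF m]])
      have "{y \<in> space (borel :: ('g \<Rightarrow> 'z) measure). rank m (y 0) \<le> of_rat u \<and> rank m (y (- g)) \<le> of_rat v} \<in> sets borel"
        using 1 by measurable
      then show ?thesis by (simp add: B_def)
    qed
    have "chat (orb_law \<nu> a f) i = measure (orb_law \<nu> a f) B"
      unfolding chat_def i B_def f_def l by simp
    also have "\<dots> = measure \<nu> (orb a f -` B \<inter> space \<nu>)"
      unfolding orb_law_def by (rule measure_distr[OF orb Bm])
    also have "\<dots> = measure \<nu> {x. rank \<nu> x \<le> of_rat u \<and> rank \<nu> (a g x) \<le> of_rat v}"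
    proof (rule measure_eq_AE)
      show "AE x in \<nu>. (x \<in> orb a f -` B \<inter> space \<nu>) = (x \<in> {x. rank \<nu> x \<le> of_rat u \<and> rank \<nu> (a g x) \<le> of_rat v})"
        using rank_iso[OF \<nu> m] stat_action_AE[OF gen a rank_iso[OF \<nu> m], of g] stat_actionD(3)[OF a]
        by eventually_elim (simp add: B_def orb_def f_def space_nonatomic_prob[OF \<nu>])
      show "orb a f -` B \<inter> space \<nu> \<in> sets \<nu>" by (rule measurable_sets[OF orb Bm])
      have "(\<lambda>x. rank \<nu> (a g x)) \<in> borel_measurable \<nu>" "rank \<nu> \<in> borel_measurable \<nu>"
        using measurable_compose[OF stat_actionD(2)[OF a, of g], of "rank \<nu>" borel]
        by (simp_all add: measurable_nonatomic_prob[OF \<nu>] measurable_rank[OF \<nu>])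
      then have "{x \<in> space \<nu>. rank \<nu> x \<le> of_rat u \<and> rank \<nu> (a g x) \<le> of_rat v} \<in> sets \<nu>" by measurable
      then show "{x. rank \<nu> x \<le> of_rat u \<and> rank \<nu> (a g x) \<le> of_rat v} \<in> sets \<nu>"
        by (simp add: space_nonatomic_prob[OF \<nu>])
    qed
    also have "\<dots> = acoord \<nu> a i" by (simp add: acoord_def i)
    finally show "acoord \<nu> a i = chat (orb_law \<nu> a (iso \<nu> m)) i" unfolding f_def by simp
  qed
qed

text \<open>The threshold set \<open>E\<close> has a boundary that is null for \<eta>: it can only
  be reached at frontier points or where a code equals a threshold, and good laws charge
  neither.\<close>

lemma pcdf_tendsto:
  fixes \<eta> :: "('g::{group_add,countable} \<Rightarrow> 'z::polish_space) measure"
  assumes gen: "gen_semigroup (set_pmf \<mu>) = UNIV" and \<eta>: "\<eta> \<in> P_mu \<mu>" and good: "good_law (law0 \<eta>)"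
  shows "(pcdf \<longlongrightarrow> pcdf \<eta>) (nhdsin (P_mu_topology \<mu>) \<eta>)"
  unfolding tendsto_fun_iff
proof (rule allI)
  fix i :: "'g \<times> rat \<times> rat"
  obtain g s t where i: "i = (g, s, t)" by (metis prod_cases3)
  have na: "nonatomic_prob (law0 \<eta>)" using good unfolding good_law_def by blast
  define E where "E = {y :: 'g \<Rightarrow> 'z. hcode (y 0) \<le> of_rat s \<and> hcode (y (- g)) \<le> of_rat t}"
  have Em: "E \<in> sets borel"
  proof -
    have 1: "(\<lambda>y :: 'g \<Rightarrow> 'z. hcode (y h)) \<in> borel_measurable borel" for h
      by (rule measurable_compose[OF measurable_product_coordinates measurable_hcode])
    have "{y \<in> space (borel :: ('g \<Rightarrow> 'z) measure). hcode (y 0) \<le> of_rat s \<and> hcode (y (- g)) \<le> of_rat t} \<in> sets borel"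
      using 1 by measurable
    then show ?thesis by (simp add: E_def)
  qed
  define R where "R y \<longleftrightarrow> y 0 \<notin> frontiers \<and> y (- g) \<notin> frontiers \<and> hcode (y 0) \<noteq> of_rat s \<and> hcode (y (- g)) \<noteq> of_rat t"
    for y :: "'g \<Rightarrow> 'z"
  have hc: "AE z in law0 \<eta>. hcode z \<noteq> c" for c
  proof -
    interpret h: prob_space "hlaw (law0 \<eta>)" using real_distribution_hlaw[OF na] by (simp add: real_distribution_def)
    have "{c} \<in> null_sets (hlaw (law0 \<eta>))"
      using measure_hlaw_singleton[OF na, of c] by (intro null_setsI) (simp_all add: h.emeasure_eq_measure, simp add: hlaw_def)
    then have "AE u in hlaw (law0 \<eta>). u \<notin> {c}" by (rule AE_not_in)
    then show ?thesis unfolding hlaw_def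
      using AE_distrD[of hcode "law0 \<eta>" borel] by (simp add: measurable_nonatomic_prob[OF na])
  qed
  have R: "AE y in \<eta>. R y"
    using AE_coord[OF gen \<eta> good_law_AE[OF good], of 0] AE_coord[OF gen \<eta> good_law_AE[OF good], of "- g"]
      AE_coord[OF gen \<eta> hc[of "of_rat s"], of 0] AE_coord[OF gen \<eta> hc[of "of_rat t"], of "- g"]
    unfolding R_def by eventually_elim simp
  have lim: "(\<lambda>n. hcode (y n h)) \<longlonglongrightarrow> hcode (l h)" if "y \<longlonglongrightarrow> l" "l h \<notin> frontiers" for y :: "nat \<Rightarrow> 'g \<Rightarrow> 'z" and l h
    using isCont_tendsto_compose[OF isCont_hcode[OF that(2)]] that(1) unfolding tendsto_fun_iff by blast
  have cl1: "y \<in> E" if y: "y \<in> closure E" "R y" for y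
  proof -
    obtain x where x: "\<And>n. x n \<in> E" "x \<longlonglongrightarrow> y" using y(1) unfolding closure_sequential by blast
    have "hcode (y 0) \<le> of_rat s"
      by (rule LIMSEQ_le_const2[OF lim[OF x(2)]]) (use x(1) y(2) in \<open>auto simp: E_def R_def\<close>)
    moreover have "hcode (y (- g)) \<le> of_rat t"
      by (rule LIMSEQ_le_const2[OF lim[OF x(2)]]) (use x(1) y(2) in \<open>auto simp: E_def R_def\<close>)
    ultimately show ?thesis by (simp add: E_def)
  qed
  have cl2: "y \<in> - E" if y: "y \<in> closure (- E)" "R y" for y
  proof (rule ccontr)
    assume "y \<notin> - E"
    then have less: "hcode (y 0) < of_rat s" "hcode (y (- g)) < of_rat t" using y(2) by (auto simp: E_def R_def)
    obtain x where x: "\<And>n. x n \<in> - E" "x \<longlonglongrightarrow> y" using y(1) unfolding closure_sequential by blast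
    have "\<forall>\<^sub>F n in sequentially. hcode (x n 0) < of_rat s" "\<forall>\<^sub>F n in sequentially. hcode (x n (- g)) < of_rat t"
      using order_tendstoD(2)[OF lim[OF x(2)] less(1)] order_tendstoD(2)[OF lim[OF x(2)] less(2)] y(2)
      unfolding R_def by blast+
    then have "\<forall>\<^sub>F n in sequentially. x n \<in> E" by eventually_elim (simp add: E_def)
    then show False using x(1) by (auto dest: eventually_happens)
  qed
  have clE: "measure \<eta> (closure S) = measure \<eta> S" if "S \<in> sets borel" "\<And>y. y \<in> closure S \<Longrightarrow> R y \<Longrightarrow> y \<in> S" for S
  proof (rule measure_eq_AE)
    show "AE y in \<eta>. (y \<in> closure S) = (y \<in> S)"
      using R by eventually_elim (use that(2) closure_subset in blast)
  qed (use that(1) in \<open>auto simp: P_muD(1)[OF \<eta>]\<close>)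
  have cm: "measure \<eta>' (- E) = 1 - measure \<eta>' E" if "\<eta>' \<in> P_mu \<mu>" for \<eta>'
    using prob_space.prob_compl[OF P_muD(3)[OF that], of E] Em
    by (simp add: P_muD(1,2)[OF that] Compl_eq_Diff_UNIV)
  show "((\<lambda>\<eta>. pcdf \<eta> i) \<longlongrightarrow> pcdf \<eta> i) (nhdsin (P_mu_topology \<mu>) \<eta>)"
  proof (rule tendstoI)
    fix \<epsilon> :: real assume \<epsilon>: "0 < \<epsilon>"
    \<comment> \<open>Upper bounds on the closures of \<open>E\<close> and of its complement
      together give a two-sided bound for the measure of \<open>E\<close>.\<close>
    define N where "N = {\<eta>' \<in> P_mu \<mu>. measure \<eta>' (closure E) < measure \<eta> E + \<epsilon>} \<inter>
       {\<eta>' \<in> P_mu \<mu>. measure \<eta>' (closure (- E)) < measure \<eta> (- E) + \<epsilon>}"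
    have "openin (P_mu_topology \<mu>) N" unfolding N_def by (intro openin_Int openin_P_mu_closed_less closed_closure)
    moreover have "\<eta> \<in> N" unfolding N_def using \<eta> \<epsilon> clE[OF Em cl1] clE[OF _ cl2] Em by (simp add: borel_comp)
    moreover have "dist (pcdf \<eta>' i) (pcdf \<eta> i) < \<epsilon>" if \<eta>': "\<eta>' \<in> N" for \<eta>'
    proof -
      have P: "\<eta>' \<in> P_mu \<mu>" using \<eta>' unfolding N_def by blast
      interpret p: prob_space \<eta>' by (rule P_muD(3)[OF P])
      have "measure \<eta>' S \<le> measure \<eta>' (closure S)" for S
        by (intro p.finite_measure_mono closure_subset) (simp add: P_muD(1)[OF P])
      then have "measure \<eta>' E < measure \<eta> E + \<epsilon>" "measure \<eta>' (- E) < measure \<eta> (- E) + \<epsilon>"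
        using \<eta>' unfolding N_def by (auto intro: le_less_trans)
      then have "\<bar>measure \<eta>' E - measure \<eta> E\<bar> < \<epsilon>" unfolding cm[OF P] cm[OF \<eta>] by linarith
      then show ?thesis unfolding pcdf_def i E_def dist_real_def by simp
    qed
    ultimately show "\<forall>\<^sub>F \<eta>' in nhdsin (P_mu_topology \<mu>) \<eta>. dist (pcdf \<eta>' i) (pcdf \<eta> i) < \<epsilon>"
      unfolding eventually_nhdsin by blast
  qed
qed

section \<open>From thresholds on codes to thresholds on ranks\<close>

lemma cdf_hlaw_eq:
  fixes m :: "'z::polish_space measure"
  assumes m: "nonatomic_prob m"
  shows "cdf (hlaw m) t = measure m {z. hcode z \<le> t}"
proof -
  have "hcode \<in> borel_measurable m" by (simp add: measurable_nonatomic_prob[OF m])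
  then show ?thesis unfolding cdf_def hlaw_def
    by (subst measure_distr) (auto simp: space_nonatomic_prob[OF m] vimage_def)
qed

text \<open>Codes lie between 0 and 3/2, so the continuous distribution function runs from 0 at -1
  to 1 at 2. The intermediate value theorem hits \<open>c\<close>, and a nearby rational nearly
  does.\<close>

lemma cdf_hlaw_rat_dense:
  fixes m :: "'z::polish_space measure"
  assumes m: "nonatomic_prob m" and c: "0 \<le> c" "c \<le> 1" and \<delta>: "\<delta> > 0"
  shows "\<exists>q::rat. \<bar>c - cdf (hlaw m) (of_rat q)\<bar> < \<delta>"
proof -
  interpret prob_space m using m unfolding nonatomic_prob_def by blast
  have "\<not> hcode z \<le> -1" for z :: 'z using hcode_bounds(1)[of z] by simp
  then have "cdf (hlaw m) (-1) = 0" unfolding cdf_hlaw_eq[OF m] by simp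
  moreover have "hcode z \<le> 2" for z :: 'z using hcode_bounds(2)[of z] by simp
  then have "{z :: 'z. hcode z \<le> 2} = space m" by (simp add: space_nonatomic_prob[OF m])
  then have "cdf (hlaw m) 2 = 1" unfolding cdf_hlaw_eq[OF m] by (simp add: prob_space)
  ultimately obtain x where x: "cdf (hlaw m) x = c"
    using IVT[of "cdf (hlaw m)" "-1" c 2] c isCont_cdf_hlaw[OF m] by auto
  have "\<forall>\<^sub>F y in at x. dist (cdf (hlaw m) y) c < \<delta>"
    using tendstoD[OF isCont_cdf_hlaw[OF m, of x, unfolded isCont_def] \<delta>] x by simp
  then obtain d where d: "d > 0" "\<And>y. y \<noteq> x \<Longrightarrow> dist y x < d \<Longrightarrow> dist (cdf (hlaw m) y) c < \<delta>"
    unfolding eventually_at by auto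
  obtain q :: rat where "x < of_rat q" "of_rat q < x + d" using of_rat_dense[of x "x + d"] d(1) by auto
  then show ?thesis using d(2)[of "of_rat q"] by (intro exI[of _ q]) (auto simp: dist_real_def abs_minus_commute)
qed

text \<open>The rank is a monotone function of the code, so the two sublevel sets are nested and
  their symmetric difference has the difference of their masses.\<close>

lemma measure_rank_hcode_symdiff:
  fixes m :: "'z::polish_space measure"
  assumes m: "nonatomic_prob m"
  shows "measure m ({z. rank m z \<le> u} - {z. hcode z \<le> s} \<union> ({z. hcode z \<le> s} - {z. rank m z \<le> u}))
     = \<bar>measure unif {..u} - cdf (hlaw m) s\<bar>"
proof -
  interpret prob_space m using m unfolding nonatomic_prob_def by blast
  have S: "sets m = sets borel" using m unfolding nonatomic_prob_def by blast
  interpret h: real_distribution "hlaw m" by (rule real_distribution_hlaw[OF m])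
  define A where "A = {z. rank m z \<le> u}"
  define B where "B = {z :: 'z. hcode z \<le> s}"
  have A: "A \<in> sets m" unfolding A_def S
    using measurable_sets[OF measurable_rank[OF m], of "{..u}"] by (simp add: vimage_def)
  have B: "B \<in> sets m" unfolding B_def S
    using measurable_sets[OF measurable_hcode, of "{..s}"] by (simp add: vimage_def)
  have mA: "measure m A = measure unif {..u}" unfolding A_def using measure_rank_vimage[OF m, of "{..u}"] by simp
  have mB: "measure m B = cdf (hlaw m) s" unfolding B_def by (rule cdf_hlaw_eq[OF m, symmetric])
  have "A \<subseteq> B \<or> B \<subseteq> A"
  proof (cases "cdf (hlaw m) s \<le> u")
    case True
    have "B \<subseteq> A" using h.cdf_nondecreasing True by (auto simp: A_def B_def rank_def intro: order_trans)
    then show ?thesis ..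
  next
    case False
    have "hcode z \<le> s" if "rank m z \<le> u" for z
      using that False h.cdf_nondecreasing[of s "hcode z"] by (force simp: rank_def)
    then show ?thesis by (auto simp: A_def B_def)
  qed
  then have "measure m (A - B \<union> (B - A)) = \<bar>measure m A - measure m B\<bar>"
  proof
    assume AB: "A \<subseteq> B"
    then have "A - B \<union> (B - A) = B - A" by blast
    then show ?thesis using finite_measure_Diff[OF B A AB] finite_measure_mono[OF AB B] by simp
  next
    assume BA: "B \<subseteq> A"
    then have "A - B \<union> (B - A) = A - B" by blast
    then show ?thesis using finite_measure_Diff[OF A B BA] finite_measure_mono[OF BA A] by simp
  qed
  then show ?thesis unfolding mA mB unfolding A_def B_def .
qed

lemma (in finite_measure) measure_Int_diff_le:
  assumes "P \<in> sets M" "P' \<in> sets M" "Q \<in> sets M" "Q' \<in> sets M"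
  shows "\<bar>measure M (P \<inter> Q) - measure M (P' \<inter> Q')\<bar> \<le> measure M (P - P' \<union> (P' - P)) + measure M (Q - Q' \<union> (Q' - Q))"
proof -
  have *: "measure M (P \<inter> Q) \<le> measure M (P' \<inter> Q') + (measure M (P - P' \<union> (P' - P)) + measure M (Q - Q' \<union> (Q' - Q)))"
    if "P \<in> sets M" "P' \<in> sets M" "Q \<in> sets M" "Q' \<in> sets M" for P P' Q Q'
  proof -
    have "measure M (P \<inter> Q) \<le> measure M (P' \<inter> Q' \<union> ((P - P' \<union> (P' - P)) \<union> (Q - Q' \<union> (Q' - Q))))"
      using that by (intro finite_measure_mono) auto
    also have "\<dots> \<le> measure M (P' \<inter> Q') + measure M ((P - P' \<union> (P' - P)) \<union> (Q - Q' \<union> (Q' - Q)))"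
      using that by (intro measure_Un_le) auto
    also have "measure M ((P - P' \<union> (P' - P)) \<union> (Q - Q' \<union> (Q' - Q)))
        \<le> measure M (P - P' \<union> (P' - P)) + measure M (Q - Q' \<union> (Q' - Q))"
      using that by (intro measure_Un_le) auto
    finally show ?thesis by simp
  qed
  have eq: "P' - P \<union> (P - P') = P - P' \<union> (P' - P)" "Q' - Q \<union> (Q - Q') = Q - Q' \<union> (Q' - Q)" by auto
  show ?thesis using *[OF assms] *[OF assms(2,1,4,3)] unfolding eq by linarith
qed

text \<open>Each rank threshold is exchanged for a code threshold at the cost of a symmetric
  difference. In coordinate \<open>- g\<close> this cost is compared with the zeroth law by
  \<open>stat_action_bound\<close>, so \<open>C\<close> serves all stationary measures at
  once.\<close>

lemma chat_pcdf_estimate: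
  assumes gen: "gen_semigroup (set_pmf \<mu>) = (UNIV :: 'g::{group_add,countable} set)"
  shows "\<exists>C>0. \<forall>\<eta> :: ('g \<Rightarrow> 'z::polish_space) measure. \<forall>u v s t. \<eta> \<in> P_mu \<mu> \<longrightarrow> nonatomic_prob (law0 \<eta>) \<longrightarrow>
     \<bar>chat \<eta> (g, u, v) - pcdf \<eta> (g, s, t)\<bar> \<le>
       \<bar>measure unif {..of_rat u} - cdf (hlaw (law0 \<eta>)) (of_rat s)\<bar>
       + C * \<bar>measure unif {..of_rat v} - cdf (hlaw (law0 \<eta>)) (of_rat t)\<bar>"
proof -
  obtain C where C: "C > 0" "\<And>(M :: ('g \<Rightarrow> 'z) measure) \<alpha> E. stat_action \<mu> M \<alpha> \<Longrightarrow> E \<in> sets M \<Longrightarrow>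
      measure M (\<alpha> g -` E \<inter> space M) \<le> C * measure M E"
    using stat_action_bound[OF gen, of g] by blast
  show ?thesis
  proof (intro exI[of _ C] conjI allI impI)
    fix \<eta> :: "('g \<Rightarrow> 'z) measure" and u v s t :: rat
    assume \<eta>: "\<eta> \<in> P_mu \<mu>" and na: "nonatomic_prob (law0 \<eta>)"
    define l where "l = law0 \<eta>"
    note na = na[folded l_def]
    interpret prob_space \<eta> by (rule P_muD(3)[OF \<eta>])
    have cm: "{y :: 'g \<Rightarrow> 'z. y h \<in> B} \<in> sets \<eta>" if "B \<in> sets borel" for h B
      using measurable_sets[OF measurable_product_coordinates that, of h] by (simp add: vimage_def P_muD(1)[OF \<eta>])
    define A where "A c = {z. rank l z \<le> c}" for c
    define B where "B c = {z :: 'z. hcode z \<le> c}" for c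
    define D where "D c d = A c - B d \<union> (B d - A c)" for c d
    have Am: "A c \<in> sets borel" for c unfolding A_def
      using measurable_sets[OF measurable_rank[OF na], of "{..c}"] by (simp add: vimage_def)
    have Bm: "B c \<in> sets borel" for c unfolding B_def
      using measurable_sets[OF measurable_hcode, of "{..c}"] by (simp add: vimage_def)
    have Dm: "D c d \<in> sets borel" for c d unfolding D_def using Am Bm by blast
    have D: "measure \<eta> {y. y 0 \<in> D c d} = \<bar>measure unif {..c} - cdf (hlaw l) d\<bar>" for c d
      using measure_rank_hcode_symdiff[OF na, of c d] measure_law0[OF \<eta> Dm[of c d]]
      unfolding D_def A_def B_def l_def by simp
    have D': "measure \<eta> {y. y (- g) \<in> D c d} \<le> C * \<bar>measure unif {..c} - cdf (hlaw l) d\<bar>" for c d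
      using C(2)[OF P_muD(4)[OF \<eta>] cm[OF Dm[of c d], of 0]] unfolding D
      by (simp add: vimage_def P_muD(2)[OF \<eta>])
    have "\<bar>measure \<eta> ({y. y 0 \<in> A (of_rat u)} \<inter> {y. y (- g) \<in> A (of_rat v)})
         - measure \<eta> ({y. y 0 \<in> B (of_rat s)} \<inter> {y. y (- g) \<in> B (of_rat t)})\<bar>
       \<le> measure \<eta> ({y. y 0 \<in> A (of_rat u)} - {y. y 0 \<in> B (of_rat s)} \<union> ({y. y 0 \<in> B (of_rat s)} - {y. y 0 \<in> A (of_rat u)}))
       + measure \<eta> ({y. y (- g) \<in> A (of_rat v)} - {y. y (- g) \<in> B (of_rat t)} \<union> ({y. y (- g) \<in> B (of_rat t)} - {y. y (- g) \<in> A (of_rat v)}))"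
      by (rule measure_Int_diff_le) (rule cm[OF Am] cm[OF Bm])+
    also have "{y :: 'g \<Rightarrow> 'z. y 0 \<in> A (of_rat u)} - {y. y 0 \<in> B (of_rat s)} \<union> ({y. y 0 \<in> B (of_rat s)} - {y. y 0 \<in> A (of_rat u)})
        = {y. y 0 \<in> D (of_rat u) (of_rat s)}" unfolding D_def by auto
    also have "{y :: 'g \<Rightarrow> 'z. y (- g) \<in> A (of_rat v)} - {y. y (- g) \<in> B (of_rat t)} \<union> ({y. y (- g) \<in> B (of_rat t)} - {y. y (- g) \<in> A (of_rat v)})
        = {y. y (- g) \<in> D (of_rat v) (of_rat t)}" unfolding D_def by auto
    also have "{y :: 'g \<Rightarrow> 'z. y 0 \<in> A (of_rat u)} \<inter> {y. y (- g) \<in> A (of_rat v)} =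
        {y. rank (law0 \<eta>) (y 0) \<le> of_rat u \<and> rank (law0 \<eta>) (y (- g)) \<le> of_rat v}"
      unfolding A_def l_def by auto
    also have "{y :: 'g \<Rightarrow> 'z. y 0 \<in> B (of_rat s)} \<inter> {y. y (- g) \<in> B (of_rat t)} =
        {y. hcode (y 0) \<le> of_rat s \<and> hcode (y (- g)) \<le> of_rat t}"
      unfolding B_def by auto
    finally show "\<bar>chat \<eta> (g, u, v) - pcdf \<eta> (g, s, t)\<bar> \<le>
       \<bar>measure unif {..of_rat u} - cdf (hlaw (law0 \<eta>)) (of_rat s)\<bar>
       + C * \<bar>measure unif {..of_rat v} - cdf (hlaw (law0 \<eta>)) (of_rat t)\<bar>"
      using D[of "of_rat u" "of_rat s"] D'[of "of_rat v" "of_rat t"]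
      unfolding chat_def pcdf_def l_def by simp
  qed (rule C(1))
qed

text \<open>The threshold 2 lies above all codes, so the second condition in \<open>pcdf\<close> is
  vacuous there.\<close>

lemma cdf_law0_eq_pcdf:
  fixes \<eta> :: "('g::{group_add,countable} \<Rightarrow> 'z::polish_space) measure"
  assumes \<eta>: "\<eta> \<in> P_mu \<mu>" and na: "nonatomic_prob (law0 \<eta>)"
  shows "cdf (hlaw (law0 \<eta>)) (of_rat q) = pcdf \<eta> (0, q, 2)"
proof -
  have "{z :: 'z. hcode z \<le> of_rat q} \<in> sets borel"
    using measurable_sets[OF measurable_hcode, of "{..of_rat q}"] by (simp add: vimage_def)
  from measure_law0[OF \<eta> this] have "cdf (hlaw (law0 \<eta>)) (of_rat q) = measure \<eta> {y. hcode (y 0) \<le> of_rat q}"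
    unfolding cdf_hlaw_eq[OF na] by simp
  moreover have "hcode z \<le> 2" for z :: 'z using hcode_bounds(2)[of z] by simp
  ultimately show ?thesis unfolding pcdf_def by simp
qed

text \<open>Code thresholds \<open>s\<close> and \<open>t\<close> are adapted to the limit measure
  only; convergence of the distribution functions at these two points keeps them nearly right along
  the sequence.\<close>

lemma chat_tendsto:
  fixes \<eta> :: "('g::{group_add,countable} \<Rightarrow> 'z::polish_space) measure"
    and N :: "nat \<Rightarrow> ('g \<Rightarrow> 'z) measure"
  assumes gen: "gen_semigroup (set_pmf \<mu>) = UNIV"
    and N: "\<And>k. N k \<in> P_mu \<mu>" "\<And>k. nonatomic_prob (law0 (N k))" and \<eta>: "\<eta> \<in> P_mu \<mu>" "nonatomic_prob (law0 \<eta>)"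
    and lim: "(\<lambda>k. pcdf (N k)) \<longlonglongrightarrow> pcdf \<eta>"
  shows "(\<lambda>k. chat (N k)) \<longlonglongrightarrow> chat \<eta>"
  unfolding tendsto_fun_iff
proof (intro allI)
  fix i :: "'g \<times> rat \<times> rat"
  obtain g u v where i: "i = (g, u, v)" by (metis prod_cases3)
  obtain C where C: "C > 0" "\<And>\<eta> :: ('g \<Rightarrow> 'z) measure. \<And>u v s t. \<eta> \<in> P_mu \<mu> \<Longrightarrow> nonatomic_prob (law0 \<eta>) \<Longrightarrow>
     \<bar>chat \<eta> (g, u, v) - pcdf \<eta> (g, s, t)\<bar> \<le>
       \<bar>measure unif {..of_rat u} - cdf (hlaw (law0 \<eta>)) (of_rat s)\<bar>
       + C * \<bar>measure unif {..of_rat v} - cdf (hlaw (law0 \<eta>)) (of_rat t)\<bar>"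
    using chat_pcdf_estimate[OF gen, of g] by blast
  have lim': "(\<lambda>k. pcdf (N k) j) \<longlonglongrightarrow> pcdf \<eta> j" for j using lim unfolding tendsto_fun_iff by blast
  interpret U: prob_space unif by (rule prob_space_unif)
  show "(\<lambda>k. chat (N k) i) \<longlonglongrightarrow> chat \<eta> i"
  proof (rule tendstoI)
    fix \<epsilon> :: real assume \<epsilon>: "0 < \<epsilon>"
    \<comment> \<open>The error budget: \<open>2 + 2 * C\<close> for the estimate at
      \<open>N k\<close>, 1 for the convergence of \<open>pcdf\<close>, and \<open>1 + C\<close> for
      the estimate at the limit, in units of \<open>\<delta>\<close>.\<close>
    define \<delta> where "\<delta> = \<epsilon> / (4 + 3 * C)"
    have \<delta>: "\<delta> > 0" "(4 + 3 * C) * \<delta> = \<epsilon>" using \<epsilon> C(1) by (simp_all add: \<delta>_def)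
    obtain s where s: "\<bar>measure unif {..of_rat u} - cdf (hlaw (law0 \<eta>)) (of_rat s)\<bar> < \<delta>"
      using cdf_hlaw_rat_dense[OF \<eta>(2) measure_nonneg U.prob_le_1 \<delta>(1)] by blast
    obtain t where t: "\<bar>measure unif {..of_rat v} - cdf (hlaw (law0 \<eta>)) (of_rat t)\<bar> < \<delta>"
      using cdf_hlaw_rat_dense[OF \<eta>(2) measure_nonneg U.prob_le_1 \<delta>(1)] by blast
    have "\<forall>\<^sub>F k in sequentially. dist (pcdf (N k) (0, s, 2)) (pcdf \<eta> (0, s, 2)) < \<delta>"
      "\<forall>\<^sub>F k in sequentially. dist (pcdf (N k) (0, t, 2)) (pcdf \<eta> (0, t, 2)) < \<delta>"
      "\<forall>\<^sub>F k in sequentially. dist (pcdf (N k) (g, s, t)) (pcdf \<eta> (g, s, t)) < \<delta>"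
      by (rule tendstoD[OF lim' \<delta>(1)])+
    then show "\<forall>\<^sub>F k in sequentially. dist (chat (N k) i) (chat \<eta> i) < \<epsilon>"
    proof eventually_elim
      case (elim k)
      define Fk where "Fk = cdf (hlaw (law0 (N k)))"
      define F where "F = cdf (hlaw (law0 \<eta>))"
      define a where "a = measure unif {..real_of_rat u}"
      define b where "b = measure unif {..real_of_rat v}"
      have 1: "\<bar>Fk (of_rat s) - F (of_rat s)\<bar> < \<delta>" "\<bar>Fk (of_rat t) - F (of_rat t)\<bar> < \<delta>"
        using elim(1,2) unfolding Fk_def F_def cdf_law0_eq_pcdf[OF N(1) N(2)] cdf_law0_eq_pcdf[OF \<eta>] dist_real_def .
      have 2: "\<bar>a - Fk (of_rat s)\<bar> \<le> 2 * \<delta>" "\<bar>b - Fk (of_rat t)\<bar> \<le> 2 * \<delta>"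
        using 1 s t unfolding F_def a_def b_def by linarith+
      have 3: "\<bar>chat (N k) i - pcdf (N k) (g, s, t)\<bar> \<le> 2 * \<delta> + C * (2 * \<delta>)"
        using C(2)[OF N(1) N(2), of k u v s t] 2 mult_left_mono[OF 2(2), of C] C(1)
        unfolding i Fk_def a_def b_def by linarith
      have 4: "\<bar>chat \<eta> i - pcdf \<eta> (g, s, t)\<bar> \<le> \<delta> + C * \<delta>"
        using C(2)[OF \<eta>, of u v s t] s mult_left_mono[OF less_imp_le[OF t], of C] C(1) unfolding i by linarith
      have "\<bar>chat (N k) i - chat \<eta> i\<bar> < 2 * \<delta> + C * (2 * \<delta>) + \<delta> + (\<delta> + C * \<delta>)"
        using 3 4 elim(3) unfolding dist_real_def by linarith
      also have "\<dots> = \<epsilon>" using \<delta>(2) by (simp add: algebra_simps)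
      finally show ?case by (simp add: dist_real_def)
    qed
  qed
qed

lemma iso_tendsto:
  fixes m :: "'z::polish_space measure" and \<nu> :: "'x::polish_space measure"
  assumes \<nu>: "nonatomic_prob \<nu>" and m: "nonatomic_prob m" "\<And>k. nonatomic_prob (N k)"
    and lim: "\<And>t. (\<lambda>k. cdf (hlaw (N k)) t) \<longlonglongrightarrow> cdf (hlaw m) t"
  shows "AE x in \<nu>. (\<lambda>k. iso \<nu> (N k) x) \<longlonglongrightarrow> iso \<nu> m x"
  using AE_rank[OF \<nu> sec_tendsto[OF m lim]] by (simp add: iso_def)

section \<open>Convergence in measure\<close>

text \<open>A pseudometric for convergence in measure; it vanishes between maps that agree almost
  everywhere.\<close>

definition dL :: "'x measure \<Rightarrow> ('x \<Rightarrow> 'z::metric_space) \<Rightarrow> ('x \<Rightarrow> 'z) \<Rightarrow> real" where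
  "dL \<nu> f h = (\<integral>x. min (dist (f x) (h x)) 1 \<partial>\<nu>)"

context prob_space
begin

lemma integrable_min_dist:
  fixes f h :: "'a \<Rightarrow> 'z::polish_space"
  assumes [measurable]: "f \<in> borel_measurable M" "h \<in> borel_measurable M"
  shows "integrable M (\<lambda>x. min (dist (f x) (h x)) 1)"
  by (intro integrable_const_bound[of _ 1]) (auto intro!: AE_I2)

lemma dL_nonneg: "0 \<le> dL M f h"
  unfolding dL_def by (intro Bochner_Integration.integral_nonneg) simp

lemma dL_commute: "dL M f h = dL M h f"
  unfolding dL_def by (simp add: dist_commute)

lemma dL_self [simp]: "dL M f f = 0"
  by (simp add: dL_def)

lemma dL_triangle:
  fixes f g h :: "'a \<Rightarrow> 'z::polish_space"
  assumes m: "f \<in> borel_measurable M" "g \<in> borel_measurable M" "h \<in> borel_measurable M"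
  shows "dL M f h \<le> dL M f g + dL M g h"
proof -
  have "dL M f h \<le> (\<integral>x. min (dist (f x) (g x)) 1 + min (dist (g x) (h x)) 1 \<partial>M)"
    unfolding dL_def
  proof (rule integral_mono)
    show "min (dist (f x) (h x)) 1 \<le> min (dist (f x) (g x)) 1 + min (dist (g x) (h x)) 1" for x
      using dist_triangle[of "f x" "h x" "g x"] zero_le_dist[of "f x" "g x"] zero_le_dist[of "g x" "h x"] by linarith
  qed (use m in \<open>auto intro!: integrable_min_dist Bochner_Integration.integrable_add\<close>)
  also have "\<dots> = dL M f g + dL M g h" unfolding dL_def
    by (rule Bochner_Integration.integral_add) (use m in \<open>auto intro!: integrable_min_dist\<close>)
  finally show ?thesis .
qed

lemma dL_tendsto_0:
  fixes f :: "nat \<Rightarrow> 'a \<Rightarrow> 'z::polish_space"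
  assumes m [measurable]: "\<And>k. f k \<in> borel_measurable M" "h \<in> borel_measurable M"
    and lim: "AE x in M. (\<lambda>k. f k x) \<longlonglongrightarrow> h x"
  shows "(\<lambda>k. dL M (f k) h) \<longlonglongrightarrow> 0"
proof -
  have "(\<lambda>k. \<integral>x. min (dist (f k x) (h x)) 1 \<partial>M) \<longlonglongrightarrow> (\<integral>x. 0 \<partial>M)"
  proof (rule integral_dominated_convergence[where w = "\<lambda>_. 1"])
    show "AE x in M. (\<lambda>k. min (dist (f k x) (h x)) 1) \<longlonglongrightarrow> 0"
      using lim
    proof eventually_elim
      case (elim x)
      have "(\<lambda>k. dist (f k x) (h x)) \<longlonglongrightarrow> 0" using elim by (rule tendsto_dist_iff[THEN iffD1])
      from tendsto_min[OF this tendsto_const[of 1]] show ?case by simp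
    qed
  qed (auto intro!: AE_I2)
  then show ?thesis unfolding dL_def by simp
qed

lemma dL_subseq:
  fixes f :: "nat \<Rightarrow> 'a \<Rightarrow> 'z::polish_space"
  assumes m: "\<And>k. f k \<in> borel_measurable M" "h \<in> borel_measurable M"
    and lim: "(\<lambda>k. dL M (f k) h) \<longlonglongrightarrow> 0"
  shows "\<exists>r :: nat \<Rightarrow> nat. strict_mono r \<and> (AE x in M. (\<lambda>k. f (r k) x) \<longlonglongrightarrow> h x)"
proof -
  have "(\<lambda>k. \<integral>x. norm (min (dist (f k x) (h x)) 1) \<partial>M) \<longlonglongrightarrow> 0" using lim unfolding dL_def by simp
  from tendsto_L1_AE_subseq[OF integrable_min_dist[OF m] this]
  obtain r :: "nat \<Rightarrow> nat" where r: "strict_mono r" "AE x in M. (\<lambda>k. min (dist (f (r k) x) (h x)) 1) \<longlonglongrightarrow> 0" by blast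
  have "AE x in M. (\<lambda>k. f (r k) x) \<longlonglongrightarrow> h x"
    using r(2)
  proof eventually_elim
    case (elim x)
    have "\<forall>\<^sub>F k in sequentially. min (dist (f (r k) x) (h x)) 1 < 1" by (rule order_tendstoD(2)[OF elim]) simp
    then have "\<forall>\<^sub>F k in sequentially. min (dist (f (r k) x) (h x)) 1 = dist (f (r k) x) (h x)"
      by eventually_elim auto
    then have "(\<lambda>k. dist (f (r k) x) (h x)) \<longlonglongrightarrow> 0" using elim by (rule Lim_transform_eventually[rotated])
    then show ?case by (rule tendsto_dist_iff[THEN iffD2])
  qed
  then show ?thesis using r(1) by blast
qed

text \<open>By Markov's inequality a step of mean \<open>(1/4)^k\<close> exceeds
  \<open>(1/2)^k\<close> with probability at most \<open>(1/2)^k\<close>. Borel-Cantelli then makes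
  almost every trajectory Cauchy with geometric steps.\<close>

lemma dL_complete:
  fixes f :: "nat \<Rightarrow> 'a \<Rightarrow> 'z::polish_space"
  assumes m [measurable]: "\<And>k. f k \<in> borel_measurable M"
    and lim: "\<And>k. dL M (f k) (f (Suc k)) \<le> (1/4)^k"
  shows "\<exists>h. h \<in> borel_measurable M \<and> (AE x in M. (\<lambda>k. f k x) \<longlonglongrightarrow> h x)"
proof -
  define u where "u k x = min (dist (f k x) (f (Suc k) x)) 1" for k x
  have ui: "integrable M (u k)" for k unfolding u_def by (rule integrable_min_dist) measurable
  define A where "A k = {x\<in>space M. (1/2)^k \<le> u k x}" for k
  have Am: "A k \<in> sets M" for k unfolding A_def u_def by measurable
  have A: "measure M (A k) \<le> (1/2)^k" for k
  proof -
    have "measure M (A k) \<le> (\<integral>x. u k x \<partial>M) / (1/2)^k"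
      unfolding A_def by (rule integral_Markov_inequality_measure[where A = "space M", OF ui]) (auto simp: u_def)
    also have "\<dots> \<le> (1/4)^k / (1/2)^k" using lim[of k] unfolding dL_def u_def by (intro divide_right_mono) auto
    also have "\<dots> = (1/2)^k" by (simp add: power_divide power_mult_distrib[symmetric] field_simps)
    finally show ?thesis .
  qed
  have "AE x in M. eventually (\<lambda>k. x \<in> space M - A k) sequentially"
  proof (rule borel_cantelli_AE1[OF Am])
    show "summable (\<lambda>k. measure M (A k))"
      by (rule summable_comparison_test'[of "\<lambda>k. (1/2)^k"]) (use A in \<open>auto simp: summable_geometric_iff\<close>)
  qed (simp add: emeasure_eq_measure)
  then have conv: "AE x in M. Cauchy (\<lambda>k. f k x)"
  proof eventually_elim
    case (elim x)
    then obtain n where n: "\<And>k. k \<ge> n \<Longrightarrow> x \<in> space M - A k" by (auto simp: eventually_sequentially)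
    have step: "dist (f k x) (f (Suc k) x) < (1/2)^k" if "k \<ge> n" for k
    proof -
      have "u k x < (1/2)^k" using n[OF that] by (auto simp: A_def)
      moreover have "(1/2::real)^k \<le> 1" by (simp add: power_le_one)
      ultimately show ?thesis unfolding u_def by linarith
    qed
    have far: "dist (f k x) (f (k + j) x) \<le> 2 * (1/2)^k - 2 * (1/2)^(k + j)" if "k \<ge> n" for k j
    proof (induction j)
      case (Suc j)
      have "dist (f k x) (f (k + Suc j) x) \<le> dist (f k x) (f (k + j) x) + dist (f (k + j) x) (f (Suc (k + j)) x)"
        using dist_triangle[of "f k x" "f (k + Suc j) x" "f (k + j) x"] by simp
      also have "\<dots> \<le> 2 * (1/2)^k - 2 * (1/2)^(k + j) + (1/2)^(k + j)"
        using Suc step[of "k + j"] that by simp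
      also have "\<dots> = 2 * (1/2)^k - 2 * (1/2)^(k + Suc j)" by simp
      finally show ?case .
    qed simp
    show ?case
    proof (rule metric_CauchyI)
      fix e :: real assume "0 < e"
      then obtain p where p: "(1/2::real)^p < e / 4" using real_arch_pow_inv[of "e/4" "1/2"] by auto
      define q where "q = max n p"
      have q: "2 * (1/2::real)^q < e / 2"
      proof -
        have "(1/2::real)^q \<le> (1/2)^p" by (rule power_decreasing) (auto simp: q_def)
        then show ?thesis using p by linarith
      qed
      have "dist (f k x) (f q x) < e / 2" if "k \<ge> q" for k
      proof -
        have "dist (f q x) (f (q + (k - q)) x) \<le> 2 * (1/2)^q - 2 * (1/2)^(q + (k - q))"
          by (rule far) (simp add: q_def)
        moreover have "0 < 2 * (1/2::real)^(q + (k - q))" by simp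
        ultimately have "dist (f q x) (f (q + (k - q)) x) < e / 2" using q by linarith
        then show ?thesis using that by (simp add: dist_commute)
      qed
      then show "\<exists>M. \<forall>m\<ge>M. \<forall>n\<ge>M. dist (f m x) (f n x) < e"
        by (intro exI[of _ q]) (meson dist_triangle_half_l)
    qed
  qed
  define h where "h x = (if Cauchy (\<lambda>k. f k x) then lim (\<lambda>k. f k x) else undefined)" for x
  have "h \<in> borel_measurable M" unfolding h_def by (rule borel_measurable_lim_polish) measurable
  moreover have "AE x in M. (\<lambda>k. f k x) \<longlonglongrightarrow> h x"
    using conv by eventually_elim (auto simp: h_def dest: Cauchy_convergent simp: convergent_LIMSEQ_iff)
  ultimately show ?thesis by blast
qed

text \<open>The Baire category theorem for the complete pseudometric \<^term>\<open>dL M\<close>, for sets that are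
  open in the whole space but dense only in a subspace \<^term>\<open>S\<close>.\<close>

lemma dL_baire:
  fixes S :: "('a \<Rightarrow> 'z::polish_space) set"
  assumes S: "f0 \<in> S" "\<And>f. f \<in> S \<Longrightarrow> f \<in> borel_measurable M"
    and op: "\<And>k f. f \<in> W k \<Longrightarrow> f \<in> borel_measurable M \<Longrightarrow>
      \<exists>\<delta>>0. \<forall>h. h \<in> borel_measurable M \<longrightarrow> dL M f h < \<delta> \<longrightarrow> h \<in> W k"
    and dense: "\<And>(k :: nat) f \<epsilon>. f \<in> S \<Longrightarrow> \<epsilon> > 0 \<Longrightarrow> \<exists>h\<in>S. h \<in> W k \<and> dL M f h < \<epsilon>"
  shows "\<exists>F f. (\<forall>k. F k \<in> S) \<and> f \<in> borel_measurable M \<and> (AE x in M. (\<lambda>k. F k x) \<longlonglongrightarrow> f x) \<and> (\<forall>k. f \<in> W k)"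
proof -
  \<comment> \<open>A state is a centre in \<open>S\<close> with a radius. The bound
    \<open>(1/4)^k\<close> feeds \<open>dL_complete\<close>; moving by less than a quarter of the
    radius and then halving it keeps all later centres within half the radius, so the limit lies
    strictly inside every ball.\<close>
  define P where "P k p \<longleftrightarrow> fst p \<in> S \<and> 0 < snd p \<and> snd p \<le> (1/4)^k" for k :: nat and p :: "('a \<Rightarrow> 'z) \<times> real"
  define Q where "Q k p q \<longleftrightarrow> dL M (fst p) (fst q) < snd p / 4 \<and> snd q \<le> snd p / 2 \<and>
     (\<forall>h. h \<in> borel_measurable M \<longrightarrow> dL M (fst q) h < snd q \<longrightarrow> h \<in> W k)" for k and p q :: "('a \<Rightarrow> 'z) \<times> real"
  have "\<exists>p. \<forall>k. P k (p k) \<and> Q k (p k) (p (Suc k))"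
  proof (rule dependent_nat_choice)
    show "\<exists>p. P 0 p" using S(1) by (intro exI[of _ "(f0, 1)"]) (simp add: P_def)
    fix p k assume p: "P k p"
    then obtain h where h: "h \<in> S" "h \<in> W k" "dL M (fst p) h < snd p / 4"
      using dense[of "fst p" "snd p / 4" k] unfolding P_def by auto
    obtain \<delta> where \<delta>: "\<delta> > 0" "\<And>h'. h' \<in> borel_measurable M \<Longrightarrow> dL M h h' < \<delta> \<Longrightarrow> h' \<in> W k"
      using op[OF h(2) S(2)[OF h(1)]] by blast
    define r where "r = Min {\<delta>, snd p / 2, (1/4)^Suc k}"
    have r: "0 < r" "r \<le> \<delta>" "r \<le> snd p / 2" "r \<le> (1/4)^Suc k" using \<delta>(1) p by (auto simp: r_def P_def)
    have "P (Suc k) (h, r)" using h r by (simp add: P_def)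
    moreover have "Q k p (h, r)" using h(3) r \<delta>(2) unfolding Q_def by auto
    ultimately show "\<exists>q. P (Suc k) q \<and> Q k p q" by blast
  qed
  then obtain p where p: "\<And>k. P k (p k)" "\<And>k. Q k (p k) (p (Suc k))" by blast
  define F where "F k = fst (p k)" for k
  define r where "r k = snd (p k)" for k
  have FS: "F k \<in> S" and r: "0 < r k" "r k \<le> (1/4)^k" for k using p(1)[of k] by (auto simp: P_def F_def r_def)
  have step: "dL M (F k) (F (Suc k)) < r k / 4" "r (Suc k) \<le> r k / 2"
    "\<And>h. h \<in> borel_measurable M \<Longrightarrow> dL M (F (Suc k)) h < r (Suc k) \<Longrightarrow> h \<in> W k" for k
    using p(2)[of k] by (auto simp: Q_def F_def r_def)
  note Fm = S(2)[OF FS]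
  have far: "dL M (F k) (F (k + j)) \<le> r k / 2" for k j
  proof (induction j arbitrary: k)
    case 0
    show ?case using r(1)[of k] by simp
  next
    case (Suc j)
    have "dL M (F k) (F (k + Suc j)) \<le> dL M (F k) (F (Suc k)) + dL M (F (Suc k)) (F (Suc k + j))"
      using dL_triangle[OF Fm Fm Fm, of k "k + Suc j" "Suc k"] by simp
    also have "\<dots> \<le> r k / 4 + r (Suc k) / 2" using step(1)[of k] Suc[of "Suc k"] by simp
    also have "\<dots> \<le> r k / 2" using step(2)[of k] by simp
    finally show ?case .
  qed
  have "dL M (F k) (F (Suc k)) \<le> (1/4)^k" for k using step(1)[of k] r[of k] by linarith
  from dL_complete[OF Fm this] obtain f where f: "f \<in> borel_measurable M" "AE x in M. (\<lambda>k. F k x) \<longlonglongrightarrow> f x" by blast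
  have lim: "(\<lambda>k. dL M (F k) f) \<longlonglongrightarrow> 0" by (rule dL_tendsto_0[OF Fm f])
  have "dL M (F k) f \<le> r k / 2" for k
  proof (rule LIMSEQ_le_const)
    show "(\<lambda>j. r k / 2 + dL M (F (j + k)) f) \<longlonglongrightarrow> r k / 2"
      using tendsto_add[OF tendsto_const LIMSEQ_ignore_initial_segment[OF lim, of k], of "r k / 2"] by simp
    have "dL M (F k) f \<le> r k / 2 + dL M (F (j + k)) f" for j
      using dL_triangle[OF Fm Fm f(1), of k "k + j"] far[of k j] by (simp add: add.commute)
    then show "\<exists>N. \<forall>j\<ge>N. dL M (F k) f \<le> r k / 2 + dL M (F (j + k)) f" by blast
  qed
  then have "dL M (F (Suc k)) f < r (Suc k)" for k using r(1)[of "Suc k"] by (smt (verit) field_sum_of_halves)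
  then have "f \<in> W k" for k by (rule step(3)[OF f(1)])
  then show ?thesis using FS f by blast
qed

end

section \<open>Transfer of residual sets\<close>

lemma measurable_iso':
  fixes m :: "'z::polish_space measure" and \<nu> :: "'x::polish_space measure"
  shows "nonatomic_prob \<nu> \<Longrightarrow> nonatomic_prob m \<Longrightarrow> iso \<nu> m \<in> borel_measurable \<nu>"
  using measurable_iso by (simp add: measurable_nonatomic_prob)

text \<open>Neighbourhoods in the space of measures are compared with the metric-valued map
  \<open>pcdf\<close>, so failure would produce a sequence of good-law measures along which
  \<open>pcdf\<close> converges. That alone forces convergence of \<open>chat\<close>, and of the
  zeroth distribution functions, hence of the isomorphisms in measure.\<close>

lemma good_neighborhood:
  fixes \<eta> :: "('g::{group_add,countable} \<Rightarrow> 'z::polish_space) measure" and \<nu> :: "'x::polish_space measure"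
  assumes gen: "gen_semigroup (set_pmf \<mu>) = UNIV" and \<nu>: "nonatomic_prob \<nu>"
    and \<eta>: "\<eta> \<in> P_mu \<mu>" and good: "good_law (law0 \<eta>)" and W: "open W" "chat \<eta> \<in> W" and \<epsilon>: "\<epsilon> > 0"
  shows "\<exists>N. openin (P_mu_topology \<mu>) N \<and> \<eta> \<in> N \<and> (\<forall>\<zeta>\<in>N. good_law (law0 \<zeta>) \<longrightarrow>
     chat \<zeta> \<in> W \<and> dL \<nu> (iso \<nu> (law0 \<eta>)) (iso \<nu> (law0 \<zeta>)) < \<epsilon>)"
proof (rule ccontr)
  assume no: "\<not> ?thesis"
  interpret prob_space \<nu> using \<nu> unfolding nonatomic_prob_def by blast
  have na: "nonatomic_prob (law0 \<eta>)" using good unfolding good_law_def by blast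
  have \<eta>': "\<eta> \<in> topspace (P_mu_topology \<mu>)" using \<eta> by (simp add: topspace_P_mu_topology)
  have "\<exists>\<zeta>. \<zeta> \<in> P_mu \<mu> \<and> good_law (law0 \<zeta>) \<and> dist (pcdf \<zeta>) (pcdf \<eta>) < 1 / real (Suc k) \<and>
     \<not> (chat \<zeta> \<in> W \<and> dL \<nu> (iso \<nu> (law0 \<eta>)) (iso \<nu> (law0 \<zeta>)) < \<epsilon>)" for k
  proof -
    have "\<forall>\<^sub>F \<zeta> in nhdsin (P_mu_topology \<mu>) \<eta>. dist (pcdf \<zeta>) (pcdf \<eta>) < 1 / real (Suc k)"
      by (rule tendstoD[OF pcdf_tendsto[OF gen \<eta> good]]) simp
    then obtain N where N: "openin (P_mu_topology \<mu>) N" "\<eta> \<in> N" "\<And>\<zeta>. \<zeta> \<in> N \<Longrightarrow> dist (pcdf \<zeta>) (pcdf \<eta>) < 1 / real (Suc k)"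
      using \<eta>' unfolding eventually_nhdsin by blast
    then obtain \<zeta> where "\<zeta> \<in> N" "good_law (law0 \<zeta>)" "\<not> (chat \<zeta> \<in> W \<and> dL \<nu> (iso \<nu> (law0 \<eta>)) (iso \<nu> (law0 \<zeta>)) < \<epsilon>)"
      using no by blast
    moreover have "\<zeta> \<in> P_mu \<mu>" using openin_subset[OF N(1)] calculation(1) by (auto simp: topspace_P_mu_topology)
    ultimately show ?thesis using N(3) by blast
  qed
  then have "\<forall>k. \<exists>\<zeta>. \<zeta> \<in> P_mu \<mu> \<and> good_law (law0 \<zeta>) \<and> dist (pcdf \<zeta>) (pcdf \<eta>) < 1 / real (Suc k) \<and>
     \<not> (chat \<zeta> \<in> W \<and> dL \<nu> (iso \<nu> (law0 \<eta>)) (iso \<nu> (law0 \<zeta>)) < \<epsilon>)" by blast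
  from choice[OF this] obtain Z where Z: "\<And>k. Z k \<in> P_mu \<mu>" "\<And>k. good_law (law0 (Z k))"
    "\<And>k. dist (pcdf (Z k)) (pcdf \<eta>) < 1 / real (Suc k)"
    "\<And>k. \<not> (chat (Z k) \<in> W \<and> dL \<nu> (iso \<nu> (law0 \<eta>)) (iso \<nu> (law0 (Z k))) < \<epsilon>)" by blast
  have Zna: "nonatomic_prob (law0 (Z k))" for k using Z(2) unfolding good_law_def by blast
  have lim: "(\<lambda>k. pcdf (Z k)) \<longlonglongrightarrow> pcdf \<eta>"
  proof (rule metric_tendsto_imp_tendsto[OF LIMSEQ_inverse_real_of_nat])
    show "\<forall>\<^sub>F k in sequentially. dist (pcdf (Z k)) (pcdf \<eta>) \<le> dist (inverse (real (Suc k))) 0"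
      using Z(3) by (intro always_eventually) (simp add: inverse_eq_divide less_imp_le)
  qed
  have "\<forall>\<^sub>F k in sequentially. chat (Z k) \<in> W"
    using topological_tendstoD[OF chat_tendsto[OF gen Z(1) Zna \<eta> na lim] W] .
  moreover have "\<forall>\<^sub>F k in sequentially. dL \<nu> (iso \<nu> (law0 \<eta>)) (iso \<nu> (law0 (Z k))) < \<epsilon>"
  proof -
    have "(\<lambda>k. cdf (hlaw (law0 (Z k))) t) \<longlonglongrightarrow> cdf (hlaw (law0 \<eta>)) t" for t
    proof (rule cdf_tendsto_of_rationals)
      fix q :: real assume "q \<in> \<rat>"
      then obtain q' where q: "q = of_rat q'" by (auto elim: Rats_cases)
      show "(\<lambda>k. cdf (hlaw (law0 (Z k))) q) \<longlonglongrightarrow> cdf (hlaw (law0 \<eta>)) q"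
        unfolding q cdf_law0_eq_pcdf[OF \<eta> na] cdf_law0_eq_pcdf[OF Z(1) Zna]
        using lim unfolding tendsto_fun_iff by blast
    qed (rule real_distribution_hlaw[OF na] real_distribution_hlaw[OF Zna] isCont_cdf_hlaw[OF na])+
    from iso_tendsto[OF \<nu> na Zna this]
    have "(\<lambda>k. dL \<nu> (iso \<nu> (law0 (Z k))) (iso \<nu> (law0 \<eta>))) \<longlonglongrightarrow> 0"
      by (rule dL_tendsto_0[OF measurable_iso'[OF \<nu> Zna] measurable_iso'[OF \<nu> na]])
    then have "\<forall>\<^sub>F k in sequentially. dL \<nu> (iso \<nu> (law0 (Z k))) (iso \<nu> (law0 \<eta>)) < \<epsilon>"
      using \<epsilon> by (rule order_tendstoD(2))
    then show ?thesis by (simp add: dL_commute)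
  qed
  ultimately have "\<forall>\<^sub>F k in sequentially. False"
    by eventually_elim (use Z(4) in blast)
  then show False by simp
qed

text \<open>The dense open sets of actions are described by open sets \<open>W n\<close> of
  coordinates, and \<open>chat\<close> transports these conditions to measures. For density the law
  of a good measure is frozen and only its action is moved into \<open>U n\<close>.\<close>

lemma residual_P_mu_of_A_mu:
  fixes \<mu> :: "'g::{group_add,countable} pmf" and \<nu> :: "'x::polish_space measure"
  assumes gen: "gen_semigroup (set_pmf \<mu>) = UNIV" and \<nu>: "nonatomic_prob \<nu>"
    and S: "residual_in (A_mu_topology \<mu> \<nu>) S"
  shows "residual_in (P_mu_topology \<mu>)
    {\<eta> :: ('g \<Rightarrow> 'z::{polish_space,perfect_space}) measure. nonatomic_prob (law0 \<eta>) \<and>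
       (\<exists>a\<in>S. stat_action \<mu> \<nu> a \<and> orb_law \<nu> a (iso \<nu> (law0 \<eta>)) = \<eta>)}" (is "residual_in _ ?R")
proof -
  have "prob_space \<nu>" using \<nu> unfolding nonatomic_prob_def by blast
  note A = A_mu_iff[OF gen this]
  obtain U where U: "\<And>n :: nat. openin (A_mu_topology \<mu> \<nu>) (U n)"
    "\<And>n. A_mu_topology \<mu> \<nu> closure_of U n = topspace (A_mu_topology \<mu> \<nu>)" "(\<Inter>n. U n) \<subseteq> S"
    using S unfolding residual_in_def by blast
  have "\<forall>n. \<exists>W. open W \<and> U n = acoord \<nu> -` W \<inter> A_mu \<mu> \<nu>"
    using U(1) unfolding A_mu_topology_eq[OF gen \<nu>] openin_pullback_topology by simp
  then obtain W where W: "\<And>n. open (W n)" "\<And>n. U n = acoord \<nu> -` W n \<inter> A_mu \<mu> \<nu>" by metis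
  \<comment> \<open>Control of \<open>chat\<close> is available only among measures with good laws,
    so the preimage of \<open>W n\<close> is replaced by the largest open set all of whose members
    with good law satisfy the condition.\<close>
  define T where "T n = \<Union>{N :: ('g \<Rightarrow> 'z) measure set. openin (P_mu_topology \<mu>) N \<and>
     (\<forall>\<zeta>\<in>N. good_law (law0 \<zeta>) \<longrightarrow> chat \<zeta> \<in> W n)}" for n
  have To: "openin (P_mu_topology \<mu>) (T n)" for n unfolding T_def by (rule openin_Union) blast
  have Td: "P_mu_topology \<mu> closure_of T n = topspace (P_mu_topology \<mu>)" for n
  proof (subst closure_of_eq_topspace_iff[OF openin_subset[OF To]], intro allI impI)
    fix X :: "('g \<Rightarrow> 'z) measure set" assume X: "openin (P_mu_topology \<mu>) X" "X \<noteq> {}"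
    obtain \<eta> where \<eta>: "\<eta> \<in> X" "\<eta> \<in> Good \<mu> \<nu>" using Good_dense[OF gen \<nu> X] by blast
    define l where "l = law0 \<eta>"
    have l: "good_law l" using \<eta>(2) unfolding Good_def l_def by blast
    then have na: "nonatomic_prob l" unfolding good_law_def by blast
    obtain a where a: "stat_action \<mu> \<nu> a" "orb_law \<nu> a (iso \<nu> l) = \<eta>"
      using \<eta>(2) unfolding Good_def l_def by blast
    have cont: "continuous_map (A_mu_topology \<mu> \<nu>) (P_mu_topology \<mu>) (\<lambda>a. orb_law \<nu> a (iso \<nu> l))"
      by (rule continuous_map_orb_law[OF gen \<nu> measurable_iso[OF \<nu> na]])
    \<comment> \<open>The actions whose orbit law, with the observing function held fixed, stays in
      \<open>X\<close>; this is open and nonempty, so it meets the dense set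
      \<open>U n\<close>.\<close>
    define V where "V = {a \<in> topspace (A_mu_topology \<mu> \<nu>). orb_law \<nu> a (iso \<nu> l) \<in> X}"
    have "openin (A_mu_topology \<mu> \<nu>) V" unfolding V_def by (rule openin_continuous_map_preimage[OF cont X(1)])
    moreover have "a \<in> V" unfolding V_def using a \<eta>(1) A by (simp add: topspace_A_mu_topology)
    ultimately obtain b where b: "b \<in> V" "b \<in> U n"
      using U(2)[of n] closure_of_eq_topspace_iff[OF openin_subset[OF U(1)], of n] by blast
    have bs: "stat_action \<mu> \<nu> b" using b(1) A unfolding V_def by (simp add: topspace_A_mu_topology)
    define \<zeta> where "\<zeta> = orb_law \<nu> b (iso \<nu> l)"
    have \<zeta>: "law0 \<zeta> = l" "chat \<zeta> = acoord \<nu> b" "\<zeta> \<in> X" "\<zeta> \<in> P_mu \<mu>"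
      using acoord_eq_chat[OF gen \<nu> bs na] b(1) orb_law_in_P_mu[OF bs measurable_iso'[OF \<nu> na]]
      unfolding \<zeta>_def V_def by auto
    have "chat \<zeta> \<in> W n" using b(2) unfolding \<zeta>(2) W(2) by blast
    then obtain N where "openin (P_mu_topology \<mu>) N" "\<zeta> \<in> N" "\<forall>\<xi>\<in>N. good_law (law0 \<xi>) \<longrightarrow> chat \<xi> \<in> W n"
      using good_neighborhood[OF gen \<nu> \<zeta>(4) _ W(1), of n 1] l unfolding \<zeta>(1) by auto
    then have "\<zeta> \<in> T n" unfolding T_def by blast
    then show "X \<inter> T n \<noteq> {}" using \<zeta>(3) by blast
  qed
  have "residual_in (P_mu_topology \<mu>) ((\<Inter>n. T n) \<inter> Good \<mu> \<nu>)"
    by (intro residual_in_Int residual_in_INT To Td residual_Good[OF gen \<nu>])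
  moreover have "(\<Inter>n. T n) \<inter> Good \<mu> \<nu> \<subseteq> ?R"
  proof
    fix \<eta> assume \<eta>: "\<eta> \<in> (\<Inter>n. T n) \<inter> Good \<mu> \<nu>"
    then have l: "good_law (law0 \<eta>)" unfolding Good_def by blast
    then have na: "nonatomic_prob (law0 \<eta>)" unfolding good_law_def by blast
    obtain a where a: "stat_action \<mu> \<nu> a" "orb_law \<nu> a (iso \<nu> (law0 \<eta>)) = \<eta>"
      using \<eta> unfolding Good_def by blast
    have c: "acoord \<nu> a = chat \<eta>" using acoord_eq_chat(2)[OF gen \<nu> a(1) na] unfolding a(2) .
    have "a \<in> U n" for n
    proof -
      have "\<eta> \<in> T n" using \<eta> by blast
      then have "chat \<eta> \<in> W n" unfolding T_def using l by blast
      then show ?thesis unfolding W(2) using c a(1) A by simp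
    qed
    then have "a \<in> S" using U(3) by blast
    then show "\<eta> \<in> ?R" using na a by blast
  qed
  ultimately show ?thesis by (rule residual_in_mono)
qed

text \<open>The limit avoids the frontiers almost everywhere, so the codes converge as well, and
  with them the distribution functions of the laws. Hence the isomorphisms converge also to the
  isomorphism for the limit law, and almost everywhere limits are unique.\<close>

lemma limit_of_isos:
  fixes f :: "'x::polish_space \<Rightarrow> 'z::polish_space"
  assumes \<nu>: "nonatomic_prob \<nu>" and m: "\<And>k. nonatomic_prob (m k)" and f: "f \<in> borel_measurable \<nu>"
    and good: "good_law (distr \<nu> borel f)" and lim: "AE x in \<nu>. (\<lambda>k. iso \<nu> (m k) x) \<longlonglongrightarrow> f x"
  shows "AE x in \<nu>. f x = iso \<nu> (distr \<nu> borel f) x"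
proof -
  interpret prob_space \<nu> using \<nu> unfolding nonatomic_prob_def by blast
  define l where "l = distr \<nu> borel f"
  have na: "nonatomic_prob l" using good unfolding good_law_def l_def by blast
  note [measurable] = f measurable_iso'[OF \<nu> m]
  have c: "cdf (hlaw (distr \<nu> borel F)) t = (\<integral>x. indicator {..t} (hcode (F x)) \<partial>\<nu>)"
    if F [measurable]: "F \<in> borel_measurable \<nu>" and "nonatomic_prob (distr \<nu> borel F)" for F :: "'x \<Rightarrow> 'z" and t
  proof -
    have "{z :: 'z. hcode z \<le> t} \<in> sets borel"
      using measurable_sets[OF measurable_hcode, of "{..t}"] by (simp add: vimage_def)
    then have "cdf (hlaw (distr \<nu> borel F)) t = measure \<nu> {x\<in>space \<nu>. hcode (F x) \<le> t}"
      unfolding cdf_hlaw_eq[OF that(2)] by (subst measure_distr[OF F]) (auto intro!: arg_cong[where f = "measure \<nu>"])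
    also have "\<dots> = (\<integral>x. indicator {x\<in>space \<nu>. hcode (F x) \<le> t} x \<partial>\<nu>)" by simp
    also have "\<dots> = (\<integral>x. indicator {..t} (hcode (F x)) \<partial>\<nu>)"
      by (rule Bochner_Integration.integral_cong) (auto split: split_indicator)
    finally show ?thesis .
  qed
  have fr: "AE x in \<nu>. f x \<notin> frontiers" by (rule AE_distrD[OF f good_law_AE[OF good]])
  have "(\<lambda>k. cdf (hlaw (m k)) t) \<longlonglongrightarrow> cdf (hlaw l) t" for t
  proof -
    have "AE u in hlaw l. u \<notin> {t}"
    proof (rule AE_not_in)
      interpret h: prob_space "hlaw l" using real_distribution_hlaw[OF na] by (simp add: real_distribution_def)
      show "{t} \<in> null_sets (hlaw l)"
        using measure_hlaw_singleton[OF na, of t] by (intro null_setsI) (simp_all add: h.emeasure_eq_measure, simp add: hlaw_def)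
    qed
    then have "AE z in l. hcode z \<noteq> t"
      unfolding hlaw_def using AE_distrD[of hcode l borel] by (simp add: measurable_nonatomic_prob[OF na])
    then have ne: "AE x in \<nu>. hcode (f x) \<noteq> t" unfolding l_def by (rule AE_distrD[OF f])
    have "(\<lambda>k. \<integral>x. indicator {..t} (hcode (iso \<nu> (m k) x)) \<partial>\<nu>) \<longlonglongrightarrow> (\<integral>x. indicator {..t} (hcode (f x)) \<partial>\<nu> :: real)"
    proof (rule integral_dominated_convergence[where w = "\<lambda>_. 1"])
      show "AE x in \<nu>. (\<lambda>k. indicator {..t} (hcode (iso \<nu> (m k) x)) :: real) \<longlonglongrightarrow> indicator {..t} (hcode (f x))"
        using fr ne lim
      proof eventually_elim
        case (elim x)
        have h: "(\<lambda>k. hcode (iso \<nu> (m k) x)) \<longlonglongrightarrow> hcode (f x)"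
          by (rule isCont_tendsto_compose[OF isCont_hcode[OF elim(1)] elim(3)])
        consider "hcode (f x) < t" | "hcode (f x) > t" using elim(2) by linarith
        then have "\<forall>\<^sub>F k in sequentially. indicator {..t} (hcode (iso \<nu> (m k) x)) = (indicator {..t} (hcode (f x)) :: real)"
        proof cases
          case 1
          show ?thesis using order_tendstoD(2)[OF h 1] by eventually_elim (use 1 in simp)
        next
          case 2
          show ?thesis using order_tendstoD(1)[OF h 2] by eventually_elim (use 2 in simp)
        qed
        then show ?case by (rule tendsto_eventually)
      qed
    qed (auto intro!: AE_I2 split: split_indicator)
    then show ?thesis
      using c[OF f, folded l_def, OF na] c[OF measurable_iso'[OF \<nu> m], unfolded distr_iso[OF \<nu> m], OF m] by simp
  qed
  from iso_tendsto[OF \<nu> na m this] have "AE x in \<nu>. (\<lambda>k. iso \<nu> (m k) x) \<longlonglongrightarrow> iso \<nu> l x" .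
  then show ?thesis using lim unfolding l_def by eventually_elim (rule LIMSEQ_unique)
qed

text \<open>A single observing function \<open>f\<close> is found for which every condition
  \<open>U n\<close> is met by actions in each basic open set. The actions satisfying all conditions
  for this \<open>f\<close> are then residual, and \<open>f\<close> turns out to be injective almost
  everywhere.\<close>

lemma residual_A_mu_of_P_mu:
  fixes \<mu> :: "'g::{group_add,countable} pmf" and \<nu> :: "'x::polish_space measure"
    and S :: "('g \<Rightarrow> 'z::{polish_space,perfect_space}) measure set"
  assumes gen: "gen_semigroup (set_pmf \<mu>) = UNIV" and \<nu>: "nonatomic_prob \<nu>"
    and S: "residual_in (P_mu_topology \<mu>) S"
  shows "residual_in (A_mu_topology \<mu> \<nu>) {a. stat_action \<mu> \<nu> a \<and>
    (\<exists>f e. f \<in> borel_measurable \<nu> \<and> e \<in> measurable borel \<nu> \<and> (AE x in \<nu>. e (f x) = x) \<and> orb_law \<nu> a f \<in> S)}"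
    (is "residual_in _ ?R")
proof -
  interpret prob_space \<nu> using \<nu> unfolding nonatomic_prob_def by blast
  note A = A_mu_iff[OF gen prob_space_axioms]
  obtain U where U: "\<And>n :: nat. openin (P_mu_topology \<mu>) (U n)"
    "\<And>n. P_mu_topology \<mu> closure_of U n = topspace (P_mu_topology \<mu>)" "(\<Inter>n. U n) \<subseteq> S \<inter> Good \<mu> \<nu>"
    using residual_in_Int[OF S residual_Good[OF gen \<nu>]] unfolding residual_in_def by blast
  define V where "V m = {a. stat_action \<mu> \<nu> a \<and> acoord \<nu> a \<in> base_set m}" for m
  \<comment> \<open>The index \<open>k\<close> encodes a condition \<open>n\<close> together with a
    basic set \<open>j\<close> of actions. An empty basic set imposes nothing; otherwise some action
    in it must meet condition \<open>n\<close> with \<open>f\<close> as observing function.\<close>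
  define W where "W k = {f :: 'x \<Rightarrow> 'z. V (snd (prod_decode k)) = {} \<or>
     (\<exists>a\<in>V (snd (prod_decode k)). orb_law \<nu> a f \<in> U (fst (prod_decode k)))}" for k
  \<comment> \<open>Isomorphisms onto good laws: the subspace in which density is available. The
    conditions \<open>W k\<close> are open in all measurable maps, which is where the limit has to
    be taken.\<close>
  define M where "M = {iso \<nu> m | m :: 'z measure. good_law m}"
  have M: "f \<in> borel_measurable \<nu>" if "f \<in> M" for f
    using that measurable_iso'[OF \<nu>] unfolding M_def good_law_def by blast
  obtain f0 where f0: "f0 \<in> M"
  proof -
    obtain F :: "nat \<Rightarrow> 'x \<Rightarrow> 'z" where "\<And>k. embeds (F k)" using embeds_dense[of "\<lambda>_. undefined"] by auto
    then have "good_law (distr \<nu> borel (F 0))" by (rule good_law_embeds[OF \<nu>])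
    then show thesis using that unfolding M_def by blast
  qed
  have op: "\<exists>\<delta>>0. \<forall>h. h \<in> borel_measurable \<nu> \<longrightarrow> dL \<nu> f h < \<delta> \<longrightarrow> h \<in> W k"
    if f: "f \<in> W k" "f \<in> borel_measurable \<nu>" for f k
  proof (rule ccontr)
    assume no: "\<not> ?thesis"
    have ne: "V (snd (prod_decode k)) \<noteq> {}"
    proof
      assume "V (snd (prod_decode k)) = {}"
      then have "W k = UNIV" unfolding W_def by simp
      moreover have "(0::real) < 1" by simp
      ultimately show False using no by blast
    qed
    then obtain a where a: "a \<in> V (snd (prod_decode k))" "orb_law \<nu> a f \<in> U (fst (prod_decode k))"
      using f(1) unfolding W_def by blast
    have "\<forall>j. \<exists>h. h \<in> borel_measurable \<nu> \<and> dL \<nu> f h < inverse (real (Suc j)) \<and> h \<notin> W k"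
    proof
      fix j :: nat
      have "inverse (real (Suc j)) > 0" by simp
      then show "\<exists>h. h \<in> borel_measurable \<nu> \<and> dL \<nu> f h < inverse (real (Suc j)) \<and> h \<notin> W k" using no by blast
    qed
    from choice[OF this] obtain h where h: "\<And>j. h j \<in> borel_measurable \<nu>" "\<And>j. dL \<nu> f (h j) < inverse (real (Suc j))"
      "\<And>j. h j \<notin> W k" by blast
    have "(\<lambda>j. dL \<nu> (h j) f) \<longlonglongrightarrow> 0"
    proof (rule tendsto_sandwich[OF _ _ tendsto_const LIMSEQ_inverse_real_of_nat])
      show "\<forall>\<^sub>F j in sequentially. 0 \<le> dL \<nu> (h j) f" by (intro always_eventually allI dL_nonneg)
      show "\<forall>\<^sub>F j in sequentially. dL \<nu> (h j) f \<le> inverse (real (Suc j))"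
        using h(2) by (intro always_eventually allI) (simp add: dL_commute[of "h _"] less_imp_le)
    qed
    from dL_subseq[OF h(1) f(2) this] obtain r :: "nat \<Rightarrow> nat" where r: "AE x in \<nu>. (\<lambda>j. h (r j) x) \<longlonglongrightarrow> f x" by blast
    have "limitin (P_mu_topology \<mu>) (\<lambda>j. orb_law \<nu> a (h (r j))) (orb_law \<nu> a f) sequentially"
      using a(1) unfolding V_def by (intro limitin_orb_law_fun[OF gen _ h(1) f(2) r]) simp
    then have "\<forall>\<^sub>F j in sequentially. orb_law \<nu> a (h (r j)) \<in> U (fst (prod_decode k))"
      using U(1) a(2) unfolding limitin_def by blast
    then obtain j where "orb_law \<nu> a (h (r j)) \<in> U (fst (prod_decode k))" by (auto dest: eventually_happens)
    then have "h (r j) \<in> W k" unfolding W_def using a(1) by blast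
    then show False using h(3) by blast
  qed
  \<comment> \<open>The orbit law of the given pair of action and isomorphism is perturbed inside
    the space of measures, into \<open>U n\<close> and into \<open>Good\<close>. Splitting the new
    measure into its own action and isomorphism moves both only slightly, by
    \<open>good_neighborhood\<close>.\<close>
  have dense: "\<exists>h\<in>M. h \<in> W k \<and> dL \<nu> f h < \<epsilon>" if f: "f \<in> M" and \<epsilon>: "\<epsilon> > 0" for f k and \<epsilon> :: real
  proof (cases "V (snd (prod_decode k)) = {}")
    case True
    then have "f \<in> W k" unfolding W_def by simp
    then show ?thesis using f \<epsilon> by (intro bexI[of _ f]) simp_all
  next
    case False
    define n where "n = fst (prod_decode k)"
    define j where "j = snd (prod_decode k)"
    obtain a where a: "stat_action \<mu> \<nu> a" "acoord \<nu> a \<in> base_set j" using False unfolding V_def j_def by blast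
    obtain m where m: "f = iso \<nu> m" "good_law m" using f unfolding M_def by blast
    then have na: "nonatomic_prob m" unfolding good_law_def by blast
    define \<eta> where "\<eta> = orb_law \<nu> a (iso \<nu> m)"
    have \<eta>: "law0 \<eta> = m" "chat \<eta> = acoord \<nu> a" "\<eta> \<in> P_mu \<mu>"
      using acoord_eq_chat[OF gen \<nu> a(1) na] orb_law_in_P_mu[OF a(1) measurable_iso'[OF \<nu> na]]
      unfolding \<eta>_def by auto
    have "\<exists>N. openin (P_mu_topology \<mu>) N \<and> \<eta> \<in> N \<and> (\<forall>\<zeta>\<in>N. good_law (law0 \<zeta>) \<longrightarrow>
      chat \<zeta> \<in> base_set j \<and> dL \<nu> (iso \<nu> (law0 \<eta>)) (iso \<nu> (law0 \<zeta>)) < \<epsilon>)"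
      by (rule good_neighborhood[OF gen \<nu> \<eta>(3) _ open_base_set _ \<epsilon>]) (use m(2) a(2) in \<open>simp_all add: \<eta>\<close>)
    then obtain N where N: "openin (P_mu_topology \<mu>) N" "\<eta> \<in> N"
      "\<And>\<zeta>. \<zeta> \<in> N \<Longrightarrow> good_law (law0 \<zeta>) \<Longrightarrow> chat \<zeta> \<in> base_set j \<and> dL \<nu> f (iso \<nu> (law0 \<zeta>)) < \<epsilon>"
      unfolding \<eta>(1) m(1) by blast
    have "openin (P_mu_topology \<mu>) (N \<inter> U n)" by (intro openin_Int N(1) U(1))
    moreover have "N \<inter> U n \<noteq> {}"
      using U(2)[of n] closure_of_eq_topspace_iff[OF openin_subset[OF U(1)], of n] N(1,2) by blast
    ultimately obtain \<zeta> where \<zeta>: "\<zeta> \<in> N" "\<zeta> \<in> U n" "\<zeta> \<in> Good \<mu> \<nu>" using Good_dense[OF gen \<nu>] by blast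
    have l: "good_law (law0 \<zeta>)" using \<zeta>(3) unfolding Good_def by blast
    then have lna: "nonatomic_prob (law0 \<zeta>)" unfolding good_law_def by blast
    obtain b where b: "stat_action \<mu> \<nu> b" "orb_law \<nu> b (iso \<nu> (law0 \<zeta>)) = \<zeta>" using \<zeta>(3) unfolding Good_def by blast
    have "acoord \<nu> b = chat \<zeta>" using acoord_eq_chat(2)[OF gen \<nu> b(1) lna] unfolding b(2) .
    then have "b \<in> V j" using N(3)[OF \<zeta>(1) l] b(1) unfolding V_def by simp
    moreover have "orb_law \<nu> b (iso \<nu> (law0 \<zeta>)) \<in> U n" unfolding b(2) by (rule \<zeta>(2))
    ultimately have "iso \<nu> (law0 \<zeta>) \<in> W k" unfolding W_def n_def j_def by blast
    moreover have "iso \<nu> (law0 \<zeta>) \<in> M" using l unfolding M_def by blast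
    ultimately show ?thesis using N(3)[OF \<zeta>(1) l] by blast
  qed
  obtain F f where F: "\<And>k. F k \<in> M" and f: "f \<in> borel_measurable \<nu>" "AE x in \<nu>. (\<lambda>k. F k x) \<longlonglongrightarrow> f x" "\<And>k. f \<in> W k"
    using dL_baire[of f0 M W, OF f0 M op dense] by blast
  have "\<forall>k. \<exists>m. F k = iso \<nu> m \<and> good_law m" using F unfolding M_def by blast
  then obtain m where m: "\<And>k. F k = iso \<nu> (m k)" "\<And>k. good_law (m k)" by metis
  have mna: "nonatomic_prob (m k)" for k using m(2) unfolding good_law_def by blast
  have fb: "f \<in> borel_measurable borel" using f(1) by (simp add: measurable_nonatomic_prob[OF \<nu>])
  \<comment> \<open>With \<open>f\<close> fixed, openness comes from continuity of the orbit law in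
    the action, and density is membership of \<open>f\<close> in the sets
    \<open>W k\<close>.\<close>
  define R where "R n = {a \<in> topspace (A_mu_topology \<mu> \<nu>). orb_law \<nu> a f \<in> U n}" for n
  have Ro: "openin (A_mu_topology \<mu> \<nu>) (R n)" for n
    unfolding R_def by (rule openin_continuous_map_preimage[OF continuous_map_orb_law[OF gen \<nu> fb] U(1)])
  have Rd: "A_mu_topology \<mu> \<nu> closure_of R n = topspace (A_mu_topology \<mu> \<nu>)" for n
  proof (subst closure_of_eq_topspace_iff[OF openin_subset[OF Ro]], intro allI impI)
    fix X assume X: "openin (A_mu_topology \<mu> \<nu>) X" "X \<noteq> {}"
    then obtain O' where O': "open O'" "X = acoord \<nu> -` O' \<inter> A_mu \<mu> \<nu>"
      unfolding A_mu_topology_eq[OF gen \<nu>] openin_pullback_topology by auto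
    obtain a where a: "a \<in> X" using X(2) by blast
    then have "acoord \<nu> a \<in> O'" unfolding O'(2) by blast
    then obtain j where j: "acoord \<nu> a \<in> base_set j" "base_set j \<subseteq> O'" using base_set_neighborhood[OF O'(1)] by blast
    have "a \<in> V j" using a j(1) A unfolding O'(2) V_def by blast
    then obtain b where b: "b \<in> V j" "orb_law \<nu> b f \<in> U n"
      using f(3)[of "prod_encode (n, j)"] unfolding W_def by auto
    have "b \<in> X" using b(1) j(2) A unfolding O'(2) V_def by blast
    moreover have "b \<in> R n" using b A unfolding R_def V_def by (simp add: topspace_A_mu_topology)
    ultimately show "X \<inter> R n \<noteq> {}" by blast
  qed
  have "residual_in (A_mu_topology \<mu> \<nu>) (\<Inter>n. R n)" by (rule residual_in_INT[OF Ro Rd])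
  moreover have "(\<Inter>n. R n) \<subseteq> ?R"
  proof
    fix a assume a: "a \<in> (\<Inter>n. R n)"
    then have "a \<in> A_mu \<mu> \<nu>" unfolding R_def by (simp add: topspace_A_mu_topology)
    then have as: "stat_action \<mu> \<nu> a" using A by blast
    have "orb_law \<nu> a f \<in> (\<Inter>n. U n)" using a unfolding R_def by blast
    then have S': "orb_law \<nu> a f \<in> S" "orb_law \<nu> a f \<in> Good \<mu> \<nu>" using U(3) by blast+
    define l where "l = distr \<nu> borel f"
    have l: "good_law l"
      using S'(2) law0_orb_law[OF as f(1)] unfolding Good_def l_def by simp
    then have lna: "nonatomic_prob l" unfolding good_law_def by blast
    have "AE x in \<nu>. f x = iso \<nu> l x"
      unfolding l_def by (rule limit_of_isos[OF \<nu> mna f(1) l[unfolded l_def]]) (use f(2) in \<open>simp add: m(1)\<close>)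
    then have "AE x in \<nu>. iso l \<nu> (f x) = x" using iso_inverse[OF \<nu> lna] by eventually_elim simp
    moreover have "iso l \<nu> \<in> measurable borel \<nu>"
      using measurable_iso[OF lna \<nu>] by (simp add: measurable_nonatomic_prob[OF \<nu>])
    ultimately show "a \<in> ?R" using as f(1) S'(1) by blast
  qed
  ultimately show ?thesis by (rule residual_in_mono)
qed

text \<open>Each transfer lemma yields a residual set whose members come with an almost everywhere
  injective observing function, and the orbit map of such a function is a conjugacy across which the
  property passes.\<close>

theorem theorem1p7:
  fixes \<mu> :: "'g::{group_add,countable} pmf"
    and \<nu> :: "'x::polish_space measure"
    and PX :: "'x measure \<Rightarrow> ('g \<Rightarrow> 'x \<Rightarrow> 'x) \<Rightarrow> bool"
    and PZ :: "('g \<Rightarrow> 'z::{polish_space,perfect_space}) measure \<Rightarrow> ('g \<Rightarrow> ('g \<Rightarrow> 'z) \<Rightarrow> ('g \<Rightarrow> 'z)) \<Rightarrow> bool"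
  assumes "gen_semigroup (set_pmf \<mu>) = UNIV"
    and "sets \<nu> = sets borel" and "prob_space \<nu>" and "\<forall>x. emeasure \<nu> {x} = 0"
    and "dynamical_property PX PZ"
  shows "residual_in (A_mu_topology \<mu> \<nu>) {a \<in> A_mu \<mu> \<nu>. PX \<nu> a}
     \<longleftrightarrow> residual_in (P_mu_topology \<mu>) {\<eta> \<in> P_mu \<mu>. PZ \<eta> shift_action}"
proof -
  note gen = assms(1)
  have \<nu>: "nonatomic_prob \<nu>"
    unfolding nonatomic_prob_def using assms(2-4) by (simp add: measure_def)
  note A = A_mu_iff[OF gen assms(3)]
  have dyn: "PX \<nu> a \<longleftrightarrow> PZ \<eta> shift_action" if "conjugate \<nu> a \<eta> shift_action" for a \<eta>
    using assms(5) that unfolding dynamical_property_def by blast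
  have conj: "conjugate \<nu> a (orb_law \<nu> a f) shift_action"
    if "stat_action \<mu> \<nu> a" "f \<in> borel_measurable \<nu>" "e \<in> measurable borel \<nu>" "AE x in \<nu>. e (f x) = x"
    for a e and f :: "'x \<Rightarrow> 'z"
    by (rule conjugate_orb_law[OF gen that])
  show ?thesis
  proof
    assume "residual_in (A_mu_topology \<mu> \<nu>) {a \<in> A_mu \<mu> \<nu>. PX \<nu> a}"
    from residual_P_mu_of_A_mu[OF gen \<nu> this]
    show "residual_in (P_mu_topology \<mu>) {\<eta> \<in> P_mu \<mu>. PZ \<eta> shift_action}"
    proof (rule residual_in_mono, intro subsetI)
      fix \<eta> :: "('g \<Rightarrow> 'z) measure"
      assume "\<eta> \<in> {\<eta>. nonatomic_prob (law0 \<eta>) \<and> (\<exists>a\<in>{a \<in> A_mu \<mu> \<nu>. PX \<nu> a}.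
        stat_action \<mu> \<nu> a \<and> orb_law \<nu> a (iso \<nu> (law0 \<eta>)) = \<eta>)}"
      then obtain a where na: "nonatomic_prob (law0 \<eta>)" and a: "PX \<nu> a" "stat_action \<mu> \<nu> a"
        and eq: "orb_law \<nu> a (iso \<nu> (law0 \<eta>)) = \<eta>" by blast
      have f: "iso \<nu> (law0 \<eta>) \<in> borel_measurable \<nu>" by (rule measurable_iso'[OF \<nu> na])
      have e: "iso (law0 \<eta>) \<nu> \<in> measurable borel \<nu>"
        using measurable_iso[OF na \<nu>] by (simp add: measurable_nonatomic_prob[OF \<nu>])
      have "conjugate \<nu> a \<eta> shift_action"
        using conj[OF a(2) f e iso_inverse[OF \<nu> na]] unfolding eq .
      then have "PZ \<eta> shift_action" using dyn a(1) by blast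
      moreover have "\<eta> \<in> P_mu \<mu>" using orb_law_in_P_mu[OF a(2) f] unfolding eq .
      ultimately show "\<eta> \<in> {\<eta> \<in> P_mu \<mu>. PZ \<eta> shift_action}" by blast
    qed
  next
    assume "residual_in (P_mu_topology \<mu>) {\<eta> \<in> P_mu \<mu>. PZ \<eta> shift_action}"
    from residual_A_mu_of_P_mu[OF gen \<nu> this]
    show "residual_in (A_mu_topology \<mu> \<nu>) {a \<in> A_mu \<mu> \<nu>. PX \<nu> a}"
    proof (rule residual_in_mono, intro subsetI)
      fix a
      assume "a \<in> {a. stat_action \<mu> \<nu> a \<and> (\<exists>f e. f \<in> borel_measurable \<nu> \<and> e \<in> measurable borel \<nu> \<and>
        (AE x in \<nu>. e (f x) = x) \<and> orb_law \<nu> a f \<in> {\<eta> \<in> P_mu \<mu>. PZ \<eta> shift_action})}"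
      then obtain f :: "'x \<Rightarrow> 'z" and e where a: "stat_action \<mu> \<nu> a"
        and fe: "f \<in> borel_measurable \<nu>" "e \<in> measurable borel \<nu>" "AE x in \<nu>. e (f x) = x"
        and P: "PZ (orb_law \<nu> a f) shift_action" by blast
      have "PX \<nu> a" using dyn[OF conj[OF a fe]] P by blast
      then show "a \<in> {a \<in> A_mu \<mu> \<nu>. PX \<nu> a}" using a A by blast
    qed
  qed
qed

end
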